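(* Let $v\in C([0,T);C^1(\mathbb{R}^3;\mathbb{R}^3))$, for some $T>0$, be a solution of the 3D incompressible Euler equations, and let $\omega=\mathrm{curl}\,v$. Suppose that the vorticity has the representation $$\omega(x,t)=\Psi(t)\,\Omega(\Phi(t)x)\qquad\text{for all }x\in\mathbb{R}^3,\ t\in[0,T),$$ where $\Psi\in C([0,T);(0,\infty))$; $\Phi\in C([0,T);\mathbb{R}^{3\times3})$ with $\det(\Phi(t))\neq0$ on $[0,T)$; $\Omega=\mathrm{curl}\,V$ for some $V$; and there exists $p_1>0$ such that $\Omega\in L^p(\mathbb{R}^3;\mathbb{R}^3)$ for all $p\in(0,p_1)$. Then necessarily either $\det(\Phi(t))=\det(\Phi(0))$ for all $t\in[0,T)$, or $\Omega=0$.
   Context: The 3D incompressible Euler equations are $$\frac{\partial v}{\partial t}+(v\cdot\nabla)v=-\nabla p,\qquad \mathrm{div}\,v=0,\qquad v(x,0)=v_0(x),$$ for the velocity $v=(v_1,v_2,v_3)(x,t)$ and a scalar pressure $p=p(x,t)$, $x\in\mathbb{R}^3$, with $\mathrm{div}\,v_0=0$. The condition $v\in C([0,T);C^1(\mathbb{R}^3;\mathbb{R}^3))$ means that $v(\cdot,t)$ is $C^1$ in $x$ with bounded gradient, $v$ is continuous in $(x,t)$, and $t\mapsto\nabla v(\cdot,t)$ is continuous from $[0,T)$ into the bounded continuous functions with the sup norm. The velocity itself is not required to be bounded. For $0<p<1$, $\Omega\in L^p$ means that $\Omega$ is measurable and $\int|\Omega|^p\,dx<\infty$. *)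

theory Defs
  imports "HOL-Analysis.Analysis"
begin

text \<open>
  The entry \<open>jacobian f (at x) $ i $ j\<close> is the partial derivative of the
  \<open>i\<close>-th component of \<open>f\<close> in the \<open>j\<close>-th variable.
\<close>

definition divergence :: "(real^3 \<Rightarrow> real^3) \<Rightarrow> real^3 \<Rightarrow> real" where
  "divergence f x = trace (jacobian f (at x))"

definition curl :: "(real^3 \<Rightarrow> real^3) \<Rightarrow> real^3 \<Rightarrow> real^3" where
  "curl f x = (let D = jacobian f (at x) in
     vector [D $ 3 $ 2 - D $ 2 $ 3, D $ 1 $ 3 - D $ 3 $ 1, D $ 2 $ 1 - D $ 1 $ 2])"

text \<open>The convective term \<open>(v \<cdot> \<nabla>)v\<close> of a velocity field at a fixed time.\<close>

definition convection :: "(real^3 \<Rightarrow> real^3) \<Rightarrow> real^3 \<Rightarrow> real^3" where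
  "convection u x = jacobian u (at x) *v u x"

text \<open>
  The class \<open>C([0,T); C\<^sup>1)\<close>. The space of bounded continuous functions is the library
  type \<open>bcontfun\<close>, whose metric is the sup metric; \<open>Bcontfun\<close> is its abstraction
  function, meaningful only on the set \<open>bcontfun\<close>.
\<close>

definition cont_C1 :: "real \<Rightarrow> (real^3 \<Rightarrow> real \<Rightarrow> real^3) \<Rightarrow> bool" where
  "cont_C1 T v \<longleftrightarrow>
     continuous_on (UNIV \<times> {0..<T}) (\<lambda>(x, t). v x t) \<and>
     (\<forall>t\<in>{0..<T}. (\<forall>x. (\<lambda>y. v y t) differentiable (at x)) \<and>
        (\<lambda>x. jacobian (\<lambda>y. v y t) (at x)) \<in> bcontfun) \<and>
     continuous_on {0..<T} (\<lambda>t. Bcontfun (\<lambda>x. jacobian (\<lambda>y. v y t) (at x)))"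

definition test_field :: "real \<Rightarrow> ((real^3) \<times> real \<Rightarrow> real^3) \<Rightarrow> bool" where
  "test_field T \<phi> \<longleftrightarrow>
     (\<forall>z. \<phi> differentiable (at z)) \<and>
     (\<forall>d. continuous_on UNIV (\<lambda>z. frechet_derivative \<phi> (at z) d)) \<and>
     (\<exists>K. compact K \<and> K \<subseteq> UNIV \<times> {0<..<T} \<and> (\<forall>z. z \<notin> K \<longrightarrow> \<phi> z = 0))"

definition locally_integrable :: "real \<Rightarrow> (real^3 \<Rightarrow> real \<Rightarrow> real) \<Rightarrow> bool" where
  "locally_integrable T p \<longleftrightarrow>
     (\<forall>K. compact K \<and> K \<subseteq> UNIV \<times> {0<..<T} \<longrightarrow> set_integrable lebesgue K (\<lambda>(x, t). p x t))"

text \<open>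
  The momentum equation \<open>\<partial>\<^sub>t v + (v \<cdot> \<nabla>)v = - \<nabla>p\<close> on \<open>\<real>\<^sup>3 \<times> (0,T)\<close>. The class
  \<open>C([0,T); C\<^sup>1)\<close> gives no meaning to \<open>\<partial>\<^sub>t v\<close>, so this derivative and \<open>\<nabla>p\<close> are
  taken in the sense of distributions. Since \<open>v\<close> is continuous and \<open>p\<close> locally integrable,
  test fields of class \<open>C\<^sup>1\<close> and of class \<open>C\<^sup>\<infinity>\<close> give the same notion. The lemma
  \<open>classical_momentum_eq\<close> below shows that classical solutions are included.
\<close>

definition momentum_eq ::
  "real \<Rightarrow> (real^3 \<Rightarrow> real \<Rightarrow> real^3) \<Rightarrow> (real^3 \<Rightarrow> real \<Rightarrow> real) \<Rightarrow> bool" where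
  "momentum_eq T v p \<longleftrightarrow>
     (\<forall>\<phi>. test_field T \<phi> \<longrightarrow>
        (LINT (x, t) : UNIV \<times> {0<..<T} | lebesgue.
           v x t \<bullet> vector_derivative (\<lambda>s. \<phi> (x, s)) (at t)
           - convection (\<lambda>y. v y t) x \<bullet> \<phi> (x, t)
           + p x t * divergence (\<lambda>y. \<phi> (y, t)) x) = 0)"

definition euler_solution ::
  "real \<Rightarrow> (real^3 \<Rightarrow> real^3) \<Rightarrow> (real^3 \<Rightarrow> real \<Rightarrow> real^3) \<Rightarrow> bool" where
  "euler_solution T v\<^sub>0 v \<longleftrightarrow>
     (\<exists>p. locally_integrable T p \<and> momentum_eq T v p) \<and>
     (\<forall>t\<in>{0..<T}. \<forall>x. divergence (\<lambda>y. v y t) x = 0) \<and>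
     (\<forall>x. v x 0 = v\<^sub>0 x)"

definition in_Lp :: "real \<Rightarrow> (real^3 \<Rightarrow> real^3) \<Rightarrow> bool" where
  "in_Lp p f \<longleftrightarrow> f \<in> borel_measurable lebesgue \<and> integrable lebesgue (\<lambda>x. norm (f x) powr p)"

lemma zero_ext:
  fixes f :: "'a::t2_space \<Rightarrow> 'b::real_normed_vector"
  assumes "open U" "compact K" "K \<subseteq> U" "continuous_on U f" "\<And>z. z \<notin> K \<Longrightarrow> f z = 0"
  shows "continuous_on UNIV f"
proof -
  have "continuous_on (- K) f"
    by (rule continuous_on_eq[of _ "\<lambda>_. 0"]) (use assms in auto)
  moreover have "open (- K)" using assms by (simp add: compact_imp_closed open_Compl)
  ultimately have "continuous_on (U \<union> - K) f"
    using assms by (intro continuous_on_open_Un) auto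
  moreover have "U \<union> - K = UNIV" using assms by auto
  ultimately show ?thesis by simp
qed

lemma integral_dir_deriv:
  fixes h h' :: "'a::euclidean_space \<Rightarrow> real"
  assumes K: "compact K" "\<And>z. z \<notin> K \<Longrightarrow> h z = 0" "\<And>z. z \<notin> K \<Longrightarrow> h' z = 0"
    and ch: "continuous_on UNIV h" and ch': "continuous_on UNIV h'"
    and d: "\<And>z. ((\<lambda>r. h (z + r *\<^sub>R e)) has_real_derivative h' z) (at 0)"
  shows "integrable lebesgue h'" and "integral\<^sup>L lebesgue h' = 0"
proof -
  have mh[measurable]: "h \<in> borel_measurable borel" "h' \<in> borel_measurable borel"
    using ch ch' by (auto intro: borel_measurable_continuous_onI)
  have int: "integrable lborel f" if "continuous_on UNIV f" "\<And>z. z \<notin> K \<Longrightarrow> f z = 0" for f :: "'a \<Rightarrow> real"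
  proof -
    have "set_integrable lborel K f"
      using K(1) that(1) borel_integrable_compact[of K f] continuous_on_subset
      by (auto simp: set_integrable_def)
    moreover have "(\<lambda>z. indicator K z *\<^sub>R f z) = f" using that(2) by (intro ext) (auto simp: indicator_def)
    ultimately show ?thesis by (simp add: set_integrable_def)
  qed
  have ih: "integrable lborel h" "integrable lborel h'" using int ch ch' K by auto
  have d2: "((\<lambda>r. h (z + r *\<^sub>R e)) has_real_derivative h' (z + r *\<^sub>R e)) (at r)" for z r
  proof -
    have "((\<lambda>s. h ((z + r *\<^sub>R e) + s *\<^sub>R e)) has_real_derivative h' (z + r *\<^sub>R e)) (at (r - r))"
      using d[of "z + r *\<^sub>R e"] by simp
    then have "((\<lambda>s. h ((z + r *\<^sub>R e) + (s - r) *\<^sub>R e)) has_real_derivative h' (z + r *\<^sub>R e)) (at r)"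
      using DERIV_shift[of "\<lambda>s. h ((z + r *\<^sub>R e) + s *\<^sub>R e)" "h' (z + r *\<^sub>R e)" r "- r"] by simp
    then show ?thesis by (simp add: algebra_simps)
  qed
  obtain M where M: "\<And>z. \<bar>h' z\<bar> \<le> M" 
  proof -
    have "bounded (h' ` K)" 
      by (intro compact_imp_bounded compact_continuous_image continuous_on_subset[OF ch'] K(1)) simp
    then obtain M where "\<And>z. z \<in> K \<Longrightarrow> \<bar>h' z\<bar> \<le> M" "M > 0" by (auto simp: bounded_pos)
    then have "\<bar>h' z\<bar> \<le> M" for z using K(3)[of z] by (cases "z \<in> K") auto
    then show ?thesis using that by blast
  qed
  define K' where "K' = (\<lambda>(k, r). k - r *\<^sub>R e) ` (K \<times> {0..1::real})"
  have cK': "compact K'" unfolding K'_def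
    by (intro compact_continuous_image compact_Times K(1)) (auto intro!: continuous_intros simp: case_prod_unfold)
  define s where "s n z = (h (z + (1 / real (Suc n)) *\<^sub>R e) - h z) / (1 / real (Suc n))" for n z
  have bnd: "norm (s n z) \<le> M * indicator K' z" for n z
  proof -
    define r where "r = 1 / real (Suc n)"
    have r: "0 < r" "r \<le> 1" by (auto simp: r_def)
    have "\<exists>\<xi>. 0 < \<xi> \<and> \<xi> < r \<and> h (z + r *\<^sub>R e) - h (z + 0 *\<^sub>R e) = (r - 0) * h' (z + \<xi> *\<^sub>R e)"
      by (rule MVT2) (use r d2 in auto)
    then obtain \<xi> where xi: "0 < \<xi>" "\<xi> < r" "h (z + r *\<^sub>R e) - h z = r * h' (z + \<xi> *\<^sub>R e)" by auto
    have s: "s n z = h' (z + \<xi> *\<^sub>R e)" unfolding s_def r_def[symmetric] xi(3) using r by simp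
    show ?thesis
    proof (cases "z \<in> K'")
      case True then show ?thesis using s M by simp
    next
      case False
      have "z + \<xi> *\<^sub>R e \<notin> K"
      proof
        assume "z + \<xi> *\<^sub>R e \<in> K"
        then have "(\<lambda>(k, r). k - r *\<^sub>R e) (z + \<xi> *\<^sub>R e, \<xi>) \<in> K'" unfolding K'_def
          using xi r by (intro imageI) auto
        then show False using False by simp
      qed
      then show ?thesis using s K(3) False by simp
    qed
  qed
  have lim: "(\<lambda>n. s n z) \<longlonglongrightarrow> h' z" for z
  proof -
    have "((\<lambda>r. (h (z + r *\<^sub>R e) - h z) / r) \<longlongrightarrow> h' z) (at 0)"
      using d[of z] by (simp add: has_field_derivative_iff)
    moreover have "filterlim (\<lambda>n. 1 / real (Suc n)) (at 0) sequentially"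
      unfolding filterlim_at using lim_1_over_n LIMSEQ_Suc by (auto simp del: of_nat_Suc intro!: always_eventually)
    ultimately show ?thesis unfolding s_def by (rule filterlim_compose)
  qed
  have z: "integral\<^sup>L lborel (s n) = 0" for n
  proof -
    let ?c = "(1 / real (Suc n)) *\<^sub>R e"
    have e: "integrable lborel (\<lambda>z. h (?c + z))" "integral\<^sup>L lborel (\<lambda>z. h (?c + z)) = integral\<^sup>L lborel h"
    proof -
      have "integrable (distr lborel borel ((+) ?c)) h" using ih(1) lborel_distr_plus[of ?c] by simp
      then show "integrable lborel (\<lambda>z. h (?c + z))" by (subst (asm) integrable_distr_eq) auto
      have "integral\<^sup>L (distr lborel borel ((+) ?c)) h = integral\<^sup>L lborel h" using lborel_distr_plus[of ?c] by simp
      then show "integral\<^sup>L lborel (\<lambda>z. h (?c + z)) = integral\<^sup>L lborel h"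
        by (subst (asm) integral_distr) auto
    qed
    have "s n = (\<lambda>z. (h (?c + z) - h z) / (1 / real (Suc n)))" by (auto simp: s_def add.commute)
    then show ?thesis using e ih by simp
  qed
  have "integrable lborel (indicator K' :: 'a \<Rightarrow> real)"
    using cK' borel_integrable_compact[OF cK', of "\<lambda>_. 1::real"] by simp
  then have "integrable lborel (\<lambda>z. M * indicator K' z)" by simp
  then have "(\<lambda>n. integral\<^sup>L lborel (s n)) \<longlonglongrightarrow> integral\<^sup>L lborel h'"
    by (intro integral_dominated_convergence[where w="\<lambda>z. M * indicator K' z"])
       (auto intro!: AE_I2 lim bnd simp del: real_norm_def, auto simp: s_def[abs_def])
  then have "integral\<^sup>L lborel h' = 0" using z by (simp add: LIMSEQ_const_iff)
  then show "integral\<^sup>L lebesgue h' = 0" using integral_completion[of h' lborel] by simp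
  show "integrable lebesgue h'" using ih integrable_completion[of h' lborel] by simp
qed

text \<open>
  Classical solutions, where \<open>\<partial>\<^sub>t v\<close> and \<open>\<nabla>p\<close> exist, are jointly continuous and satisfy the
  momentum equation at every point, are covered by \<open>momentum_eq\<close>.
\<close>

lemma classical_momentum_eq:
  fixes v v' :: "real^3 \<Rightarrow> real \<Rightarrow> real^3" and p :: "real^3 \<Rightarrow> real \<Rightarrow> real" and g :: "real^3 \<Rightarrow> real \<Rightarrow> real^3"
  assumes v: "continuous_on (UNIV \<times> {0<..<T}) (\<lambda>(x, t). v x t)"
    and v': "continuous_on (UNIV \<times> {0<..<T}) (\<lambda>(x, t). v' x t)"
    and p: "continuous_on (UNIV \<times> {0<..<T}) (\<lambda>(x, t). p x t)"
    and g: "continuous_on (UNIV \<times> {0<..<T}) (\<lambda>(x, t). g x t)"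
    and dv: "\<And>x t. t \<in> {0<..<T} \<Longrightarrow> ((\<lambda>s. v x s) has_vector_derivative v' x t) (at t)"
    and dp: "\<And>x t. t \<in> {0<..<T} \<Longrightarrow> ((\<lambda>y. p y t) has_derivative (\<lambda>h. g x t \<bullet> h)) (at x)"
    and eq: "\<And>x t. t \<in> {0<..<T} \<Longrightarrow> v' x t + convection (\<lambda>y. v y t) x = - g x t"
  shows "locally_integrable T p" and "momentum_eq T v p"
proof -
  let ?U = "UNIV \<times> {0<..<T} :: ((real^3) \<times> real) set"
  have oU: "open ?U" by (intro open_Times) auto
  show "locally_integrable T p"
    unfolding locally_integrable_def
  proof (intro allI impI)
    fix K :: "((real^3) \<times> real) set" assume "compact K \<and> K \<subseteq> ?U"
    then have "integrable lborel (\<lambda>z. indicator K z *\<^sub>R (case z of (x, t) \<Rightarrow> p x t))"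
      using borel_integrable_compact[of K "\<lambda>(x, t). p x t"] continuous_on_subset[OF p] by auto
    then show "set_integrable lebesgue K (\<lambda>(x, t). p x t)"
      unfolding set_integrable_def
      by (subst integrable_completion) (auto dest: borel_measurable_integrable)
  qed
  show "momentum_eq T v p"
    unfolding momentum_eq_def
  proof (intro allI impI)
    fix \<phi> :: "(real^3) \<times> real \<Rightarrow> real^3" assume tf: "test_field T \<phi>"
    define D where "D z d = frechet_derivative \<phi> (at z) d" for z d
    have D: "(\<phi> has_derivative D z) (at z)" for z
    proof -
      have "\<phi> differentiable (at z)" using tf unfolding test_field_def by blast
      then show ?thesis using frechet_derivative_works unfolding D_def by metis
    qed
    have cD: "continuous_on UNIV (\<lambda>z. D z d)" for d using tf unfolding test_field_def D_def by blast
    have c\<phi>: "continuous_on UNIV \<phi>"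
      
      by (intro continuous_at_imp_continuous_on ballI has_derivative_continuous[OF D])
    obtain K where K: "compact K" "K \<subseteq> ?U" "\<And>z. z \<notin> K \<Longrightarrow> \<phi> z = 0"
      using tf unfolding test_field_def by blast
    have oK: "open (- K)" using K(1) by (simp add: compact_imp_closed open_Compl)
    have D0: "D z d = 0" if "z \<notin> K" for z d
    proof -
      have "((\<lambda>_. 0) has_derivative D z) (at z)"
        by (rule has_derivative_transform_within_open[OF D oK]) (use that K in auto)
      then have "D z = (\<lambda>_. 0)" by (rule has_derivative_unique[OF _ has_derivative_const])
      then show ?thesis by simp
    qed
    have Dline: "((\<lambda>r. \<phi> (z + r *\<^sub>R d)) has_vector_derivative D z d) (at 0)" for z d
    proof -
      have "((\<lambda>r. z + r *\<^sub>R d) has_vector_derivative d) (at 0)"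
        by (auto intro!: derivative_eq_intros)
      moreover have "(\<phi> has_derivative D z) (at (z + 0 *\<^sub>R d))" using D by simp
      ultimately show ?thesis
        using vector_derivative_diff_chain_within[of "\<lambda>r. z + r *\<^sub>R d" d 0 UNIV \<phi> "D z"]
        by (auto simp: o_def intro: has_derivative_at_withinI)
    qed
    have near: "\<forall>\<^sub>F r in nhds 0. z + r *\<^sub>R d \<in> S" if "open S" "z \<in> S" for z d and S :: "((real^3) \<times> real) set"
    proof -
      have "((\<lambda>r. z + r *\<^sub>R d) \<longlongrightarrow> z + 0 *\<^sub>R d) (nhds 0)"
        by (intro tendsto_intros filterlim_ident)
      then show ?thesis using that topological_tendstoD by fastforce
    qed
    have zero_deriv: "(h has_real_derivative 0) (at 0)" if "\<forall>\<^sub>F r in nhds 0. h r = 0" for h :: "real \<Rightarrow> real"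
      using DERIV_cong_ev[of 0 0 h "\<lambda>_. 0" 0 0] that by simp

    define h0 where "h0 = (\<lambda>z. v (fst z) (snd z) \<bullet> \<phi> z)"
    define h0' where "h0' = (\<lambda>z. v' (fst z) (snd z) \<bullet> \<phi> z + v (fst z) (snd z) \<bullet> D z (0, 1))"
    define hi where "hi = (\<lambda>i z. p (fst z) (snd z) * \<phi> z $ i)"
    define hi' where "hi' = (\<lambda>i z. g (fst z) (snd z) $ i * \<phi> z $ i + p (fst z) (snd z) * D z (axis i 1, 0) $ i)"
    note cc = v[unfolded case_prod_unfold] v'[unfolded case_prod_unfold] p[unfolded case_prod_unfold]
      g[unfolded case_prod_unfold] continuous_on_subset[OF c\<phi> subset_UNIV] continuous_on_subset[OF cD subset_UNIV]
    have A: "integrable lebesgue h0'" "integral\<^sup>L lebesgue h0' = 0"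
    proof -
      have c: "continuous_on UNIV h0" "continuous_on UNIV h0'"
        by (rule zero_ext[OF oU K(1,2)];
            force simp: h0_def h0'_def K(3) D0 intro!: continuous_intros cc)+
      have "((\<lambda>r. h0 (z + r *\<^sub>R (0, 1))) has_real_derivative h0' z) (at 0)" for z
      proof (cases "z \<in> K")
        case True
        then have t: "snd z \<in> {0<..<T}" using K(2) by auto
        have "((\<lambda>s. v (fst z) s) has_vector_derivative v' (fst z) (snd z)) (at (snd z + 0))"
          using dv[OF t] by simp
        moreover have "((\<lambda>r. snd z + r) has_vector_derivative 1) (at 0)"
          by (auto intro!: derivative_eq_intros)
        ultimately have "((\<lambda>r. v (fst z) (snd z + r)) has_vector_derivative v' (fst z) (snd z)) (at 0)"
          using vector_diff_chain_at[of "\<lambda>r. snd z + r" 1 0 "\<lambda>s. v (fst z) s" "v' (fst z) (snd z)"]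
          by (simp add: o_def)
        then have "((\<lambda>r. v (fst z) (snd z + r) \<bullet> \<phi> (z + r *\<^sub>R (0, 1))) has_vector_derivative
            (v (fst z) (snd z + 0) \<bullet> D z (0, 1) + v' (fst z) (snd z) \<bullet> \<phi> (z + 0 *\<^sub>R (0, 1)))) (at 0)"
          by (rule bounded_bilinear.has_vector_derivative[OF bounded_bilinear_inner _ Dline])
        then show ?thesis
          by (simp add: h0_def h0'_def has_real_derivative_iff_has_vector_derivative add.commute zero_prod_def[symmetric])
      next
        case False
        have "h0' z = 0" using K(3)[OF False] D0[OF False] by (simp add: h0'_def)
        moreover have "\<forall>\<^sub>F r in nhds 0. h0 (z + r *\<^sub>R (0, 1)) = 0"
          by (rule eventually_mono[OF near[OF oK, of z "(0, 1)"]]) (use False K(3) in \<open>unfold h0_def, simp_all del: scaleR_Pair\<close>)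
        ultimately show ?thesis by (simp only: zero_deriv)
      qed
      moreover have "h0 z = 0" "h0' z = 0" if "z \<notin> K" for z
        using K(3)[OF that] D0[OF that] by (simp_all add: h0_def h0'_def)
      ultimately show "integrable lebesgue h0'" "integral\<^sup>L lebesgue h0' = 0"
        using integral_dir_deriv[OF K(1) _ _ c, of "(0, 1)"] by blast+
    qed
    have B: "integrable lebesgue (hi' i)" "integral\<^sup>L lebesgue (hi' i) = 0" for i
    proof -
      have c: "continuous_on UNIV (hi i)" "continuous_on UNIV (hi' i)"
        by (rule zero_ext[OF oU K(1,2)];
            force simp: hi_def hi'_def K(3) D0 intro!: continuous_intros cc)+
      have "((\<lambda>r. hi i (z + r *\<^sub>R (axis i 1, 0))) has_real_derivative hi' i z) (at 0)" for z
      proof (cases "z \<in> K")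
        case True
        then have t: "snd z \<in> {0<..<T}" using K(2) by auto
        have "((\<lambda>r. fst z + r *\<^sub>R axis i 1) has_vector_derivative axis i 1) (at 0)"
          by (auto intro!: derivative_eq_intros)
        moreover have "((\<lambda>y. p y (snd z)) has_derivative (\<lambda>h. g (fst z) (snd z) \<bullet> h)) (at (fst z + 0 *\<^sub>R axis i 1))"
          using dp[OF t] by simp
        ultimately have "((\<lambda>r. p (fst z + r *\<^sub>R axis i 1) (snd z)) has_vector_derivative g (fst z) (snd z) \<bullet> axis i 1) (at 0)"
          using vector_derivative_diff_chain_within[of "\<lambda>r. fst z + r *\<^sub>R axis i 1" "axis i 1" 0 UNIV "\<lambda>y. p y (snd z)"]
          by (auto simp: o_def intro: has_derivative_at_withinI)
        then have p1: "((\<lambda>r. p (fst z + r *\<^sub>R axis i 1) (snd z)) has_real_derivative g (fst z) (snd z) $ i) (at 0)"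
          by (simp add: has_real_derivative_iff_has_vector_derivative inner_axis)
        have "((\<lambda>r. \<phi> (z + r *\<^sub>R (axis i 1, 0)) $ i) has_real_derivative D z (axis i 1, 0) $ i) (at 0)"
          unfolding has_real_derivative_iff_has_vector_derivative
          by (rule bounded_linear.has_vector_derivative[OF bounded_linear_vec_nth Dline])
        from DERIV_mult[OF p1 this] show ?thesis
          by (simp add: hi_def hi'_def algebra_simps zero_prod_def[symmetric])
      next
        case False
        have "hi' i z = 0" using K(3)[OF False] D0[OF False] by (simp add: hi'_def)
        moreover have "\<forall>\<^sub>F r in nhds 0. hi i (z + r *\<^sub>R (axis i 1, 0)) = 0"
          by (rule eventually_mono[OF near[OF oK, of z "(axis i 1, 0)"]]) (use False K(3) in \<open>unfold hi_def, simp_all del: scaleR_Pair\<close>)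
        ultimately show ?thesis by (simp only: zero_deriv)
      qed
      moreover have "hi i z = 0" "hi' i z = 0" if "z \<notin> K" for z
        using K(3)[OF that] D0[OF that] by (simp_all add: hi_def hi'_def)
      ultimately show "integrable lebesgue (hi' i)" "integral\<^sup>L lebesgue (hi' i) = 0"
        using integral_dir_deriv[OF K(1) _ _ c, of "(axis i 1, 0)"] by blast+
    qed
    have dt: "vector_derivative (\<lambda>s. \<phi> (x, s)) (at t) = D (x, t) (0, 1)" for x t
    proof -
      have "((\<lambda>s. (x, s)) has_vector_derivative (0, 1)) (at t)"
        by (auto intro!: derivative_eq_intros has_vector_derivative_Pair)
      then have "((\<lambda>s. \<phi> (x, s)) has_vector_derivative D (x, t) (0, 1)) (at t)"
        using vector_derivative_diff_chain_within[of "\<lambda>s. (x, s)" "(0, 1)" t UNIV \<phi> "D (x, t)"] D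
        by (auto simp: o_def intro: has_derivative_at_withinI)
      then show ?thesis by (rule vector_derivative_at)
    qed
    have div: "divergence (\<lambda>y. \<phi> (y, t)) x = (\<Sum>i\<in>UNIV. D (x, t) (axis i 1, 0) $ i)" for x t
    proof -
      have "((\<lambda>y. (y, t)) has_derivative (\<lambda>h. (h, 0))) (at x)"
        by (auto intro!: derivative_eq_intros)
      from diff_chain_at[OF this D]
      have "((\<lambda>y. \<phi> (y, t)) has_derivative (\<lambda>h. D (x, t) (h, 0))) (at x)" by (simp add: o_def)
      then have "frechet_derivative (\<lambda>y. \<phi> (y, t)) (at x) = (\<lambda>h. D (x, t) (h, 0))"
        by (rule frechet_derivative_at[symmetric])
      then show ?thesis by (simp add: divergence_def jacobian_def trace_def matrix_def)
    qed
    have key: "(indicator ?U z *\<^sub>R (case z of (x, t) \<Rightarrow>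
           v x t \<bullet> vector_derivative (\<lambda>s. \<phi> (x, s)) (at t)
           - convection (\<lambda>y. v y t) x \<bullet> \<phi> (x, t)
           + p x t * divergence (\<lambda>y. \<phi> (y, t)) x)) = h0' z + (\<Sum>i\<in>UNIV. hi' i z)" for z
    proof (cases "z \<in> ?U")
      case True
      obtain x t where z: "z = (x, t)" by (cases z)
      have e: "convection (\<lambda>y. v y t) x = - g x t - v' x t"
        using eq[of t x] True z by (simp add: algebra_simps eq_diff_eq)
      show ?thesis using True
        by (simp add: z e dt div h0'_def hi'_def sum.distrib sum_distrib_left inner_vec_def[of "g x t"]
            inner_diff_left algebra_simps)
    next
      case False
      then have "z \<notin> K" using K by auto
      then show ?thesis using False by (simp add: K(3) D0 h0'_def hi'_def)
    qed
    show "(LINT (x, t) : ?U | lebesgue.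
           v x t \<bullet> vector_derivative (\<lambda>s. \<phi> (x, s)) (at t)
           - convection (\<lambda>y. v y t) x \<bullet> \<phi> (x, t)
           + p x t * divergence (\<lambda>y. \<phi> (y, t)) x) = 0"
      unfolding set_lebesgue_integral_def key using A B by simp
  qed
qed

end

theory Submission
  imports Defs
begin

text \<open>
Along a smooth flow the vorticity obeys \<open>(\<partial>\<^sub>t + v \<cdot> \<nabla>)\<omega> = (\<omega> \<cdot> \<nabla>)v\<close>, and \<open>v\<close> preserves volume, so that
\<open>|d/dt \<integral>|\<omega>|\<^sup>p dx| \<le> p \<parallel>\<nabla>v\<parallel> \<integral>|\<omega>|\<^sup>p dx\<close>, with the factor \<open>p\<close> in front. If
\<open>\<omega>(x,t) = \<Psi>(t) \<Omega>(\<Phi>(t)x)\<close>, the integral is \<open>\<Psi>(t)\<^sup>p |det \<Phi>(t)|\<inverse> \<integral>|\<Omega>|\<^sup>p\<close>. After division by the positive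
number \<open>\<integral>|\<Omega>|\<^sup>p\<close> the limit \<open>p \<rightarrow> 0\<close> is harmless: \<open>\<Psi>\<^sup>p\<close> tends to 1, the right-hand side to 0, and what is
left says that \<open>|det \<Phi>|\<inverse>\<close> has derivative 0. The sign of the determinant is constant by continuity.

The vorticity is only continuous and the momentum equation only holds in the sense of distributions,
so the balance of powers needs a renormalisation argument. The momentum equation is tested with the
divergence-free field \<open>\<nabla>k \<times> c\<close>, where \<open>k\<close> is a translated space-time mollifier; the pressure disappears,
and the mollified vorticity \<open>W\<close> satisfies \<open>(\<partial>\<^sub>t + v \<cdot> \<nabla>)W = H\<close> pointwise, where \<open>H\<close> is an integral of
velocity increments (\<open>mollified_vorticity_eq\<close>). Because the increments are of first order in the distance,
\<open>H\<close> stays bounded and tends to \<open>(\<omega> \<cdot> \<nabla>)v\<close> (\<open>stretching_bound\<close>, \<open>stretching_close\<close>). The smooth function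
\<open>(|W|\<^sup>2 + \<delta>)\<^sup>q\<close> with \<open>q = p/2\<close>, cut off in space and time, is then integrated by parts; removing first the mollifier,
then \<open>\<delta>\<close> (\<open>local_power_bound\<close>), then the cut-off in space (\<open>global_power_bound\<close>) gives the balance of
powers, weakly in time. The velocity grows at most linearly, which is just what the last cut-off can bear.

No power integral is differentiated in time: the derivative in \<open>t\<close> stays on a test function \<open>\<eta>\<close>, and the lemma of
du Bois-Reymond is applied once, after the limit \<open>p \<rightarrow> 0\<close> (\<open>determinant_locally_constant\<close>).
\<close>

section \<open>Directional derivatives and integration by parts\<close>

text \<open>
The velocity has classical derivatives in the space directions only, so that it has no Frechet derivative in
space-time. Integration by parts asks for no more than the derivatives along single directions.
\<close>

definition has_dderiv :: "('a::real_normed_vector \<Rightarrow> 'b::real_normed_vector) \<Rightarrow> 'a \<Rightarrow> 'b \<Rightarrow> 'a \<Rightarrow> bool" where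
  "has_dderiv f e D z \<longleftrightarrow> ((\<lambda>r. f (z + r *\<^sub>R e)) has_vector_derivative D) (at 0)"

lemma has_dderiv_has_derivative:
  assumes "(f has_derivative f') (at z)"
  shows "has_dderiv f e (f' e) z"
proof -
  have "((\<lambda>r. z + r *\<^sub>R e) has_vector_derivative e) (at 0)"
    by (auto intro!: derivative_eq_intros)
  moreover have "(f has_derivative f') (at (z + 0 *\<^sub>R e))" using assms by simp
  ultimately show ?thesis
    using vector_derivative_diff_chain_within[of "\<lambda>r. z + r *\<^sub>R e" e 0 UNIV f f']
    by (auto simp: has_dderiv_def o_def intro: has_derivative_at_withinI)
qed

lemma has_dderiv_scaleR:
  assumes "has_dderiv f e f' z" "has_dderiv g e g' z"
  shows "has_dderiv (\<lambda>z. f z *\<^sub>R g z) e (f z *\<^sub>R g' + f' *\<^sub>R g z) z"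
  using bounded_bilinear.has_vector_derivative[OF bounded_bilinear_scaleR assms[unfolded has_dderiv_def]]
  by (simp add: has_dderiv_def)

lemma has_dderiv_mult:
  fixes f g :: "_ \<Rightarrow> real"
  assumes "has_dderiv f e f' z" "has_dderiv g e g' z"
  shows "has_dderiv (\<lambda>z. f z * g z) e (f z * g' + f' * g z) z"
  using has_dderiv_scaleR[OF assms] by simp

lemma has_dderiv_inner:
  assumes "has_dderiv f e f' z" "has_dderiv g e g' z"
  shows "has_dderiv (\<lambda>z. f z \<bullet> g z) e (f z \<bullet> g' + f' \<bullet> g z) z"
  using bounded_bilinear.has_vector_derivative[OF bounded_bilinear_inner assms[unfolded has_dderiv_def]]
  by (simp add: has_dderiv_def)

lemma bounded_bilinear_cross3: "bounded_bilinear cross3"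
  using bilinear_cross bilinear_conv_bounded_bilinear by blast

lemma has_dderiv_cross:
  assumes "has_dderiv f e f' z" "has_dderiv g e g' z"
  shows "has_dderiv (\<lambda>z. cross3 (f z) (g z)) e (cross3 (f z) g' + cross3 f' (g z)) z"
  using bounded_bilinear.has_vector_derivative[OF bounded_bilinear_cross3 assms[unfolded has_dderiv_def]]
  by (simp add: has_dderiv_def)

lemma has_dderiv_const: "has_dderiv (\<lambda>_. c) e 0 z"
  by (simp add: has_dderiv_def)

lemma has_dderiv_linear:
  assumes "bounded_linear h" "has_dderiv f e f' z"
  shows "has_dderiv (\<lambda>z. h (f z)) e (h f') z"
  using bounded_linear.has_vector_derivative[OF assms(1) assms(2)[unfolded has_dderiv_def]]
  by (simp add: has_dderiv_def)

lemma has_dderiv_real_comp: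
  fixes f :: "_ \<Rightarrow> real"
  assumes "(h has_real_derivative h') (at (f z))" "has_dderiv f e f' z"
  shows "has_dderiv (\<lambda>z. h (f z)) e (h' * f') z"
proof -
  have "((\<lambda>r. f (z + r *\<^sub>R e)) has_real_derivative f') (at 0)"
    using assms(2) by (simp add: has_dderiv_def has_real_derivative_iff_has_vector_derivative)
  moreover have "(h has_real_derivative h') (at (f (z + 0 *\<^sub>R e)))" using assms(1) by simp
  ultimately have "((\<lambda>r. h (f (z + r *\<^sub>R e))) has_real_derivative h' * f') (at 0)"
    using DERIV_chain2[of h h' "\<lambda>r. f (z + r *\<^sub>R e)" 0 f' UNIV] by simp
  then show ?thesis by (simp add: has_dderiv_def has_real_derivative_iff_has_vector_derivative)
qed

lemma has_dderiv_shift: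
  assumes "has_dderiv f e D (z - c)" shows "has_dderiv (\<lambda>z. f (z - c)) e D z"
  using assms by (simp add: has_dderiv_def algebra_simps)

lemma has_dderiv_unique:
  "has_dderiv f e D z \<Longrightarrow> has_dderiv f e D' z \<Longrightarrow> D = D'"
  unfolding has_dderiv_def by (rule vector_derivative_unique_at)

lemma has_dderiv_zero_outside:
  fixes f :: "'a::real_normed_vector \<Rightarrow> 'b::real_normed_vector"
  assumes "compact K" "\<And>z. z \<notin> K \<Longrightarrow> f z = 0" "has_dderiv f e D z" "z \<notin> K"
  shows "D = 0"
proof -
  have o: "open (- K)" using assms(1) by (simp add: compact_imp_closed open_Compl)
  have "((\<lambda>r. z + r *\<^sub>R e) \<longlongrightarrow> z + 0 *\<^sub>R e) (nhds 0)"
    by (intro tendsto_intros filterlim_ident)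
  then have "\<forall>\<^sub>F r in nhds 0. z + r *\<^sub>R e \<in> - K" using o assms(4) topological_tendstoD by fastforce
  then have "\<forall>\<^sub>F r in nhds 0. f (z + r *\<^sub>R e) = 0" by eventually_elim (use assms(2) in auto)
  then have "((\<lambda>r. f (z + r *\<^sub>R e)) has_vector_derivative 0) (at 0) \<longleftrightarrow> ((\<lambda>_::real. 0::'b) has_vector_derivative 0) (at 0)"
    by (intro has_vector_derivative_cong_ev) (auto simp: assms(2,4) elim: eventually_mono)
  then have "has_dderiv f e 0 z" by (simp add: has_dderiv_def)
  then show ?thesis using has_dderiv_unique assms(3) by blast
qed

lemma integrable_compact_support:
  fixes f :: "'a::euclidean_space \<Rightarrow> 'b::{banach, second_countable_topology}"
  assumes "continuous_on UNIV f" "compact K" "\<And>z. z \<notin> K \<Longrightarrow> f z = 0"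
  shows "integrable lborel f"
proof -
  have "integrable lborel (\<lambda>z. indicator K z *\<^sub>R f z)"
    using borel_integrable_compact[OF assms(2)] assms(1) continuous_on_subset by blast
  moreover have "(\<lambda>z. indicator K z *\<^sub>R f z) = f" using assms(3) by (intro ext) (auto simp: indicator_def)
  ultimately show ?thesis by simp
qed

text \<open>
The divergence theorem in the form used throughout: the function \<open>E\<close> is to be recognised as a sum of directional
derivatives of compactly supported functions. The index set and the directions are arbitrary, so
that the sum may run over the space directions only, over space and time, or over a single direction.
\<close>

lemma integral_sum_dderiv_zero:
  fixes F D :: "'i \<Rightarrow> 'a::euclidean_space \<Rightarrow> real"
  assumes K: "compact K" "\<And>i z. i \<in> I \<Longrightarrow> z \<notin> K \<Longrightarrow> F i z = 0"
    and c: "\<And>i. i \<in> I \<Longrightarrow> continuous_on UNIV (F i)" "\<And>i. i \<in> I \<Longrightarrow> continuous_on UNIV (D i)"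
    and d: "\<And>i z. i \<in> I \<Longrightarrow> has_dderiv (F i) (e i) (D i z) z"
    and E: "\<And>z. E z = (\<Sum>i\<in>I. D i z)"
  shows "integral\<^sup>L lborel E = 0"
proof -
  have z: "D i z = 0" if "i \<in> I" "z \<notin> K" for i z
    using has_dderiv_zero_outside[OF K(1) K(2)[OF that(1)] d[OF that(1)] that(2)] .
  have int: "integrable lborel (D i)" if "i \<in> I" for i
    using integrable_compact_support[OF c(2) K(1)] z that by blast
  have "integral\<^sup>L lborel (D i) = 0" if i: "i \<in> I" for i
  proof -
    have "integral\<^sup>L lebesgue (D i) = 0"
      using integral_dir_deriv(2)[OF K(1) K(2)[OF i] z[OF i] c(1)[OF i] c(2)[OF i], of "e i"] d[OF i]
      by (simp add: has_dderiv_def has_real_derivative_iff_has_vector_derivative)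
    then show ?thesis using integral_completion[of "D i" lborel] int[OF i] by simp
  qed
  then show ?thesis unfolding E using int by simp
qed

section \<open>Mollifying kernels with radial gradient\<close>

text \<open>
A bump of the form \<open>(r\<^sup>2 - |x|\<^sup>2)\<^sup>m\<close> on the ball of radius \<open>r\<close>. Its gradient is \<open>-2m x\<close> times the bump with exponent
\<open>m - 1\<close>, which makes the gradient radial and keeps the family closed under differentiation.
\<close>

definition hat :: "nat \<Rightarrow> real \<Rightarrow> 'a::real_inner \<Rightarrow> real" where
  "hat m r x = (max 0 (r\<^sup>2 - x \<bullet> x)) ^ m"

lemma max_power_DERIV:
  "((\<lambda>x::real. (max 0 x) ^ Suc (Suc m)) has_real_derivative real (Suc (Suc m)) * (max 0 x) ^ Suc m) (at x)"
proof (cases "x = 0")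
  case False
  then consider "x > 0" | "x < 0" by linarith
  then show ?thesis
  proof cases
    case 1
    have "((\<lambda>x::real. x ^ Suc (Suc m)) has_real_derivative real (Suc (Suc m)) * (max 0 x) ^ Suc m) (at x)"
      using 1 by (auto intro!: derivative_eq_intros simp del: power_Suc)
    then show ?thesis
      by (rule has_field_derivative_transform_within_open[of _ _ _ "{0<..}"]) (use 1 in auto)
  next
    case 2
    have "((\<lambda>x::real. 0) has_real_derivative real (Suc (Suc m)) * (max 0 x) ^ Suc m) (at x)"
      using 2 by (simp add: max_def)
    then show ?thesis
      by (rule has_field_derivative_transform_within_open[of _ _ _ "{..<0}"]) (use 2 in auto)
  qed
next
  case True
  have "((\<lambda>h::real. (max 0 h) ^ Suc m * (if h > 0 then 1 else 0)) \<longlongrightarrow> 0) (at 0)"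
  proof (rule Lim_null_comparison)
    have "((\<lambda>h::real. (max 0 h) ^ Suc m) \<longlongrightarrow> (max 0 0) ^ Suc m) (at 0)" by (intro tendsto_intros)
    then show "((\<lambda>h::real. (max 0 h) ^ Suc m) \<longlongrightarrow> 0) (at 0)" by simp
  qed (auto intro!: always_eventually)
  moreover have "(max 0 h) ^ Suc m * (if h > 0 then 1 else 0) = (max 0 h) ^ Suc (Suc m) / h" for h :: real
    by (auto simp: max_def)
  ultimately show ?thesis using True by (simp add: has_field_derivative_iff)
qed

lemma has_derivative_hat:
  "(hat (Suc (Suc m)) r has_derivative (\<lambda>h. - 2 * real (Suc (Suc m)) * hat (Suc m) r x * (x \<bullet> h))) (at x)"
proof -
  have 1: "((\<lambda>x. r\<^sup>2 - x \<bullet> x) has_derivative (\<lambda>h. - 2 * (x \<bullet> h))) (at x)"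
    by (auto intro!: derivative_eq_intros simp: inner_commute)
  have 2: "((\<lambda>x::real. (max 0 x) ^ Suc (Suc m)) has_derivative
     (\<lambda>h. real (Suc (Suc m)) * (max 0 (r\<^sup>2 - x \<bullet> x)) ^ Suc m * h)) (at (r\<^sup>2 - x \<bullet> x))"
    using max_power_DERIV[of m] unfolding has_field_derivative_def .
  have "hat (Suc (Suc m)) r = (\<lambda>x::real. (max 0 x) ^ Suc (Suc m)) \<circ> (\<lambda>x::'a. r\<^sup>2 - x \<bullet> x)"
    by (auto simp: hat_def)
  moreover have "(\<lambda>h. - 2 * real (Suc (Suc m)) * hat (Suc m) r x * (x \<bullet> h)) =
     (\<lambda>h. real (Suc (Suc m)) * (max 0 (r\<^sup>2 - x \<bullet> x)) ^ Suc m * h) \<circ> (\<lambda>h. - 2 * (x \<bullet> h))"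
    by (auto simp: hat_def algebra_simps)
  ultimately show ?thesis using diff_chain_at[OF 1 2] by simp
qed

lemma hat_nonneg [simp]: "hat m r x \<ge> 0" by (simp add: hat_def)

lemma continuous_on_hat [continuous_intros]:
  "continuous_on S f \<Longrightarrow> continuous_on S (\<lambda>x. hat m r (f x))"
  unfolding hat_def by (intro continuous_intros)

lemma hat_zero: "r > 0 \<Longrightarrow> m > 0 \<Longrightarrow> x \<notin> cball 0 r \<Longrightarrow> hat m r x = 0"
  unfolding hat_def
  by (auto simp: max_def power2_norm_eq_inner[symmetric] intro: power_mono)

lemma hat_pos: "r > 0 \<Longrightarrow> hat m r 0 > 0"
  by (simp add: hat_def max_def)

lemma integral_pos_at:
  fixes f :: "'a::euclidean_space \<Rightarrow> real"
  assumes "continuous_on UNIV f" "\<And>z. f z \<ge> 0" "f z0 > 0" "integrable lborel f"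
  shows "integral\<^sup>L lborel f > 0"
proof (rule ccontr)
  assume "\<not> ?thesis"
  then have "integral\<^sup>L lborel f = 0" using integral_nonneg_AE[of f lborel] assms(2) by (simp add: order.antisym)
  then have "AE z in lborel. f z = 0" using integral_nonneg_eq_0_iff_AE[OF assms(4)] assms(2) by auto
  moreover have "closed {z. f z = 0}"
    using continuous_closed_preimage_constant[OF assms(1) closed_UNIV] by simp
  ultimately have "f z0 = 0" using mem_closed_if_AE_lebesgue[of "{z. f z = 0}" z0]
    by (simp add: AE_completion)
  then show False using assms(3) by simp
qed

lemma integral_hat_pos:
  assumes "r > 0" "m > 0"
  shows "integral\<^sup>L lborel (hat m r :: 'a::euclidean_space \<Rightarrow> real) > 0"
proof (rule integral_pos_at)
  show c: "continuous_on UNIV (hat m r :: 'a \<Rightarrow> real)" by (intro continuous_on_hat continuous_on_id)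
  show "integrable lborel (hat m r :: 'a \<Rightarrow> real)"
    by (rule integrable_compact_support[OF c compact_cball hat_zero[OF assms]])
qed (use assms hat_pos in auto)

text \<open>
A space-time kernel \<open>k\<close> of mass 1 with radial spatial gradient \<open>\<nabla>k = - x g\<close>, \<open>g \<ge> 0\<close>, and \<open>\<nabla>g = - x gg\<close>;
\<open>kt\<close> and \<open>gt\<close> are the time derivatives. A radial gradient makes \<open>\<nabla>k \<times> c\<close> divergence-free at once and lets
\<open>\<integral>g|x|\<^sup>2 = 3\<close> follow from integration by parts, whatever the radius, so that no scaling is needed.
\<close>

locale mollifier =
  fixes r \<tau> :: real and k g kt gt gg :: "(real^3) \<times> real \<Rightarrow> real"
  assumes cont: "continuous_on UNIV k" "continuous_on UNIV g" "continuous_on UNIV kt" "continuous_on UNIV gt" "continuous_on UNIV gg"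
    and supp: "\<And>z. z \<notin> cball 0 r \<times> cball 0 \<tau> \<Longrightarrow> k z = 0 \<and> g z = 0 \<and> kt z = 0 \<and> gt z = 0 \<and> gg z = 0"
    and nonneg: "\<And>z. k z \<ge> 0" "\<And>z. g z \<ge> 0"
    and integral_k: "integral\<^sup>L lborel k = 1"
    and k_deriv: "\<And>z. (k has_derivative (\<lambda>h. - (fst z \<bullet> fst h) * g z + snd h * kt z)) (at z)"
    and g_deriv: "\<And>z. (g has_derivative (\<lambda>h. - (fst z \<bullet> fst h) * gg z + snd h * gt z)) (at z)"
    and kt_deriv: "\<And>z e. has_dderiv kt (e, 0) (- (fst z \<bullet> e) * gt z) z"

lemma hat_fst_deriv:
  fixes z :: "'a::real_inner \<times> 'b::real_inner"
  shows "((\<lambda>z. hat (Suc (Suc m)) r (fst z)) has_derivative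
    (\<lambda>h. - 2 * real (Suc (Suc m)) * hat (Suc m) r (fst z) * (fst z \<bullet> fst h))) (at z)"
  using diff_chain_at[OF has_derivative_fst[OF has_derivative_ident] has_derivative_hat] by (simp add: o_def inner_real_def)

lemma hat_snd_deriv:
  fixes z :: "'a::real_inner \<times> real"
  shows "((\<lambda>z. hat (Suc (Suc m)) r (snd z)) has_derivative
    (\<lambda>h. - 2 * real (Suc (Suc m)) * hat (Suc m) r (snd z) * (snd z * snd h))) (at z)"
  using diff_chain_at[OF has_derivative_snd[OF has_derivative_ident] has_derivative_hat[of m r "snd z"]]
  by (simp add: o_def inner_real_def)

lemma integral_product:
  fixes f :: "'a::euclidean_space \<Rightarrow> real" and h :: "'b::euclidean_space \<Rightarrow> real"
  assumes "integrable lborel (\<lambda>z. f (fst z) * h (snd z))"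
  shows "integral\<^sup>L lborel (\<lambda>z. f (fst z) * h (snd z)) = integral\<^sup>L lborel f * integral\<^sup>L lborel h"
proof -
  have "integrable (lborel \<Otimes>\<^sub>M lborel) (\<lambda>z::'a\<times>'b. f (fst z) * h (snd z))" using assms by (simp add: lborel_prod)
  from lborel_pair.integral_fst'[OF this]
  have "integral\<^sup>L lborel (\<lambda>z. f (fst z) * h (snd z)) = (\<integral>x. \<integral>y. f x * h y \<partial>lborel \<partial>lborel)"
    by (simp add: lborel_prod)
  then show ?thesis by simp
qed

text \<open>
The bound \<open>M\<close> depends on the radius \<open>r\<close> in space but not on the radius \<open>\<tau>\<close> in time, because the kernel is a
product and its time factor is normalised. Hence \<open>\<tau>\<close> may be chosen afterwards, so small that
the oscillation of the velocity in time is negligible even after multiplication by \<open>M\<close>.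
\<close>

lemma mollifier_exists:
  assumes r: "r > 0"
  shows "\<exists>M. \<forall>\<tau>>0. \<exists>k g kt gt gg. mollifier r \<tau> k g kt gt gg \<and> integral\<^sup>L lborel (\<lambda>z. g z * norm (fst z)) \<le> M"
proof (rule exI, intro allI impI)
  fix \<tau> :: real assume \<tau>: "\<tau> > 0"
  let ?K = "cball 0 r \<times> cball 0 \<tau> :: ((real^3) \<times> real) set"
  have K: "compact ?K" by (intro compact_Times compact_cball)
  have z: "hat m r (fst z) * hat n \<tau> (snd z) = 0" if "m > 0" "n > 0" "z \<notin> ?K" for m n and z :: "(real^3) \<times> real"
    using that hat_zero[OF r, of m "fst z"] hat_zero[OF \<tau>, of n "snd z"] by (cases z) auto
  have z1: "hat m r (fst z) * norm (fst z) * hat n \<tau> (snd z) = 0" if "m > 0" "n > 0" "z \<notin> ?K" for m n and z :: "(real^3) \<times> real"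
    using z[OF that] by auto
  define c3 where "c3 = integral\<^sup>L lborel (hat 3 r :: real^3 \<Rightarrow> real)"
  define c2 where "c2 = integral\<^sup>L lborel (hat 2 \<tau> :: real \<Rightarrow> real)"
  \<comment> \<open>numerator of the bound; the time factor \<open>c2\<close> cancels against the normalisation \<open>c\<close>\<close>
  define cM where "cM = integral\<^sup>L lborel (\<lambda>x::real^3. hat 2 r x * norm x)"
  have pos: "c3 > 0" "c2 > 0"
    unfolding c3_def c2_def using r \<tau> by (auto intro!: integral_hat_pos)
  define c where "c = c3 * c2"
  have c0: "c > 0" using pos by (simp add: c_def)
  define k where "k z = hat 3 r (fst z) * hat 2 \<tau> (snd z) / c" for z :: "(real^3) \<times> real"
  define g where "g z = 6 * hat 2 r (fst z) * hat 2 \<tau> (snd z) / c" for z :: "(real^3) \<times> real"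
  define kt where "kt z = hat 3 r (fst z) * (- 4 * hat 1 \<tau> (snd z) * snd z) / c" for z :: "(real^3) \<times> real"
  define gt where "gt z = 6 * hat 2 r (fst z) * (- 4 * hat 1 \<tau> (snd z) * snd z) / c" for z :: "(real^3) \<times> real"
  define gg where "gg z = 24 * hat 1 r (fst z) * hat 2 \<tau> (snd z) / c" for z :: "(real^3) \<times> real"
  note defs = k_def g_def kt_def gt_def gg_def
  have dh: "((\<lambda>z. hat 3 r (fst z)) has_derivative (\<lambda>h. - 6 * hat 2 r (fst z) * (fst z \<bullet> fst h))) (at z)"
    "((\<lambda>z. hat 2 r (fst z)) has_derivative (\<lambda>h. - 4 * hat 1 r (fst z) * (fst z \<bullet> fst h))) (at z)"
    "((\<lambda>z. hat 2 \<tau> (snd z)) has_derivative (\<lambda>h. - 4 * hat 1 \<tau> (snd z) * (snd z * snd h))) (at z)" for z :: "(real^3) \<times> real"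
    using hat_fst_deriv[of 1 r z] hat_fst_deriv[of 0 r z] hat_snd_deriv[of 0 \<tau> z] by (simp_all add: numeral_3_eq_3 numeral_2_eq_2)
  have ck: "continuous_on UNIV (\<lambda>z::(real^3) \<times> real. hat 3 r (fst z) * hat 2 \<tau> (snd z))"
    by (intro continuous_intros)
  have m: "mollifier r \<tau> k g kt gt gg"
  proof
    show "continuous_on UNIV k" "continuous_on UNIV g" "continuous_on UNIV kt" "continuous_on UNIV gt" "continuous_on UNIV gg"
      unfolding defs using c0 by (auto intro!: continuous_intros)
    show "k z = 0 \<and> g z = 0 \<and> kt z = 0 \<and> gt z = 0 \<and> gg z = 0" if "z \<notin> ?K" for z
      using z[of 3 2, OF _ _ that] z[of 2 2, OF _ _ that] z[of 3 1, OF _ _ that] z[of 2 1, OF _ _ that] z[of 1 2, OF _ _ that]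
      by (auto simp: defs)
    show "k z \<ge> 0" "g z \<ge> 0" for z using c0 by (auto simp: defs)
    have "integrable lborel (\<lambda>z::(real^3) \<times> real. hat 3 r (fst z) * hat 2 \<tau> (snd z))"
      by (rule integrable_compact_support[OF ck K]) (rule z; simp)
    from integral_product[OF this] have "integral\<^sup>L lborel (\<lambda>z::(real^3) \<times> real. hat 3 r (fst z) * hat 2 \<tau> (snd z)) = c"
      by (simp add: c_def c3_def c2_def)
    then show "integral\<^sup>L lborel k = 1" using c0 unfolding k_def by simp
    show "(k has_derivative (\<lambda>h. - (fst z \<bullet> fst h) * g z + snd h * kt z)) (at z)" for z
      unfolding defs using c0
      by (auto intro!: derivative_eq_intros dh simp: field_simps)
    show "(g has_derivative (\<lambda>h. - (fst z \<bullet> fst h) * gg z + snd h * gt z)) (at z)" for z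
      unfolding defs using c0
      by (auto intro!: derivative_eq_intros dh simp: field_simps)
    show "has_dderiv kt (e, 0) (- (fst z \<bullet> e) * gt z) z" for z e
    proof -
      have "has_dderiv (\<lambda>z. hat 1 \<tau> (snd z) * snd z) (e, 0) 0 z" for z :: "(real^3) \<times> real"
        by (simp add: has_dderiv_def)
      note m = has_dderiv_mult[OF has_dderiv_has_derivative[OF dh(1)[of z], of "(e, 0)"] this]
      have "kt = (\<lambda>z. (- 4 / c) * (hat 3 r (fst z) * (hat 1 \<tau> (snd z) * snd z)))"
        by (auto simp: kt_def)
      moreover have "- (fst z \<bullet> e) * gt z = (- 4 / c) * (hat 3 r (fst z) * 0 + - 6 * hat 2 r (fst z) * (fst z \<bullet> fst (e, 0::real)) * (hat 1 \<tau> (snd z) * snd z))"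
        by (simp add: gt_def)
      ultimately show ?thesis using has_dderiv_linear[OF bounded_linear_mult_right[of "- 4 / c"] m] by (simp only:)
    qed
  qed
  have i: "integral\<^sup>L lborel (\<lambda>z. g z * norm (fst z)) = 6 * cM / c3"
  proof -
    have "integrable lborel (\<lambda>z::(real^3) \<times> real. (hat 2 r (fst z) * norm (fst z)) * hat 2 \<tau> (snd z))"
      by (rule integrable_compact_support[OF _ K]; (rule z1, simp_all)?) (intro continuous_intros)
    from integral_product[OF this] have "integral\<^sup>L lborel (\<lambda>z::(real^3) \<times> real. (hat 2 r (fst z) * norm (fst z)) * hat 2 \<tau> (snd z)) = cM * c2"
      by (simp add: cM_def c2_def)
    then have "integral\<^sup>L lborel (\<lambda>z::(real^3) \<times> real. (6 / c) * ((hat 2 r (fst z) * norm (fst z)) * hat 2 \<tau> (snd z))) = 6 / c * (cM * c2)"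
      by simp
    also have "\<dots> = 6 * cM / c3" using pos by (simp add: c_def)
    finally show ?thesis unfolding g_def by (simp add: mult_ac)
  qed
  show "\<exists>k g kt gt gg. mollifier r \<tau> k g kt gt gg \<and> integral\<^sup>L lborel (\<lambda>z. g z * norm (fst z)) \<le>
     6 * integral\<^sup>L lborel (\<lambda>x::real^3. hat 2 r x * norm x) / integral\<^sup>L lborel (hat 3 r :: real^3 \<Rightarrow> real)"
    by (intro exI[of _ k] exI[of _ g] exI[of _ kt] exI[of _ gt] exI[of _ gg] conjI m)
      (simp add: i cM_def c3_def)
qed

section \<open>Mollification of continuous fields\<close>

definition mollify :: "('a::euclidean_space \<Rightarrow> real) \<Rightarrow> ('a \<Rightarrow> 'b::euclidean_space) \<Rightarrow> 'a \<Rightarrow> 'b" where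
  "mollify k w z = (LBINT v. k (v - z) *\<^sub>R w v)"

lemma integral_lborel_cbox:
  fixes f :: "'a::euclidean_space \<Rightarrow> 'b::euclidean_space"
  assumes "continuous_on UNIV f" "compact K" "\<And>z. z \<notin> K \<Longrightarrow> f z = 0" "K \<subseteq> cbox a b"
  shows "integral\<^sup>L lborel f = integral (cbox a b) f"
proof -
  have "(\<lambda>x. if x \<in> cbox a b then f x else 0) = f" using assms(3,4) by (intro ext) auto
  then have "integral (cbox a b) f = integral UNIV f" using integral_restrict_UNIV[of "cbox a b" f] by simp
  then show ?thesis using integral_lborel[OF integrable_compact_support[OF assms(1-3)]] by simp
qed

context
  fixes w :: "'a::euclidean_space \<Rightarrow> 'b::euclidean_space" and K :: "'a set"
  assumes w: "continuous_on UNIV w" and K: "compact K"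
begin

lemma mollify_kernel_compact:
  assumes k: "continuous_on UNIV k" "\<And>z. z \<notin> K \<Longrightarrow> k z = 0"
  shows "continuous_on UNIV (\<lambda>v. k (v - z) *\<^sub>R w v)" "compact ((+) z ` K)"
    "v \<notin> (+) z ` K \<Longrightarrow> k (v - z) *\<^sub>R w v = 0"
proof -
  show "continuous_on UNIV (\<lambda>v. k (v - z) *\<^sub>R w v)"
    by (intro continuous_intros w continuous_on_compose2[OF k(1)]) auto
  show "compact ((+) z ` K)" using K compact_translation by blast
  show "v \<notin> (+) z ` K \<Longrightarrow> k (v - z) *\<^sub>R w v = 0"
    using k(2)[of "v - z"] by (force simp: image_iff)
qed

lemma integrable_mollify:
  assumes k: "continuous_on UNIV k" "\<And>z. z \<notin> K \<Longrightarrow> k z = 0"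
  shows "integrable lborel (\<lambda>v. k (v - z) *\<^sub>R w v)"
  using integrable_compact_support[OF mollify_kernel_compact(1)[OF k] mollify_kernel_compact(2)[OF k], of z] mollify_kernel_compact(3)[OF k]
  by blast

lemma mollify_eq:
  assumes k: "continuous_on UNIV k" "\<And>z. z \<notin> K \<Longrightarrow> k z = 0" and sub: "(+) z ` K \<subseteq> cbox a b"
  shows "mollify k w z = integral (cbox a b) (\<lambda>v. k (v - z) *\<^sub>R w v)"
  unfolding mollify_def
  by (rule integral_lborel_cbox[OF mollify_kernel_compact(1)[OF k] mollify_kernel_compact(2)[OF k] mollify_kernel_compact(3)[OF k] sub])

lemma translates_in_cbox:
  obtains a b where "\<And>z. z \<in> ball z0 1 \<Longrightarrow> (+) z ` K \<subseteq> cbox a b"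
proof -
  have "bounded ((\<lambda>(x, y). x + y) ` (cball z0 1 \<times> K))"
    by (intro compact_imp_bounded compact_continuous_image compact_Times compact_cball K)
      (auto intro!: continuous_intros simp: case_prod_unfold)
  then obtain a where ab: "(\<lambda>(x, y). x + y) ` (cball z0 1 \<times> K) \<subseteq> cbox (-a) a"
    using bounded_subset_cbox_symmetric by blast
  have "(+) z ` K \<subseteq> cbox (-a) a" if "z \<in> ball z0 1" for z
  proof -
    have "z \<in> cball z0 1" using that by auto
    then show ?thesis using ab by fastforce
  qed
  then show ?thesis using that by blast
qed

lemma continuous_mollify:
  assumes k: "continuous_on UNIV k" "\<And>z. z \<notin> K \<Longrightarrow> k z = 0"
  shows "continuous_on UNIV (mollify k w)"
proof (rule continuous_at_imp_continuous_on, rule ballI)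
  fix z0 :: 'a
  obtain a b where sub: "\<And>z. z \<in> ball z0 1 \<Longrightarrow> (+) z ` K \<subseteq> cbox a b"
    using translates_in_cbox by blast
  have ab: "mollify k w z = integral (cbox a b) (\<lambda>v. k (v - z) *\<^sub>R w v)" if "z \<in> ball z0 1" for z
    by (rule mollify_eq[OF k sub[OF that]])
  have "continuous_on (ball z0 1) (\<lambda>z. integral (cbox a b) (\<lambda>v. k (v - z) *\<^sub>R w v))"
    by (rule integral_continuous_on_param)
      (auto intro!: continuous_intros continuous_on_compose2[OF k(1)] continuous_on_compose2[OF w] simp: case_prod_unfold)
  then have "continuous_on (ball z0 1) (mollify k w)"
    using ab continuous_on_cong by (metis (no_types, lifting))
  then show "isCont (mollify k w) z0"
    using continuous_on_eq_continuous_at[OF open_ball] centre_in_ball[of z0 1] by (metis zero_less_one)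
qed

text \<open>
Differentiation under the integral sign over a box that contains the supports of all nearby
translates. The sign comes from the translation \<open>v - z\<close> of the kernel.
\<close>

lemma mollify_dderiv:
  assumes k: "continuous_on UNIV k" "\<And>z. z \<notin> K \<Longrightarrow> k z = 0"
    and k': "continuous_on UNIV k'" and d: "\<And>z. has_dderiv k e (k' z) z"
  shows "has_dderiv (mollify k w) e (- mollify k' w z0) z0"
proof -
  have k'0: "k' z = 0" if "z \<notin> K" for z
    using has_dderiv_zero_outside[OF K k(2) d that] .
  obtain a b where sub: "\<And>z. z \<in> ball z0 1 \<Longrightarrow> (+) z ` K \<subseteq> cbox a b"
    using translates_in_cbox by blast
  have ab: "mollify k w z = integral (cbox a b) (\<lambda>v. k (v - z) *\<^sub>R w v)" if "z \<in> ball z0 1" for z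
    by (rule mollify_eq[OF k sub[OF that]])
  define \<delta> where "\<delta> = 1 / (1 + norm e)"
  have \<delta>: "\<delta> > 0" by (simp add: \<delta>_def add_pos_nonneg)
  have near: "z0 + s *\<^sub>R e \<in> ball z0 1" if "s \<in> ball 0 \<delta>" for s
  proof -
    have "\<bar>s\<bar> * norm e \<le> \<delta> * norm e" using that by (intro mult_right_mono) auto
    also have "\<dots> < 1" by (simp add: \<delta>_def divide_simps add_pos_nonneg)
    finally show ?thesis by (simp add: dist_norm)
  qed
  have kd: "((\<lambda>s. k (v - (z0 + s *\<^sub>R e))) has_vector_derivative - k' (v - (z0 + s *\<^sub>R e))) (at s)" for v s
  proof -
    have "((\<lambda>s'. k ((v - (z0 + s *\<^sub>R e)) + s' *\<^sub>R e)) has_vector_derivative k' (v - (z0 + s *\<^sub>R e))) (at (s - s))"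
      using d[of "v - (z0 + s *\<^sub>R e)"] by (simp add: has_dderiv_def)
    moreover have "((\<lambda>s'. s - s') has_vector_derivative -1) (at s)"
      by (auto intro!: derivative_eq_intros)
    ultimately have "((\<lambda>s'. k ((v - (z0 + s *\<^sub>R e)) + (s - s') *\<^sub>R e)) has_vector_derivative (-1) *\<^sub>R k' (v - (z0 + s *\<^sub>R e))) (at s)"
      using vector_diff_chain_at[of "\<lambda>s'. s - s'" "-1" s] by (simp add: o_def)
    then show ?thesis by (simp add: algebra_simps)
  qed
  have "((\<lambda>s. integral (cbox a b) (\<lambda>v. k (v - (z0 + s *\<^sub>R e)) *\<^sub>R w v)) has_vector_derivative
      integral (cbox a b) (\<lambda>v. (- k' (v - (z0 + 0 *\<^sub>R e))) *\<^sub>R w v)) (at 0 within ball 0 \<delta>)"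
  proof (rule leibniz_rule_vector_derivative)
    show "((\<lambda>s. k (v - (z0 + s *\<^sub>R e)) *\<^sub>R w v) has_vector_derivative (- k' (v - (z0 + s *\<^sub>R e))) *\<^sub>R w v) (at s within ball 0 \<delta>)" for s v
      using bounded_linear.has_vector_derivative[OF bounded_linear_scaleR_left kd]
      by (rule has_vector_derivative_at_within)
    show "(\<lambda>v. k (v - (z0 + s *\<^sub>R e)) *\<^sub>R w v) integrable_on cbox a b" for s
      by (intro integrable_continuous continuous_intros continuous_on_compose2[OF k(1)] continuous_on_compose2[OF w]) auto
    show "continuous_on (ball 0 \<delta> \<times> cbox a b) (\<lambda>(s, v). (- k' (v - (z0 + s *\<^sub>R e))) *\<^sub>R w v)"
      by (auto intro!: continuous_intros continuous_on_compose2[OF k'] continuous_on_compose2[OF w] simp: case_prod_unfold)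
  qed (use \<delta> in auto)
  then have 1: "((\<lambda>s. integral (cbox a b) (\<lambda>v. k (v - (z0 + s *\<^sub>R e)) *\<^sub>R w v)) has_vector_derivative
      integral (cbox a b) (\<lambda>v. (- k' (v - z0)) *\<^sub>R w v)) (at 0)"
    using \<delta> by (simp add: at_within_open[of _ "ball 0 \<delta>"])
  have 2: "integral (cbox a b) (\<lambda>v. (- k' (v - z0)) *\<^sub>R w v) = - mollify k' w z0"
    using mollify_eq[OF k' k'0 sub[of z0]] by (simp add: integral_neg)
  show ?thesis unfolding has_dderiv_def 2[symmetric]
    by (rule has_vector_derivative_transform_within_open[OF 1 open_ball[of 0 \<delta>]])
      (use \<delta> ab[OF near] in auto)
qed

end

section \<open>The equation of the mollified vorticity\<close>

text \<open>
The axial vector of the antisymmetric part of a matrix; on the Jacobian matrix of a field it is the curl.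
\<close>

definition curl_of :: "real^3^3 \<Rightarrow> real^3" where
  "curl_of D = vector [D $ 3 $ 2 - D $ 2 $ 3, D $ 1 $ 3 - D $ 3 $ 1, D $ 2 $ 1 - D $ 1 $ 2]"

lemma bounded_linear_curl_of: "bounded_linear curl_of"
  unfolding linear_conv_bounded_linear[symmetric]
  by (rule linearI) (simp_all add: curl_of_def vec_eq_iff forall_3 algebra_simps)

lemma continuous_on_curl_of [continuous_intros]:
  "continuous_on S J \<Longrightarrow> continuous_on S (\<lambda>z. curl_of (J z))"
  by (rule bounded_linear.continuous_on[OF bounded_linear_curl_of])

lemma bounded_linear_transpose: "bounded_linear (transpose :: real^'n^'m \<Rightarrow> _)"
  unfolding linear_conv_bounded_linear[symmetric]
  by (rule linearI) (simp_all add: transpose_def vec_eq_iff)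

lemma continuous_on_transpose [continuous_intros]:
  fixes J :: "_ \<Rightarrow> real^'n^'m"
  shows "continuous_on S J \<Longrightarrow> continuous_on S (\<lambda>z. transpose (J z))"
  by (rule bounded_linear.continuous_on[OF bounded_linear_transpose])

lemma continuous_on_cross3 [continuous_intros]:
  "continuous_on S f \<Longrightarrow> continuous_on S g \<Longrightarrow> continuous_on S (\<lambda>z. cross3 (f z) (g z))"
  by (rule bounded_bilinear.continuous_on[OF bounded_bilinear_cross3])

lemma mat_vec_mult_bilinear: "bounded_bilinear (\<lambda>(A::real^'n^'m) x. A *v x)"
  unfolding bilinear_conv_bounded_bilinear[symmetric] bilinear_def
  by (auto intro!: linearI simp: matrix_vector_mult_add_rdistrib matrix_vector_right_distrib
      scaleR_matrix_vector_assoc matrix_vector_mult_scaleR)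

lemmas vec3_simps = cross3_def inner_vec_def sum_3 vec_eq_iff vector_def matrix_vector_mult_def
  transpose_def trace_def axis_def curl_of_def forall_3

text \<open>
Applied to \<open>A = \<nabla>u\<close> and \<open>h = u\<close> this is \<open>(u \<cdot> \<nabla>)u = \<omega> \<times> u + \<nabla>(|u|\<^sup>2/2)\<close>.
\<close>

lemma cross_curl_of: "A *v h = cross3 (curl_of A) h + transpose A *v h"
  by (simp add: vec3_simps algebra_simps)

text \<open>
For \<open>A = \<nabla>u\<close> this is \<open>div (u \<times> c) = c \<cdot> curl u\<close>.
\<close>

lemma sum_cross_mat_axis: "(\<Sum>i\<in>UNIV. cross3 (A *v axis i 1) c $ i) = curl_of A \<bullet> c"
  by (simp add: vec3_simps algebra_simps)

text \<open>
What the argument needs of an Euler solution on a time interval \<open>(a,b)\<close>. Velocity and Jacobian are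
continuous on all of space-time; for a solution on \<open>[0,T)\<close> this is arranged by freezing the time outside \<open>[a,b]\<close>, and the
momentum equation is only claimed for test fields supported in \<open>(a,b)\<close>. As these test fields are
divergence-free, no pressure occurs.
\<close>

locale velocity_field =
  fixes u :: "(real^3) \<times> real \<Rightarrow> real^3" and J :: "(real^3) \<times> real \<Rightarrow> real^3^3" and L a b :: real
  assumes cont_u: "continuous_on UNIV u" and cont_J: "continuous_on UNIV J"
    and u_deriv: "\<And>x t. ((\<lambda>y. u (y, t)) has_derivative (\<lambda>h. J (x, t) *v h)) (at x)"
    and div_free: "\<And>z. trace (J z) = 0"
    and grad_bound: "\<And>z h. norm (J z *v h) \<le> L * norm h"
    and momentum: "\<And>\<phi> \<phi>' K. (\<And>z. (\<phi> has_derivative \<phi>' z) (at z)) \<Longrightarrow> (\<And>d. continuous_on UNIV (\<lambda>z. \<phi>' z d)) \<Longrightarrow>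
      compact K \<Longrightarrow> K \<subseteq> UNIV \<times> {a<..<b} \<Longrightarrow> (\<And>z. z \<notin> K \<Longrightarrow> \<phi> z = 0) \<Longrightarrow>
      (\<And>z. (\<Sum>i\<in>UNIV. \<phi>' z (axis i 1, 0) $ i) = 0) \<Longrightarrow>
      (LBINT z. u z \<bullet> \<phi>' z (0, 1) - (J z *v u z) \<bullet> \<phi> z) = 0"
begin

definition vorticity :: "(real^3) \<times> real \<Rightarrow> real^3" where "vorticity z = curl_of (J z)"

lemma cont_w: "continuous_on UNIV vorticity"
  unfolding vorticity_def[abs_def] by (intro continuous_intros cont_J)

lemma u_dderiv: "has_dderiv u (e, 0) (J z *v e) z"
  using has_dderiv_has_derivative[OF u_deriv[of "snd z" "fst z"], of e]
  by (cases z) (simp add: has_dderiv_def)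

end

text \<open>
Mollification around a fixed point \<open>z0\<close> away from the ends of the time interval, so that the kernel only sees times
at which the momentum equation holds.
\<close>

locale mollified_flow = velocity_field + mollifier +
  fixes z0 :: "(real^3) \<times> real"
  assumes time_window: "cball (snd z0) \<tau> \<subseteq> {a<..<b}"
begin

definition offset :: "(real^3) \<times> real \<Rightarrow> real^3" where "offset v = fst v - fst z0"

definition supp_set :: "((real^3) \<times> real) set" where
  "supp_set = (\<lambda>v. v + z0) ` (cball 0 r \<times> cball 0 \<tau>)"

lemma compact_supp_set: "compact supp_set"
  unfolding supp_set_def
  by (intro compact_continuous_image compact_Times compact_cball continuous_intros)

lemma supp_set_zero: "v \<notin> supp_set \<Longrightarrow> k (v - z0) = 0 \<and> g (v - z0) = 0 \<and> kt (v - z0) = 0 \<and> gt (v - z0) = 0 \<and> gg (v - z0) = 0"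
  by (rule supp, rule notI, drule imageI[of _ _ "\<lambda>v. v + z0"]) (simp add: supp_set_def)

lemma supp_set_window: "supp_set \<subseteq> UNIV \<times> {a<..<b}"
proof -
  have "snd v \<in> {a<..<b}" if "v \<in> supp_set" for v
  proof -
    have "v - z0 \<in> cball 0 r \<times> cball 0 \<tau>"
      using that unfolding supp_set_def by (elim imageE) simp
    then have "snd v \<in> cball (snd z0) \<tau>" by (auto simp: mem_Times_iff dist_norm)
    then show ?thesis using time_window by blast
  qed
  then show ?thesis by force
qed

lemma cont_shift:
  "continuous_on UNIV (\<lambda>v. k (v - z0))" "continuous_on UNIV (\<lambda>v. g (v - z0))" "continuous_on UNIV (\<lambda>v. kt (v - z0))"
  "continuous_on UNIV (\<lambda>v. gt (v - z0))" "continuous_on UNIV (\<lambda>v. gg (v - z0))" "continuous_on UNIV offset"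
  unfolding offset_def[abs_def]
  by (intro continuous_intros continuous_on_compose2[OF cont(1)] continuous_on_compose2[OF cont(2)]
     continuous_on_compose2[OF cont(3)] continuous_on_compose2[OF cont(4)] continuous_on_compose2[OF cont(5)]; simp)+

lemma integrable_supp:
  fixes f :: "_ \<Rightarrow> 'z::{banach, second_countable_topology}"
  assumes "continuous_on UNIV f" "\<And>v. v \<notin> supp_set \<Longrightarrow> f v = 0"
  shows "integrable lborel f"
  by (rule integrable_compact_support[OF assms(1) compact_supp_set assms(2)])

lemmas cont_mat = bounded_bilinear.continuous_on[OF mat_vec_mult_bilinear]
lemmas cont_all = cont_shift cont_u cont_J cont_w 
  cont_mat

lemma offset_dderiv: "has_dderiv offset (e, s) e z"
  unfolding has_dderiv_def offset_def by (auto intro!: derivative_eq_intros)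

lemma shift_dderiv:
  "has_dderiv (\<lambda>v. g (v - z0)) (e, 0) (- (offset z \<bullet> e) * gg (z - z0)) z"
  "has_dderiv (\<lambda>v. k (v - z0)) (e, 0) (- (offset z \<bullet> e) * g (z - z0)) z"
  "has_dderiv (\<lambda>v. kt (v - z0)) (e, 0) (- (offset z \<bullet> e) * gt (z - z0)) z"
proof -
  have "has_dderiv (\<lambda>v. g (v - z0)) (e, 0) (- (fst (z - z0) \<bullet> fst (e, 0::real)) * gg (z - z0) + snd (e, 0) * gt (z - z0)) z"
    by (rule has_dderiv_shift has_dderiv_has_derivative g_deriv)+
  then show "has_dderiv (\<lambda>v. g (v - z0)) (e, 0) (- (offset z \<bullet> e) * gg (z - z0)) z" by (simp add: offset_def)
  have "has_dderiv (\<lambda>v. k (v - z0)) (e, 0) (- (fst (z - z0) \<bullet> fst (e, 0::real)) * g (z - z0) + snd (e, 0) * kt (z - z0)) z"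
    by (rule has_dderiv_shift has_dderiv_has_derivative k_deriv)+
  then show "has_dderiv (\<lambda>v. k (v - z0)) (e, 0) (- (offset z \<bullet> e) * g (z - z0)) z" by (simp add: offset_def)
  have "has_dderiv (\<lambda>v. kt (v - z0)) (e, 0) (- (fst (z - z0) \<bullet> e) * gt (z - z0)) z"
    by (rule has_dderiv_shift kt_deriv)+
  then show "has_dderiv (\<lambda>v. kt (v - z0)) (e, 0) (- (offset z \<bullet> e) * gt (z - z0)) z" by (simp add: offset_def)
qed

text \<open>
The momentum equation with the test field \<open>g (c \<times> offset)\<close>, which is \<open>\<nabla>k \<times> c\<close>, the curl of \<open>k c\<close>.
\<close>

lemma momentum_against_curl_kernel: "(LBINT v. gt (v - z0) * (u v \<bullet> cross3 c (offset v)) - g (v - z0) * ((J v *v u v) \<bullet> cross3 c (offset v))) = 0"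
proof -
  define \<phi> where "\<phi> v = g (v - z0) *\<^sub>R cross3 c (offset v)" for v
  define \<phi>' where "\<phi>' v h = g (v - z0) *\<^sub>R cross3 c (fst h) + (- (offset v \<bullet> fst h) * gg (v - z0) + snd h * gt (v - z0)) *\<^sub>R cross3 c (offset v)" for v h
  have "(LBINT z. u z \<bullet> \<phi>' z (0, 1) - (J z *v u z) \<bullet> \<phi> z) = 0"
  proof (rule momentum)
    show "(\<phi> has_derivative \<phi>' z) (at z)" for z
    proof -
      have g': "((\<lambda>v. g (v - z0)) has_derivative (\<lambda>h. - (offset z \<bullet> fst h) * gg (z - z0) + snd h * gt (z - z0))) (at z)"
      proof -
        have "((\<lambda>v. v - z0) has_derivative (\<lambda>h. h)) (at z)" by (auto intro!: derivative_eq_intros)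
        from diff_chain_at[OF this g_deriv] show ?thesis by (simp add: o_def offset_def)
      qed
      have "((\<lambda>v. offset v) has_derivative fst) (at z)" unfolding offset_def by (auto intro!: derivative_eq_intros)
      then have c': "((\<lambda>v. cross3 c (offset v)) has_derivative (\<lambda>h. cross3 c (fst h))) (at z)"
        by (rule bounded_linear.has_derivative[OF bounded_bilinear.bounded_linear_right[OF bounded_bilinear_cross3]])
      show ?thesis unfolding \<phi>_def[abs_def] \<phi>'_def[abs_def]
        by (rule bounded_bilinear.FDERIV[OF bounded_bilinear_scaleR g' c'])
    qed
    show "continuous_on UNIV (\<lambda>z. \<phi>' z d)" for d
      unfolding \<phi>'_def by (intro continuous_intros cont_all)
    show "compact supp_set" "supp_set \<subseteq> UNIV \<times> {a<..<b}" by (fact compact_supp_set supp_set_window)+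
    show "\<phi> z = 0" if "z \<notin> supp_set" for z using supp_set_zero[OF that] by (simp add: \<phi>_def)
    show "(\<Sum>i\<in>UNIV. \<phi>' z (axis i 1, 0) $ i) = 0" for z
      by (simp add: \<phi>'_def vec3_simps algebra_simps)
  qed
  then show ?thesis by (simp add: \<phi>_def \<phi>'_def)
qed

text \<open>
The divergence of \<open>u \<times> kt c\<close>: the curl moves from the test field to the velocity.
\<close>

lemma vorticity_against_time_kernel: "(LBINT v. kt (v - z0) * (vorticity v \<bullet> c) - gt (v - z0) * (u v \<bullet> cross3 c (offset v))) = 0"
proof (rule integral_sum_dderiv_zero[OF compact_supp_set])
  let ?F = "\<lambda>i v. kt (v - z0) * (cross3 (u v) c $ i)"
  let ?D = "\<lambda>i v. kt (v - z0) * (cross3 (J v *v axis i 1) c $ i) + (- (offset v \<bullet> axis i 1) * gt (v - z0)) * (cross3 (u v) c $ i)"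
  show "?F i z = 0" if "z \<notin> supp_set" for i z using supp_set_zero[OF that] by simp
  show "continuous_on UNIV (?F i)" "continuous_on UNIV (?D i)" for i
    by (intro continuous_intros cont_all)+
  show "has_dderiv (?F i) (axis i 1, 0) (?D i z) z" for i z
    using has_dderiv_mult[OF shift_dderiv(3) has_dderiv_linear[OF bounded_linear_vec_nth has_dderiv_cross[OF u_dderiv has_dderiv_const]]]
    by simp
  show "kt (v - z0) * (vorticity v \<bullet> c) - gt (v - z0) * (u v \<bullet> cross3 c (offset v)) = (\<Sum>i\<in>UNIV. ?D i v)" for v
    unfolding vorticity_def sum_cross_mat_axis[symmetric]
    by (simp add: sum_3 vec3_simps algebra_simps)
qed

text \<open>
The gradient part of \<open>(u \<cdot> \<nabla>)u\<close> is orthogonal to the divergence-free test field. The integrand is half the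
divergence of \<open>g |u|\<^sup>2 (c \<times> offset)\<close>.
\<close>

lemma gradient_part_vanishes: "(LBINT v. g (v - z0) * ((transpose (J v) *v u v) \<bullet> cross3 c (offset v))) = 0"
proof -
  have "(LBINT v. 2 * (g (v - z0) * ((transpose (J v) *v u v) \<bullet> cross3 c (offset v)))) = 0"
  proof (rule integral_sum_dderiv_zero[OF compact_supp_set])
  let ?F = "\<lambda>i v. g (v - z0) * ((u v \<bullet> u v) * (cross3 c (offset v) $ i))"
  let ?D = "\<lambda>i v. g (v - z0) * ((u v \<bullet> u v) * (cross3 c (axis i 1) $ i) + (u v \<bullet> (J v *v axis i 1) + (J v *v axis i 1) \<bullet> u v) * (cross3 c (offset v) $ i))
      + (- (offset v \<bullet> axis i 1) * gg (v - z0)) * ((u v \<bullet> u v) * (cross3 c (offset v) $ i))"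
  show "?F i z = 0" if "z \<notin> supp_set" for i z using supp_set_zero[OF that] by simp
  show "continuous_on UNIV (?F i)" "continuous_on UNIV (?D i)" for i
    by (intro continuous_intros cont_all; simp)+
  show "has_dderiv (?F i) (axis i 1, 0) (?D i z) z" for i z
    using has_dderiv_mult[OF shift_dderiv(1) has_dderiv_mult[OF has_dderiv_inner[OF u_dderiv u_dderiv]
       has_dderiv_linear[OF bounded_linear_vec_nth has_dderiv_cross[OF has_dderiv_const offset_dderiv]]]]
    by simp
  show "2 * (g (v - z0) * ((transpose (J v) *v u v) \<bullet> cross3 c (offset v))) = (\<Sum>i\<in>UNIV. ?D i v)" for v
    by (simp add: sum_3 vec3_simps algebra_simps)
  qed
  then show ?thesis by simp
qed

text \<open>
The integrand is the divergence of \<open>u \<times> g offset\<close>, since \<open>g offset = - \<nabla>k\<close> has no curl.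
\<close>

lemma vorticity_weakly_divergence_free: "(LBINT v. g (v - z0) * (vorticity v \<bullet> offset v)) = 0"
proof (rule integral_sum_dderiv_zero[OF compact_supp_set])
  let ?F = "\<lambda>i v. g (v - z0) * (cross3 (u v) (offset v) $ i)"
  let ?D = "\<lambda>i v. g (v - z0) * ((cross3 (u v) (axis i 1) + cross3 (J v *v axis i 1) (offset v)) $ i)
      + (- (offset v \<bullet> axis i 1) * gg (v - z0)) * (cross3 (u v) (offset v) $ i)"
  show "?F i z = 0" if "z \<notin> supp_set" for i z using supp_set_zero[OF that] by simp
  show "continuous_on UNIV (?F i)" "continuous_on UNIV (?D i)" for i
    by (intro continuous_intros cont_all)+
  show "has_dderiv (?F i) (axis i 1, 0) (?D i z) z" for i z
    by (rule has_dderiv_mult[OF shift_dderiv(1) has_dderiv_linear[OF bounded_linear_vec_nth has_dderiv_cross[OF u_dderiv offset_dderiv]]])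
  show "g (v - z0) * (vorticity v \<bullet> offset v) = (\<Sum>i\<in>UNIV. ?D i v)" for v
    unfolding vorticity_def sum_cross_mat_axis[symmetric]
    by (simp add: sum_3 vec3_simps algebra_simps)
qed

text \<open>
The commutator of transport and mollification together with the mollified stretching term. Only increments of the velocity
enter, so the integrand carries two factors of first order in the offset, as many as \<open>second_moment\<close> can control.
\<close>

definition stretching :: "real^3" where
  "stretching = (LBINT v. g (v - z0) *\<^sub>R ((vorticity v \<bullet> offset v) *\<^sub>R (u v - u z0) - ((u v - u z0) \<bullet> offset v) *\<^sub>R vorticity v))"

lemma cross_identity: "cross3 p q \<bullet> cross3 c d = (p \<bullet> c) * (q \<bullet> d) - (p \<bullet> d) * (q \<bullet> c)"
  by (simp add: vec3_simps algebra_simps)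

text \<open>
The mollified vorticity equation at \<open>z0\<close>: the first term on the right is the time derivative of the mollified
vorticity, the second its derivative in the direction of \<open>u z0\<close>. The four identities above combine
pointwise under the integral; the divergence-free condition of the vorticity is what permits subtracting the constant
\<open>u z0\<close> in the term where the vorticity meets the kernel.
\<close>

lemma mollified_vorticity_eq:
  "stretching = - mollify kt vorticity z0 + (LBINT v. ((u z0 \<bullet> offset v) * g (v - z0)) *\<^sub>R vorticity v)"
proof (rule vector_eq_rdot[THEN iffD1, rule_format])
  fix c :: "real^3"
  let ?h = "\<lambda>v. g (v - z0) *\<^sub>R ((vorticity v \<bullet> offset v) *\<^sub>R (u v - u z0) - ((u v - u z0) \<bullet> offset v) *\<^sub>R vorticity v)"
  let ?m = "\<lambda>v. kt (v - z0) *\<^sub>R vorticity v"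
  let ?n = "\<lambda>v. ((u z0 \<bullet> offset v) * g (v - z0)) *\<^sub>R vorticity v"
  have z: "?h v = 0" "?m v = 0" "?n v = 0" if "v \<notin> supp_set" for v
    using supp_set_zero[OF that] by auto
  have i: "integrable lborel ?h" "integrable lborel ?m" "integrable lborel ?n"
    by (rule integrable_supp; (intro continuous_intros cont_all | rule z, assumption))+
  let ?e1 = "\<lambda>v. kt (v - z0) * (vorticity v \<bullet> c) - gt (v - z0) * (u v \<bullet> cross3 c (offset v))"
  let ?e2 = "\<lambda>v. gt (v - z0) * (u v \<bullet> cross3 c (offset v)) - g (v - z0) * ((J v *v u v) \<bullet> cross3 c (offset v))"
  let ?e3 = "\<lambda>v. g (v - z0) * ((transpose (J v) *v u v) \<bullet> cross3 c (offset v))"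
  let ?e4 = "\<lambda>v. g (v - z0) * (vorticity v \<bullet> offset v)"
  have ie: "integrable lborel ?e1" "integrable lborel ?e2" "integrable lborel ?e4"
    by (rule integrable_supp; (intro continuous_intros cont_all | simp add: supp_set_zero))+
  have ie3: "integrable lborel ?e3"
    by (rule integrable_supp; (intro continuous_intros cont_all | simp add: supp_set_zero))
  have eq: "?h v \<bullet> c + ?m v \<bullet> c - ?n v \<bullet> c = ?e1 v + ?e2 v + ?e3 v - (u z0 \<bullet> c) * ?e4 v" for v
  proof -
    have "(J v *v u v) \<bullet> cross3 c (offset v) = cross3 (vorticity v) (u v) \<bullet> cross3 c (offset v) + (transpose (J v) *v u v) \<bullet> cross3 c (offset v)"
      using cross_curl_of[of "J v" "u v"] by (simp add: vorticity_def inner_add_left)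
    then have "(J v *v u v) \<bullet> cross3 c (offset v) = (vorticity v \<bullet> c) * (u v \<bullet> offset v) - (vorticity v \<bullet> offset v) * (u v \<bullet> c) + (transpose (J v) *v u v) \<bullet> cross3 c (offset v)"
      unfolding cross_identity .
    note J_eq = this
    show ?thesis unfolding J_eq by (simp add: inner_diff_left algebra_simps)
  qed
  have "integral\<^sup>L lborel (\<lambda>v. ?h v \<bullet> c + ?m v \<bullet> c - ?n v \<bullet> c) = 0"
  proof -
    have "integral\<^sup>L lborel (\<lambda>v. f1 v + f2 v + f3 v - d * f4 v) =
        integral\<^sup>L lborel f1 + integral\<^sup>L lborel f2 + integral\<^sup>L lborel f3 - d * integral\<^sup>L lborel f4"
      if "integrable lborel f1" "integrable lborel f2" "integrable lborel f3" "integrable lborel f4"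
      for f1 f2 f3 f4 :: "(real^3) \<times> real \<Rightarrow> real" and d :: real using that by simp
    from this[OF ie(1,2) ie3 ie(3)] show ?thesis
      unfolding eq momentum_against_curl_kernel vorticity_against_time_kernel gradient_part_vanishes vorticity_weakly_divergence_free by simp
  qed
  moreover have "integral\<^sup>L lborel (\<lambda>v. ?h v \<bullet> c + ?m v \<bullet> c - ?n v \<bullet> c) = stretching \<bullet> c + mollify kt vorticity z0 \<bullet> c - integral\<^sup>L lborel ?n \<bullet> c"
  proof -
    have "integral\<^sup>L lborel (\<lambda>v. f1 v \<bullet> c + f2 v \<bullet> c - f3 v \<bullet> c) =
        integral\<^sup>L lborel f1 \<bullet> c + integral\<^sup>L lborel f2 \<bullet> c - integral\<^sup>L lborel f3 \<bullet> c"
      if "integrable lborel f1" "integrable lborel f2" "integrable lborel f3"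
      for f1 f2 f3 :: "(real^3) \<times> real \<Rightarrow> real^3" using that by simp
    from this[OF i] show ?thesis unfolding stretching_def mollify_def .
  qed
  ultimately show "stretching \<bullet> c = (- mollify kt vorticity z0 + integral\<^sup>L lborel ?n) \<bullet> c"
    by (simp add: inner_add_left inner_diff_left)
qed

end

section \<open>Estimates for the mollified vortex stretching\<close>

lemma integral_shift:
  fixes f :: "'a::euclidean_space \<Rightarrow> 'b::{banach, second_countable_topology}"
  assumes "continuous_on UNIV f"
  shows "integral\<^sup>L lborel (\<lambda>v. f (v - c)) = integral\<^sup>L lborel f"
proof -
  have [measurable]: "f \<in> borel_measurable borel" using assms by (rule borel_measurable_continuous_onI)
  have "integral\<^sup>L (distr lborel borel ((+) (- c))) f = integral\<^sup>L lborel f" using lborel_distr_plus[of "- c"] by simp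
  then show ?thesis by (subst (asm) integral_distr) auto
qed

context velocity_field begin

lemma L_nonneg: "L \<ge> 0"
  using grad_bound[of undefined "axis 1 1"] norm_ge_zero by (metis mult.right_neutral norm_axis_1 order_trans)

lemma u_lipschitz: "norm (u (x, t) - u (y, t)) \<le> L * norm (x - y)"
proof (rule differentiable_bound[of UNIV "\<lambda>y. u (y, t)" "\<lambda>x h. J (x, t) *v h" L])
  show "((\<lambda>y. u (y, t)) has_derivative (*v) (J (x, t))) (at x within UNIV)" for x
    using u_deriv by simp
  show "onorm ((*v) (J (x, t))) \<le> L" for x by (rule onorm_bound[OF L_nonneg grad_bound])
qed auto

end

context mollified_flow begin

lemma integral_k_shift: "(LBINT v. k (v - z0)) = 1"
  using integral_shift[OF cont(1), of z0] integral_k by simp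

lemma mollify_close:
  fixes f :: "_ \<Rightarrow> 'z::euclidean_space"
  assumes f: "continuous_on UNIV f" and e: "\<And>v. v \<in> supp_set \<Longrightarrow> norm (f v - c) \<le> e"
  shows "norm (mollify k f z0 - c) \<le> e"
proof -
  have i: "integrable lborel (\<lambda>v. k (v - z0) *\<^sub>R f v)" "integrable lborel (\<lambda>v. k (v - z0) *\<^sub>R c)"
     "integrable lborel (\<lambda>v. k (v - z0) *\<^sub>R (f v - c))" "integrable lborel (\<lambda>v. k (v - z0) * e)"
    by (rule integrable_supp; (intro continuous_intros cont_all f | simp add: supp_set_zero))+
  have ik: "integrable lborel (\<lambda>v. k (v - z0))"
    by (rule integrable_supp; (intro continuous_intros cont_all f | simp add: supp_set_zero))
  have "mollify k f z0 - c = (LBINT v. k (v - z0) *\<^sub>R f v) - (LBINT v. k (v - z0) *\<^sub>R c)"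
    using integral_k_shift ik by (simp add: mollify_def)
  also have "\<dots> = (LBINT v. k (v - z0) *\<^sub>R (f v - c))"
    using i by (simp add: scaleR_diff_right)
  also have "norm \<dots> \<le> (LBINT v. k (v - z0) * e)"
  proof (rule Bochner_Integration.integral_norm_bound_integral[OF i(3,4)])
    show "norm (k (v - z0) *\<^sub>R (f v - c)) \<le> k (v - z0) * e" for v
      using e[of v] supp_set_zero[of v] nonneg(1)[of "v - z0"]
      by (cases "v \<in> supp_set") (auto intro: mult_left_mono)
  qed
  also have "\<dots> = e" using integral_k_shift by simp
  finally show ?thesis .
qed

text \<open>
Integration by parts of \<open>k (offset \<bullet> q)\<close> in the direction \<open>p\<close>. The singular kernel \<open>g\<close> is thus normalised: its
matrix of second moments is the identity for every radius.
\<close>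

lemma second_moment: "(LBINT v. g (v - z0) * ((offset v \<bullet> p) * (offset v \<bullet> q))) = p \<bullet> q"
proof -
  have "(LBINT v. k (v - z0) * (p \<bullet> q) - g (v - z0) * ((offset v \<bullet> p) * (offset v \<bullet> q))) = 0"
  proof (rule integral_sum_dderiv_zero[OF compact_supp_set, of "{()}"])
    let ?F = "\<lambda>_ v. k (v - z0) * (offset v \<bullet> q)"
    let ?D = "\<lambda>_ v. k (v - z0) * (offset v \<bullet> 0 + p \<bullet> q) + (- (offset v \<bullet> p) * g (v - z0)) * (offset v \<bullet> q)"
    show "?F i z = 0" if "z \<notin> supp_set" for i z using supp_set_zero[OF that] by simp
    show "continuous_on UNIV (?F i)" "continuous_on UNIV (?D i)" for i
      by (intro continuous_intros cont_all)+
    show "has_dderiv (?F i) (p, 0) (?D i z) z" for i z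
      by (rule has_dderiv_mult[OF shift_dderiv(2) has_dderiv_inner[OF offset_dderiv has_dderiv_const]])
    show "k (v - z0) * (p \<bullet> q) - g (v - z0) * ((offset v \<bullet> p) * (offset v \<bullet> q)) = (\<Sum>i\<in>{()}. ?D i v)" for v
      by simp
  qed
  moreover have "integrable lborel (\<lambda>v. k (v - z0) * (p \<bullet> q))" "integrable lborel (\<lambda>v. g (v - z0) * ((offset v \<bullet> p) * (offset v \<bullet> q)))"
    by (rule integrable_supp; (intro continuous_intros cont_all | simp add: supp_set_zero))+
  ultimately show ?thesis using integral_k_shift by simp
qed

text \<open>
A quadratic bound in the offset costs only the trace 3 of the second moments, while a linear one costs \<open>M\<close>, which
blows up with shrinking radius and has to be paid for by \<open>\<alpha>\<close>.
\<close>

lemma integral_moment_bound: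
  fixes f :: "_ \<Rightarrow> 'z::euclidean_space"
  assumes f: "continuous_on UNIV f" and z: "\<And>v. v \<notin> supp_set \<Longrightarrow> f v = 0"
    and b: "\<And>v. v \<in> supp_set \<Longrightarrow> norm (f v) \<le> g (v - z0) * (\<alpha> * norm (offset v) + \<beta> * (norm (offset v))\<^sup>2)"
    and M: "integral\<^sup>L lborel (\<lambda>z. g z * norm (fst z)) \<le> M" and \<alpha>: "\<alpha> \<ge> 0"
  shows "norm (integral\<^sup>L lborel f) \<le> \<alpha> * M + 3 * \<beta>"
proof -
  have i: "integrable lborel f" by (rule integrable_supp[OF f z])
  have i1: "integrable lborel (\<lambda>v. g (v - z0) * norm (offset v))"
    by (rule integrable_supp; (intro continuous_intros cont_all | simp add: supp_set_zero))
  have i2: "integrable lborel (\<lambda>v. g (v - z0) * ((offset v \<bullet> axis j 1) * (offset v \<bullet> axis j 1)))" for j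
    by (rule integrable_supp; (intro continuous_intros cont_all | simp add: supp_set_zero))
  have n2: "(norm (offset v))\<^sup>2 = (\<Sum>j\<in>UNIV. (offset v \<bullet> axis j 1) * (offset v \<bullet> axis j 1))" for v
    unfolding power2_norm_eq_inner inner_axis by (simp add: inner_vec_def)
  have e: "g (v - z0) * (\<alpha> * norm (offset v) + \<beta> * (norm (offset v))\<^sup>2) =
      \<alpha> * (g (v - z0) * norm (offset v)) + \<beta> * (\<Sum>j\<in>UNIV. g (v - z0) * ((offset v \<bullet> axis j 1) * (offset v \<bullet> axis j 1)))" for v
    by (simp add: n2 algebra_simps sum_distrib_left)
  have i3: "integrable lborel (\<lambda>v. g (v - z0) * (\<alpha> * norm (offset v) + \<beta> * (norm (offset v))\<^sup>2))"
    unfolding e by (intro Bochner_Integration.integrable_add integrable_mult_right Bochner_Integration.integrable_sum i1 i2)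
  have "norm (integral\<^sup>L lborel f) \<le> (LBINT v. g (v - z0) * (\<alpha> * norm (offset v) + \<beta> * (norm (offset v))\<^sup>2))"
  proof (rule Bochner_Integration.integral_norm_bound_integral[OF i i3])
    show "norm (f v) \<le> g (v - z0) * (\<alpha> * norm (offset v) + \<beta> * (norm (offset v))\<^sup>2)" for v
      using b[of v] z[of v] supp_set_zero[of v] by (cases "v \<in> supp_set") auto
  qed
  also have "\<dots> = \<alpha> * (LBINT v. g (v - z0) * norm (offset v)) + \<beta> * (\<Sum>j\<in>(UNIV::3 set). LBINT v. g (v - z0) * ((offset v \<bullet> axis j 1) * (offset v \<bullet> axis j 1)))"
    unfolding e using i1 i2 by simp
  also have "\<dots> = \<alpha> * (LBINT v. g (v - z0) * norm (offset v)) + 3 * \<beta>"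
    unfolding second_moment by (simp add: inner_axis_axis)
  also have "(LBINT v. g (v - z0) * norm (offset v)) = integral\<^sup>L lborel (\<lambda>z. g z * norm (fst z))"
    using integral_shift[of "\<lambda>z. g z * norm (fst z)" z0] cont(2) by (simp add: offset_def continuous_intros)
  also have "\<alpha> * \<dots> + 3 * \<beta> \<le> \<alpha> * M + 3 * \<beta>" using M \<alpha> by (simp add: mult_left_mono)
  finally show ?thesis .
qed

text \<open>
The value of the stretching integral for a linear velocity and a constant vorticity. For a trace-free
Jacobian it is exactly the stretching term \<open>A *v p\<close>.
\<close>

lemma ideal_integral:
  "(LBINT v. g (v - z0) *\<^sub>R ((p \<bullet> offset v) *\<^sub>R (A *v offset v) - ((A *v offset v) \<bullet> offset v) *\<^sub>R p)) = A *v p - trace A *\<^sub>R p"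
proof (rule vector_eq_rdot[THEN iffD1, rule_format])
  fix c :: "real^3"
  let ?h = "\<lambda>v. g (v - z0) *\<^sub>R ((p \<bullet> offset v) *\<^sub>R (A *v offset v) - ((A *v offset v) \<bullet> offset v) *\<^sub>R p)"
  have i: "integrable lborel ?h"
    by (rule integrable_supp; (intro continuous_intros cont_all | simp add: supp_set_zero))
  have i1: "integrable lborel (\<lambda>v. g (v - z0) * ((offset v \<bullet> p') * (offset v \<bullet> q)))" for p' q
    by (rule integrable_supp; (intro continuous_intros cont_all | simp add: supp_set_zero))
  have "?h v \<bullet> c = g (v - z0) * ((offset v \<bullet> p) * (offset v \<bullet> (transpose A *v c))) -
     (p \<bullet> c) * (\<Sum>i\<in>UNIV. g (v - z0) * ((offset v \<bullet> (A $ i)) * (offset v \<bullet> axis i 1)))" for v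
    by (simp add: vec3_simps algebra_simps)
  then have "integral\<^sup>L lborel (\<lambda>v. ?h v \<bullet> c) = (LBINT v. g (v - z0) * ((offset v \<bullet> p) * (offset v \<bullet> (transpose A *v c)))) -
     (p \<bullet> c) * (\<Sum>i\<in>UNIV. LBINT v. g (v - z0) * ((offset v \<bullet> (A $ i)) * (offset v \<bullet> axis i 1)))"
    using i1 by simp
  also have "\<dots> = p \<bullet> (transpose A *v c) - (p \<bullet> c) * (\<Sum>i\<in>UNIV. (A $ i) \<bullet> axis i 1)"
    unfolding second_moment ..
  also have "\<dots> = (A *v p - trace A *\<^sub>R p) \<bullet> c"
    by (simp add: vec3_simps algebra_simps)
  finally show "integral\<^sup>L lborel ?h \<bullet> c = (A *v p - trace A *\<^sub>R p) \<bullet> c"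
    using integral_inner_left[OF i, of c] by simp
qed

context
  fixes \<theta> M
  assumes \<theta>: "\<And>v. v \<in> supp_set \<Longrightarrow> norm (u v - u (fst v, snd z0)) \<le> \<theta>"
    and M: "integral\<^sup>L lborel (\<lambda>z. g z * norm (fst z)) \<le> M"
    and \<theta>0: "\<theta> \<ge> 0"
begin

text \<open>
The increment in time is not of first order in the offset; it is kept apart as \<open>\<theta>\<close> and made small by
the choice of \<open>\<tau>\<close>.
\<close>

lemma increment_bound:
  assumes "v \<in> supp_set" shows "norm (u v - u z0) \<le> \<theta> + L * norm (offset v)"
proof -
  have "norm (u (fst v, snd z0) - u z0) \<le> L * norm (offset v)"
    using u_lipschitz[of "fst v" "snd z0" "fst z0"] by (simp add: offset_def)
  then show ?thesis using \<theta>[OF assms] norm_triangle_ineq[of "u v - u (fst v, snd z0)" "u (fst v, snd z0) - u z0"] by simp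
qed

lemma norm_commutator_le:
  fixes p d q :: "real^3"
  assumes "norm p \<le> P" "norm d \<le> D"
  shows "norm ((p \<bullet> q) *\<^sub>R d - (d \<bullet> q) *\<^sub>R p) \<le> 2 * (P * D) * norm q"
proof -
  have "norm ((p \<bullet> q) *\<^sub>R d) \<le> (norm p * norm q) * norm d" 
    by (simp add: Cauchy_Schwarz_ineq2 mult_right_mono)
  moreover have "norm ((d \<bullet> q) *\<^sub>R p) \<le> (norm d * norm q) * norm p"
    by (simp add: Cauchy_Schwarz_ineq2 mult_right_mono)
  moreover have "norm p * norm d \<le> P * D" using assms by (intro mult_mono) (auto intro: order_trans[OF norm_ge_zero])
  then have "norm p * norm d * norm q \<le> P * D * norm q" by (rule mult_right_mono) simp
  ultimately show ?thesis using norm_triangle_ineq4[of "(p \<bullet> q) *\<^sub>R d" "(d \<bullet> q) *\<^sub>R p"]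
    by (simp add: mult_ac)
qed

text \<open>
Only the Lipschitz constant of the velocity enters, so the bound is the same for all radii as long as \<open>\<theta> M\<close> is
bounded.
\<close>

lemma stretching_bound:
  assumes Mw: "\<And>v. v \<in> supp_set \<Longrightarrow> norm (vorticity v) \<le> Mw" and Mw0: "Mw \<ge> 0"
  shows "norm stretching \<le> 2 * Mw * (\<theta> * M + 3 * L)"
proof -
  have "norm stretching \<le> (2 * Mw * \<theta>) * M + 3 * (2 * Mw * L)"
    unfolding stretching_def
  proof (rule integral_moment_bound[OF _ _ _ M])
    fix v assume v: "v \<in> supp_set"
    have "norm ((vorticity v \<bullet> offset v) *\<^sub>R (u v - u z0) - ((u v - u z0) \<bullet> offset v) *\<^sub>R vorticity v) \<le> 2 * (Mw * (\<theta> + L * norm (offset v))) * norm (offset v)"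
      by (rule norm_commutator_le[OF Mw[OF v] increment_bound[OF v]])
    from mult_left_mono[OF this nonneg(2)[of "v - z0"]]
    show "norm (g (v - z0) *\<^sub>R ((vorticity v \<bullet> offset v) *\<^sub>R (u v - u z0) - ((u v - u z0) \<bullet> offset v) *\<^sub>R vorticity v))
      \<le> g (v - z0) * ((2 * Mw * \<theta>) * norm (offset v) + (2 * Mw * L) * (norm (offset v))\<^sup>2)"
      unfolding norm_scaleR using nonneg(2)[of "v - z0"] by (simp add: algebra_simps power2_eq_square)
  qed (use Mw0 \<theta>0 in \<open>auto simp: supp_set_zero intro!: continuous_intros cont_all\<close>)
  then show ?thesis by (simp add: algebra_simps)
qed

text \<open>
The integrand is compared with that of \<open>ideal_integral\<close>, replacing first the vorticity and then the
velocity increment by its linearisation.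
\<close>

lemma stretching_close:
  assumes e1: "\<And>v. v \<in> supp_set \<Longrightarrow> norm (vorticity v - vorticity z0) \<le> e1"
    and e2: "\<And>v. v \<in> supp_set \<Longrightarrow> norm (u (fst v, snd z0) - u z0 - J z0 *v offset v) \<le> e2 * norm (offset v)" 
    and e10: "e1 \<ge> 0"
  shows "norm (stretching - J z0 *v vorticity z0) \<le> 2 * (e1 * (\<theta> * M + 3 * L) + norm (vorticity z0) * (\<theta> * M + 3 * e2))"
proof -
  let ?f = "\<lambda>v. g (v - z0) *\<^sub>R ((vorticity v \<bullet> offset v) *\<^sub>R (u v - u z0) - ((u v - u z0) \<bullet> offset v) *\<^sub>R vorticity v)"
  let ?I = "\<lambda>v. g (v - z0) *\<^sub>R ((vorticity z0 \<bullet> offset v) *\<^sub>R (J z0 *v offset v) - ((J z0 *v offset v) \<bullet> offset v) *\<^sub>R vorticity z0)"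
  have i: "integrable lborel ?f" "integrable lborel ?I"
    by (rule integrable_supp; (intro continuous_intros cont_all | simp add: supp_set_zero))+
  have "stretching - J z0 *v vorticity z0 = integral\<^sup>L lborel ?f - integral\<^sup>L lborel ?I"
    unfolding stretching_def ideal_integral div_free by simp
  also have "\<dots> = (LBINT v. ?f v - ?I v)" using i by (rule Bochner_Integration.integral_diff[symmetric])
  also have "norm \<dots> \<le> (2 * e1 * \<theta> + 2 * norm (vorticity z0) * \<theta>) * M + 3 * (2 * e1 * L + 2 * norm (vorticity z0) * e2)"
  proof (rule integral_moment_bound[OF _ _ _ M])
    fix v assume v: "v \<in> supp_set"
    let ?d = "u v - u z0"
    have "norm (?d - J z0 *v offset v) \<le> \<theta> + e2 * norm (offset v)"
    proof -
      have eq: "?d - J z0 *v offset v = (u v - u (fst v, snd z0)) + (u (fst v, snd z0) - u z0 - J z0 *v offset v)" by simp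
      show ?thesis unfolding eq by (rule norm_triangle_le[OF add_mono[OF \<theta>[OF v] e2[OF v]]])
    qed
    from norm_commutator_le[OF order_refl this, of "vorticity z0" "offset v"] norm_commutator_le[OF e1[OF v] increment_bound[OF v], of "offset v"]
    have "norm (((vorticity v - vorticity z0) \<bullet> offset v) *\<^sub>R ?d - (?d \<bullet> offset v) *\<^sub>R (vorticity v - vorticity z0)) +
       norm ((vorticity z0 \<bullet> offset v) *\<^sub>R (?d - J z0 *v offset v) - ((?d - J z0 *v offset v) \<bullet> offset v) *\<^sub>R vorticity z0)
       \<le> 2 * (e1 * (\<theta> + L * norm (offset v))) * norm (offset v) + 2 * (norm (vorticity z0) * (\<theta> + e2 * norm (offset v))) * norm (offset v)" by linarith
    moreover have "((vorticity v \<bullet> offset v) *\<^sub>R ?d - (?d \<bullet> offset v) *\<^sub>R vorticity v) - ((vorticity z0 \<bullet> offset v) *\<^sub>R (J z0 *v offset v) - ((J z0 *v offset v) \<bullet> offset v) *\<^sub>R vorticity z0)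
      = (((vorticity v - vorticity z0) \<bullet> offset v) *\<^sub>R ?d - (?d \<bullet> offset v) *\<^sub>R (vorticity v - vorticity z0)) + ((vorticity z0 \<bullet> offset v) *\<^sub>R (?d - J z0 *v offset v) - ((?d - J z0 *v offset v) \<bullet> offset v) *\<^sub>R vorticity z0)"
      by (simp add: inner_diff_left scaleR_diff_left scaleR_diff_right)
    ultimately have "norm (((vorticity v \<bullet> offset v) *\<^sub>R ?d - (?d \<bullet> offset v) *\<^sub>R vorticity v) - ((vorticity z0 \<bullet> offset v) *\<^sub>R (J z0 *v offset v) - ((J z0 *v offset v) \<bullet> offset v) *\<^sub>R vorticity z0))
       \<le> 2 * (e1 * (\<theta> + L * norm (offset v))) * norm (offset v) + 2 * (norm (vorticity z0) * (\<theta> + e2 * norm (offset v))) * norm (offset v)"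
      by (simp only: norm_triangle_le)
    then have "g (v - z0) * norm (((vorticity v \<bullet> offset v) *\<^sub>R ?d - (?d \<bullet> offset v) *\<^sub>R vorticity v) - ((vorticity z0 \<bullet> offset v) *\<^sub>R (J z0 *v offset v) - ((J z0 *v offset v) \<bullet> offset v) *\<^sub>R vorticity z0))
       \<le> g (v - z0) * (2 * (e1 * (\<theta> + L * norm (offset v))) * norm (offset v) + 2 * (norm (vorticity z0) * (\<theta> + e2 * norm (offset v))) * norm (offset v))"
      by (rule mult_left_mono[OF _ nonneg(2)])
    then show "norm (?f v - ?I v) \<le> g (v - z0) * ((2 * e1 * \<theta> + 2 * norm (vorticity z0) * \<theta>) * norm (offset v) + (2 * e1 * L + 2 * norm (vorticity z0) * e2) * (norm (offset v))\<^sup>2)"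
      unfolding scaleR_diff_right[symmetric] norm_scaleR
      using nonneg(2)[of "v - z0"] by (simp add: algebra_simps power2_eq_square)
  qed (use e10 \<theta>0 in \<open>auto simp: supp_set_zero intro!: continuous_intros cont_all\<close>)
  finally show ?thesis by (simp add: algebra_simps)
qed

end

end

context velocity_field begin

text \<open>
The two radii are coupled here: given the radius \<open>\<epsilon>\<close> in space, the radius in time is so small that the velocity
oscillates in time by at most \<open>\<theta>\<close>, where \<open>\<theta> M = \<epsilon>\<close>.
The closeness statement is pointwise in \<open>z\<close>, because differentiability of the velocity is used at single points only.
\<close>

lemma mollified_vorticity_exists:
  assumes R: "a < a'" "a' \<le> b'" "b' < b" and \<epsilon>: "0 < \<epsilon>" "\<epsilon> \<le> 1"
    and Mw: "\<And>v. v \<in> cball 0 (R + 1) \<times> {a' - 1..b' + 1} \<Longrightarrow> norm (vorticity v) \<le> Mw" "Mw \<ge> 0"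
  shows "\<exists>W D Wt. continuous_on UNIV W \<and> (\<forall>i. continuous_on UNIV (D i)) \<and> continuous_on UNIV Wt \<and>
    (\<forall>z. has_dderiv W (0, 1) (Wt z) z) \<and> (\<forall>i z. has_dderiv W (axis i 1, 0) (D i z) z) \<and>
    (\<forall>z\<in>cball 0 R \<times> {a'..b'}. norm (W z) \<le> Mw \<and>
       norm (Wt z + (\<Sum>i\<in>UNIV. (u z $ i) *\<^sub>R D i z)) \<le> 2 * Mw * (1 + 3 * L) \<and>
       (\<forall>e1\<ge>0. \<forall>e2. (\<forall>v. dist v z \<le> 2 * \<epsilon> \<longrightarrow> norm (vorticity v - vorticity z) \<le> e1) \<longrightarrow>
          (\<forall>x. norm (x - fst z) \<le> \<epsilon> \<longrightarrow> norm (u (x, snd z) - u z - J z *v (x - fst z)) \<le> e2 * norm (x - fst z)) \<longrightarrow>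
          norm (W z - vorticity z) \<le> e1 \<and>
          norm (Wt z + (\<Sum>i\<in>UNIV. (u z $ i) *\<^sub>R D i z) - J z *v vorticity z) \<le> 2 * (e1 * (\<epsilon> + 3 * L) + norm (vorticity z) * (\<epsilon> + 3 * e2))))"
proof -
  obtain M0 where M0: "\<And>\<tau>. \<tau> > 0 \<Longrightarrow> \<exists>k g kt gt gg. mollifier \<epsilon> \<tau> k g kt gt gg \<and> integral\<^sup>L lborel (\<lambda>z. g z * norm (fst z)) \<le> M0"
    using mollifier_exists[OF \<epsilon>(1)] by blast
  define M where "M = max M0 1"
  define \<theta> where "\<theta> = \<epsilon> / M"
  have M: "M > 0" "M0 \<le> M" by (auto simp: M_def)
  have \<theta>: "\<theta> > 0" "\<theta> * M = \<epsilon>" using M \<epsilon> by (auto simp: \<theta>_def)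
  let ?C = "cball 0 (R + 1) \<times> {a' - 1..b' + 1} :: ((real^3) \<times> real) set"
  have cC: "compact ?C" by (intro compact_Times compact_cball compact_Icc)
  have "uniformly_continuous_on ?C u"
    by (intro compact_uniformly_continuous continuous_on_subset[OF cont_u] cC) auto
  then obtain \<delta> where \<delta>: "\<delta> > 0" "\<And>z z'. z \<in> ?C \<Longrightarrow> z' \<in> ?C \<Longrightarrow> dist z' z < \<delta> \<Longrightarrow> dist (u z') (u z) < \<theta>"
    unfolding uniformly_continuous_on_def using \<theta>(1) by metis
  \<comment> \<open>small enough for the time oscillation and for the kernel to stay inside \<open>(a,b)\<close>\<close>
  define \<tau> where "\<tau> = Min {\<epsilon>, \<delta> / 2, (a' - a) / 2, (b - b') / 2}"
  have \<tau>: "\<tau> > 0" "\<tau> \<le> \<epsilon>" "\<tau> < \<delta>" "\<tau> < a' - a" "\<tau> < b - b'"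
    using R \<epsilon> \<delta>(1) by (auto simp: \<tau>_def min_def)
  obtain k g kt gt gg where m: "mollifier \<epsilon> \<tau> k g kt gt gg" "integral\<^sup>L lborel (\<lambda>z. g z * norm (fst z)) \<le> M"
    using M0[OF \<tau>(1)] M(2) order_trans by blast
  interpret mollifier \<epsilon> \<tau> k g kt gt gg by fact
  let ?K = "cball 0 \<epsilon> \<times> cball 0 \<tau> :: ((real^3) \<times> real) set"
  have K: "compact ?K" by (intro compact_Times compact_cball)
  define W where "W = mollify k vorticity"
  define Wt where "Wt = (\<lambda>z. - mollify kt vorticity z)"
  define D where "D = (\<lambda>i z. - mollify (\<lambda>v. - (fst v \<bullet> axis i 1) * g v) vorticity z)"
  have cD: "continuous_on UNIV (\<lambda>v. - (fst v \<bullet> e) * g v)" for e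
    by (intro continuous_intros cont)
  have zk: "k z = 0" "kt z = 0" "- (fst z \<bullet> e) * g z = 0" if "z \<notin> ?K" for z e using supp[OF that] by auto
  have kd: "has_dderiv k (e, 0) (- (fst z \<bullet> e) * g z) z" "has_dderiv k (0, 1) (kt z) z" for e z
    using has_dderiv_has_derivative[OF k_deriv, of "(e, 0)"] has_dderiv_has_derivative[OF k_deriv, of "(0, 1)"] by simp_all
  have 1: "continuous_on UNIV W" "continuous_on UNIV Wt" "continuous_on UNIV (D i)" for i
    unfolding W_def Wt_def D_def
    by (intro continuous_intros continuous_mollify[OF cont_w K] cont cD zk; assumption)+
  have 2: "has_dderiv W (0, 1) (Wt z) z" "has_dderiv W (axis i 1, 0) (D i z) z" for i z
    unfolding W_def Wt_def D_def
    by (rule mollify_dderiv[OF cont_w K]; (rule cont cD kd zk; assumption?))+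
  have 3: "norm (W z) \<le> Mw \<and>
       norm (Wt z + (\<Sum>i\<in>UNIV. (u z $ i) *\<^sub>R D i z)) \<le> 2 * Mw * (1 + 3 * L) \<and>
       (\<forall>e1\<ge>0. \<forall>e2. (\<forall>v. dist v z \<le> 2 * \<epsilon> \<longrightarrow> norm (vorticity v - vorticity z) \<le> e1) \<longrightarrow>
          (\<forall>x. norm (x - fst z) \<le> \<epsilon> \<longrightarrow> norm (u (x, snd z) - u z - J z *v (x - fst z)) \<le> e2 * norm (x - fst z)) \<longrightarrow>
          norm (W z - vorticity z) \<le> e1 \<and>
          norm (Wt z + (\<Sum>i\<in>UNIV. (u z $ i) *\<^sub>R D i z) - J z *v vorticity z) \<le> 2 * (e1 * (\<epsilon> + 3 * L) + norm (vorticity z) * (\<epsilon> + 3 * e2)))"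
    if z: "z \<in> cball 0 R \<times> {a'..b'}" for z
  proof -
    interpret mollified_flow u J L a b \<epsilon> \<tau> k g kt gt gg z
    proof unfold_locales
      show "cball (snd z) \<tau> \<subseteq> {a<..<b}" using z \<tau> by (auto simp: dist_real_def)
    qed
    have vs: "norm (fst v - fst z) \<le> \<epsilon>" "\<bar>snd v - snd z\<bar> \<le> \<tau>" if "v \<in> supp_set" for v
      using that unfolding supp_set_def by (auto simp: dist_norm)
    have vC: "v \<in> ?C" "(fst v, snd z) \<in> ?C" if "v \<in> supp_set" for v
    proof -
      have "norm (fst v) \<le> R + 1" using vs(1)[OF that] z \<epsilon> norm_triangle_ineq[of "fst z" "fst v - fst z"] by auto
      moreover have "snd v \<in> {a' - 1..b' + 1}" "snd z \<in> {a' - 1..b' + 1}" using vs(2)[OF that] z \<tau>(2) \<epsilon> by auto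
      ultimately show "v \<in> ?C" "(fst v, snd z) \<in> ?C" by (auto simp: mem_Times_iff)
    qed
    have vd: "dist v z \<le> 2 * \<epsilon>" if "v \<in> supp_set" for v
    proof -
      have "dist v z \<le> norm (fst v - fst z) + \<bar>snd v - snd z\<bar>"
        unfolding dist_norm using norm_Pair_le[of "fst v - fst z" "snd v - snd z"] by (cases v, cases z) simp
      then show ?thesis using vs[OF that] \<tau>(2) by simp
    qed
    have th: "norm (u v - u (fst v, snd z)) \<le> \<theta>" if "v \<in> supp_set" for v
    proof -
      have "dist v (fst v, snd z) < \<delta>" using vs(2)[OF that] \<tau>(3) by (cases v) (simp add: dist_Pair_Pair dist_real_def)
      then show ?thesis using \<delta>(2)[OF vC(2)[OF that] vC(1)[OF that]] by (simp add: dist_norm)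
    qed
    have Heq: "Wt z + (\<Sum>i\<in>UNIV. (u z $ i) *\<^sub>R D i z) = stretching"
    proof -
      have "(\<Sum>i\<in>UNIV. (u z $ i) *\<^sub>R D i z) = (LBINT v. ((u z \<bullet> offset v) * g (v - z)) *\<^sub>R vorticity v)"
      proof -
        have i: "integrable lborel (\<lambda>v. (- (fst (v - z) \<bullet> axis i 1) * g (v - z)) *\<^sub>R vorticity v)" for i
          by (rule integrable_mollify[OF cont_w K cD zk(3)])
        have "(\<Sum>i\<in>UNIV. (u z $ i) *\<^sub>R D i z) = (\<Sum>i\<in>UNIV. LBINT v. (- (u z $ i)) *\<^sub>R (- (fst (v - z) \<bullet> axis i 1) * g (v - z)) *\<^sub>R vorticity v)"
          unfolding D_def mollify_def integral_scaleR_right by simp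
        also have "\<dots> = (LBINT v. \<Sum>i\<in>UNIV. (- (u z $ i)) *\<^sub>R (- (fst (v - z) \<bullet> axis i 1) * g (v - z)) *\<^sub>R vorticity v)"
          using i by (intro Bochner_Integration.integral_sum[symmetric] integrable_scaleR_right)
        also have "(\<lambda>v. \<Sum>i\<in>UNIV. (- (u z $ i)) *\<^sub>R (- (fst (v - z) \<bullet> axis i 1) * g (v - z)) *\<^sub>R vorticity v) = (\<lambda>v. ((u z \<bullet> offset v) * g (v - z)) *\<^sub>R vorticity v)"
        proof
          fix v
          have "(- (u z $ i)) *\<^sub>R (- (fst (v - z) \<bullet> axis i 1) * g (v - z)) *\<^sub>R vorticity v = (g (v - z) * (u z $ i * offset v $ i)) *\<^sub>R vorticity v" for i
            by (simp add: offset_def inner_axis algebra_simps)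
          then show "(\<Sum>i\<in>UNIV. (- (u z $ i)) *\<^sub>R (- (fst (v - z) \<bullet> axis i 1) * g (v - z)) *\<^sub>R vorticity v) = ((u z \<bullet> offset v) * g (v - z)) *\<^sub>R vorticity v"
            by (simp only: scaleR_left.sum[symmetric] sum_distrib_left[symmetric]) (simp add: inner_vec_def mult.commute)
        qed
        finally show ?thesis .
      qed
      then show ?thesis using mollified_vorticity_eq by (simp add: Wt_def)
    qed
    have "norm (W z) \<le> Mw"
      using mollify_close[OF cont_w, of 0 Mw] Mw(1) vC(1) by (simp add: W_def)
    moreover have "norm stretching \<le> 2 * Mw * (\<theta> * M + 3 * L)"
      by (rule stretching_bound[OF th m(2) less_imp_le[OF \<theta>(1)] Mw(1)[OF vC(1)] Mw(2)])
    then have "norm stretching \<le> 2 * Mw * (1 + 3 * L)" 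
      unfolding \<theta>(2) using \<epsilon> Mw(2) by (elim order_trans) (intro mult_left_mono; simp)
    moreover have "norm (W z - vorticity z) \<le> e1 \<and> norm (stretching - J z *v vorticity z) \<le> 2 * (e1 * (\<epsilon> + 3 * L) + norm (vorticity z) * (\<epsilon> + 3 * e2))"
      if e: "e1 \<ge> 0" "\<forall>v. dist v z \<le> 2 * \<epsilon> \<longrightarrow> norm (vorticity v - vorticity z) \<le> e1"
        "\<forall>x. norm (x - fst z) \<le> \<epsilon> \<longrightarrow> norm (u (x, snd z) - u z - J z *v (x - fst z)) \<le> e2 * norm (x - fst z)" for e1 e2
    proof
      have w1: "norm (vorticity v - vorticity z) \<le> e1" if "v \<in> supp_set" for v using vd[OF that] e(2) by blast
      show "norm (W z - vorticity z) \<le> e1" unfolding W_def by (rule mollify_close[OF cont_w w1])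
      have "norm (stretching - J z *v vorticity z) \<le> 2 * (e1 * (\<theta> * M + 3 * L) + norm (vorticity z) * (\<theta> * M + 3 * e2))"
        by (rule stretching_close[OF th m(2) less_imp_le[OF \<theta>(1)] w1 _ e(1)]) (use vs(1) e(3) in \<open>auto simp: offset_def\<close>)
      then show "norm (stretching - J z *v vorticity z) \<le> 2 * (e1 * (\<epsilon> + 3 * L) + norm (vorticity z) * (\<epsilon> + 3 * e2))" unfolding \<theta>(2) .
    qed
    ultimately show ?thesis unfolding Heq by blast
  qed
  show ?thesis by (rule exI[of _ W], rule exI[of _ D], rule exI[of _ Wt]) (use 1 2 3 in blast)
qed

end

section \<open>The local power balance of the vorticity\<close>

lemma UNIV_option_sum:
  fixes f :: "('i::finite) option \<Rightarrow> 'b::comm_monoid_add"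
  shows "(\<Sum>i\<in>UNIV. f i) = f None + (\<Sum>i\<in>UNIV. f (Some i))"
proof -
  have "(\<Sum>i\<in>UNIV. f i) = f None + (\<Sum>i\<in>range Some. f i)"
    unfolding UNIV_option_conv by (subst sum.insert) auto
  then show ?thesis by (simp add: sum.reindex)
qed

context velocity_field begin

text \<open>
Bounded pointwise convergence on a cylinder, ready for dominated convergence.
\<close>

lemma mollified_sequences:
  assumes R: "a < a'" "a' \<le> b'" "b' < b"
  obtains W D Wt and M :: real where
    "\<And>n::nat. continuous_on UNIV (W n)" "\<And>n i. continuous_on UNIV (D n i)" "\<And>n. continuous_on UNIV (Wt n)"
    "\<And>n z. has_dderiv (W n) (0, 1) (Wt n z) z" "\<And>n i z. has_dderiv (W n) (axis i 1, 0) (D n i z) z"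
    "\<And>n z. z \<in> cball 0 R \<times> {a'..b'} \<Longrightarrow> norm (W n z) \<le> M"
    "\<And>n z. z \<in> cball 0 R \<times> {a'..b'} \<Longrightarrow> norm (Wt n z + (\<Sum>i\<in>UNIV. (u z $ i) *\<^sub>R D n i z)) \<le> M"
    "\<And>z. z \<in> cball 0 R \<times> {a'..b'} \<Longrightarrow> (\<lambda>n. W n z) \<longlonglongrightarrow> vorticity z"
    "\<And>z. z \<in> cball 0 R \<times> {a'..b'} \<Longrightarrow> (\<lambda>n. Wt n z + (\<Sum>i\<in>UNIV. (u z $ i) *\<^sub>R D n i z)) \<longlonglongrightarrow> J z *v vorticity z"
proof -
  have "compact (vorticity ` (cball 0 (R + 1) \<times> {a' - 1..b' + 1}))"
    by (intro compact_continuous_image continuous_on_subset[OF cont_w] compact_Times compact_cball compact_Icc) auto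
  then obtain Mw where Mw: "\<And>v. v \<in> cball 0 (R + 1) \<times> {a' - 1..b' + 1} \<Longrightarrow> norm (vorticity v) \<le> Mw" "Mw > 0"
    using compact_imp_bounded bounded_pos by (metis imageI)
  define \<epsilon> where "\<epsilon> n = inverse (real (Suc n))" for n
  have \<epsilon>: "0 < \<epsilon> n" "\<epsilon> n \<le> 1" "\<epsilon> \<longlonglongrightarrow> 0" for n
    unfolding \<epsilon>_def using LIMSEQ_inverse_real_of_nat by (auto simp: inverse_le_1_iff)
  define P where "P n W D Wt \<longleftrightarrow> continuous_on UNIV W \<and> (\<forall>i. continuous_on UNIV (D i)) \<and> continuous_on UNIV Wt \<and>
    (\<forall>z. has_dderiv W (0, 1) (Wt z) z) \<and> (\<forall>i z. has_dderiv W (axis i 1, 0) (D i z) z) \<and>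
    (\<forall>z\<in>cball 0 R \<times> {a'..b'}. norm (W z) \<le> Mw \<and>
       norm (Wt z + (\<Sum>i\<in>UNIV. (u z $ i) *\<^sub>R D i z)) \<le> 2 * Mw * (1 + 3 * L) \<and>
       (\<forall>e1\<ge>0. \<forall>e2. (\<forall>v. dist v z \<le> 2 * \<epsilon> n \<longrightarrow> norm (vorticity v - vorticity z) \<le> e1) \<longrightarrow>
          (\<forall>x. norm (x - fst z) \<le> \<epsilon> n \<longrightarrow> norm (u (x, snd z) - u z - J z *v (x - fst z)) \<le> e2 * norm (x - fst z)) \<longrightarrow>
          norm (W z - vorticity z) \<le> e1 \<and>
          norm (Wt z + (\<Sum>i\<in>UNIV. (u z $ i) *\<^sub>R D i z) - J z *v vorticity z) \<le> 2 * (e1 * (\<epsilon> n + 3 * L) + norm (vorticity z) * (\<epsilon> n + 3 * e2))))" for n W D Wt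
  have "\<forall>n. \<exists>W D Wt. P n W D Wt"
    unfolding P_def by (intro allI mollified_vorticity_exists[OF R \<epsilon>(1,2) Mw(1) less_imp_le[OF Mw(2)]])
  then obtain W D Wt where PW: "\<And>n. P n (W n) (D n) (Wt n)" by metis
  have A: "continuous_on UNIV (W n)" "continuous_on UNIV (D n i)" "continuous_on UNIV (Wt n)"
    "has_dderiv (W n) (0, 1) (Wt n z) z" "has_dderiv (W n) (axis i 1, 0) (D n i z) z" for n i z
    using PW[of n] unfolding P_def by blast+
  have B: "norm (W n z) \<le> Mw" "norm (Wt n z + (\<Sum>i\<in>UNIV. (u z $ i) *\<^sub>R D n i z)) \<le> 2 * Mw * (1 + 3 * L)"
    if "z\<in>cball 0 R \<times> {a'..b'}" for n z
    using PW[of n] that unfolding P_def by blast+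
  have C: "norm (W n z - vorticity z) \<le> e1 \<and>
          norm (Wt n z + (\<Sum>i\<in>UNIV. (u z $ i) *\<^sub>R D n i z) - J z *v vorticity z) \<le> 2 * (e1 * (\<epsilon> n + 3 * L) + norm (vorticity z) * (\<epsilon> n + 3 * e2))"
    if "z\<in>cball 0 R \<times> {a'..b'}" "e1 \<ge> 0" "\<And>v. dist v z \<le> 2 * \<epsilon> n \<Longrightarrow> norm (vorticity v - vorticity z) \<le> e1"
          "\<And>x. norm (x - fst z) \<le> \<epsilon> n \<Longrightarrow> norm (u (x, snd z) - u z - J z *v (x - fst z)) \<le> e2 * norm (x - fst z)" for n z e1 e2
    using PW[of n] that unfolding P_def by blast
  have D: "(\<lambda>n. W n z) \<longlonglongrightarrow> vorticity z \<and> (\<lambda>n. Wt n z + (\<Sum>i\<in>UNIV. (u z $ i) *\<^sub>R D n i z)) \<longlonglongrightarrow> J z *v vorticity z"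
    if z: "z \<in> cball 0 R \<times> {a'..b'}" for z
  proof -
    define c where "c = 1 + 2 * (1 + 3 * L + 3 * norm (vorticity z))"
    have c: "c \<ge> 1" using L_nonneg by (simp add: c_def)
    have ev: "\<forall>\<^sub>F n in sequentially. norm (W n z - vorticity z) \<le> s \<and>
        norm (Wt n z + (\<Sum>i\<in>UNIV. (u z $ i) *\<^sub>R D n i z) - J z *v vorticity z) \<le> c * s + 2 * norm (vorticity z) * \<epsilon> n" if s: "s > 0" for s
    proof -
      obtain d1 where d1: "d1 > 0" "\<And>v. dist v z < d1 \<Longrightarrow> norm (vorticity v - vorticity z) < s"
        using cont_w s unfolding continuous_on_iff by (metis UNIV_I dist_norm)
      have "\<exists>d>0. \<forall>x. norm (x - fst z) < d \<longrightarrow>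
          norm (u (x, snd z) - u (fst z, snd z) - J (fst z, snd z) *v (x - fst z)) \<le> s * norm (x - fst z)"
        using u_deriv[of "snd z" "fst z"] s unfolding has_derivative_at_alt by blast
      then obtain d2 where d2: "d2 > 0" "\<And>x. norm (x - fst z) < d2 \<Longrightarrow>
          norm (u (x, snd z) - u z - J z *v (x - fst z)) \<le> s * norm (x - fst z)"
        by auto
      have "\<forall>\<^sub>F n in sequentially. \<epsilon> n < min (d1 / 2) d2"
        using order_tendstoD(2)[OF \<epsilon>(3), of "min (d1 / 2) d2"] d1 d2 by simp
      then show ?thesis
      proof eventually_elim
        case (elim n)
        have "norm (W n z - vorticity z) \<le> s \<and>
          norm (Wt n z + (\<Sum>i\<in>UNIV. (u z $ i) *\<^sub>R D n i z) - J z *v vorticity z) \<le> 2 * (s * (\<epsilon> n + 3 * L) + norm (vorticity z) * (\<epsilon> n + 3 * s))"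
        proof (rule C[OF z])
          show "norm (vorticity v - vorticity z) \<le> s" if "dist v z \<le> 2 * \<epsilon> n" for v
            using d1(2)[of v] that elim by simp
          show "norm (u (x, snd z) - u z - J z *v (x - fst z)) \<le> s * norm (x - fst z)" if "norm (x - fst z) \<le> \<epsilon> n" for x
            using d2(2)[of x] that elim by simp
        qed (use s in simp)
        moreover have "s * \<epsilon> n \<le> s" using \<epsilon>(2)[of n] s by (simp add: mult_left_le)
        moreover have "2 * (s * (\<epsilon> n + 3 * L) + norm (vorticity z) * (\<epsilon> n + 3 * s)) = 2 * (s * \<epsilon> n) + 6 * (s * L) + 2 * (norm (vorticity z) * \<epsilon> n) + 6 * (norm (vorticity z) * s)"
          by (simp add: algebra_simps)
        moreover have "c * s + 2 * norm (vorticity z) * \<epsilon> n = 3 * s + 6 * (s * L) + 6 * (norm (vorticity z) * s) + 2 * (norm (vorticity z) * \<epsilon> n)"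
          by (simp add: c_def algebra_simps)
        ultimately show ?case using s by linarith
      qed
    qed
    have "(\<lambda>n. W n z - vorticity z) \<longlonglongrightarrow> 0"
    proof (rule tendstoI)
      fix e :: real assume e: "e > 0"
      show "\<forall>\<^sub>F n in sequentially. dist (W n z - vorticity z) 0 < e"
        using ev[of "e / 2"] e by (auto elim!: eventually_mono)
    qed
    moreover have "(\<lambda>n. Wt n z + (\<Sum>i\<in>UNIV. (u z $ i) *\<^sub>R D n i z) - J z *v vorticity z) \<longlonglongrightarrow> 0"
    proof (rule tendstoI)
      fix e :: real assume e: "e > 0"
      have "(\<lambda>n. 2 * norm (vorticity z) * \<epsilon> n) \<longlonglongrightarrow> 2 * norm (vorticity z) * 0" by (intro tendsto_intros \<epsilon>(3))
      then have "\<forall>\<^sub>F n in sequentially. 2 * norm (vorticity z) * \<epsilon> n < e / 2" using order_tendstoD(2)[of _ _ _ "e / 2"] e by fastforce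
      moreover have "\<forall>\<^sub>F n in sequentially. norm (Wt n z + (\<Sum>i\<in>UNIV. (u z $ i) *\<^sub>R D n i z) - J z *v vorticity z) \<le> e / 2 + 2 * norm (vorticity z) * \<epsilon> n"
        using ev[of "e / (2 * c)"] e c by (auto elim!: eventually_mono)
      ultimately show "\<forall>\<^sub>F n in sequentially. dist (Wt n z + (\<Sum>i\<in>UNIV. (u z $ i) *\<^sub>R D n i z) - J z *v vorticity z) 0 < e"
        by eventually_elim (simp add: dist_norm)
    qed
    ultimately show ?thesis by (simp add: LIM_zero_iff)
  qed
  show ?thesis
  proof (rule that[of W D Wt "max Mw (2 * Mw * (1 + 3 * L))"])
  qed (use A B D in \<open>auto simp: le_max_iff_disj\<close>)
qed

lemma powr_dderiv:
  fixes W :: "'z::real_normed_vector \<Rightarrow> real^3"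
  assumes "has_dderiv W e W' z" "\<delta> > 0"
  shows "has_dderiv (\<lambda>z. (W z \<bullet> W z + \<delta>) powr q) e (2 * q * (W z \<bullet> W z + \<delta>) powr (q - 1) * (W z \<bullet> W')) z"
proof -
  have d: "has_dderiv (\<lambda>z. W z \<bullet> W z) e (2 * (W z \<bullet> W')) z"
    using has_dderiv_inner[OF assms(1) assms(1)] by (simp add: inner_commute)
  have "((\<lambda>x. (x + \<delta>) powr q) has_real_derivative q * (W z \<bullet> W z + \<delta>) powr (q - 1)) (at (W z \<bullet> W z))"
    using assms(2) by (auto intro!: derivative_eq_intros simp: add_nonneg_pos)
  from has_dderiv_real_comp[OF this d] show ?thesis by (simp add: mult_ac)
qed

context
  fixes \<eta> \<eta>' :: "real \<Rightarrow> real" and \<zeta> :: "real^3 \<Rightarrow> real" and X :: "real^3 \<Rightarrow> real^3" and R a' b' :: real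
  assumes time: "a < a'" "a' \<le> b'" "b' < b"
    and \<eta>: "\<And>t. (\<eta> has_real_derivative \<eta>' t) (at t)" "continuous_on UNIV \<eta>'" "\<And>t. t \<notin> {a'..b'} \<Longrightarrow> \<eta> t = 0"
    and \<zeta>: "\<And>x. (\<zeta> has_derivative (\<lambda>h. X x \<bullet> h)) (at x)" "continuous_on UNIV X" "\<And>x. x \<notin> cball 0 R \<Longrightarrow> \<zeta> x = 0"
begin

lemma cont_cutoff: "continuous_on UNIV \<eta>" "continuous_on UNIV \<zeta>"
  using DERIV_isCont[OF \<eta>(1)] has_derivative_continuous[OF \<zeta>(1)]
  by (auto simp: continuous_on_eq_continuous_at)

lemma cont_comp:
  "continuous_on S f \<Longrightarrow> continuous_on S (\<lambda>z. \<eta> (f z))"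
  "continuous_on S f \<Longrightarrow> continuous_on S (\<lambda>z. \<eta>' (f z))"
  "continuous_on S f' \<Longrightarrow> continuous_on S (\<lambda>z. \<zeta> (f' z))"
  "continuous_on S f' \<Longrightarrow> continuous_on S (\<lambda>z. X (f' z))"
  by (auto intro: continuous_on_compose2[OF cont_cutoff(1)] continuous_on_compose2[OF cont_cutoff(2)]
     continuous_on_compose2[OF \<eta>(2)] continuous_on_compose2[OF \<zeta>(2)])

lemma cutoff_zero: "t \<notin> {a'..b'} \<Longrightarrow> \<eta>' t = 0" "x \<notin> cball 0 R \<Longrightarrow> X x = 0"
proof -
  assume t: "t \<notin> {a'..b'}"
  have "has_dderiv \<eta> 1 (\<eta>' t) t"
    using has_dderiv_has_derivative[OF \<eta>(1)[unfolded has_field_derivative_def], of 1] by simp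
  from has_dderiv_zero_outside[OF compact_Icc \<eta>(3) this t] show "\<eta>' t = 0" .
next
  assume x: "x \<notin> cball 0 R"
  have "X x \<bullet> X x = 0"
    by (rule has_dderiv_zero_outside[OF compact_cball \<zeta>(3) has_dderiv_has_derivative[OF \<zeta>(1)] x])
  then show "X x = 0" by simp
qed

abbreviation "cylinder \<equiv> cball 0 R \<times> {a'..b'} :: ((real^3) \<times> real) set"

lemma compact_cylinder: "compact cylinder" by (intro compact_Times compact_cball compact_Icc)

lemma cylinder_zero:
  assumes "z \<notin> cylinder"
  shows "\<eta> (snd z) * \<zeta> (fst z) = 0" "\<eta>' (snd z) * \<zeta> (fst z) = 0" "\<eta> (snd z) * (c \<bullet> X (fst z)) = 0"
  using assms \<eta>(3)[of "snd z"] \<zeta>(3)[of "fst z"] cutoff_zero(1)[of "snd z"] cutoff_zero(2)[of "fst z"]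
  by (auto simp: mem_Times_iff)

lemma cutoff_dderiv:
  "has_dderiv (\<lambda>z. \<eta> (snd z) * \<zeta> (fst z)) (0, 1) (\<eta>' (snd z) * \<zeta> (fst z)) z"
  "has_dderiv (\<lambda>z. \<eta> (snd z) * \<zeta> (fst z)) (e, 0) (\<eta> (snd z) * (X (fst z) \<bullet> e)) z"
proof -
  have "((\<lambda>z. \<eta> (snd z)) has_derivative (\<lambda>h. \<eta>' (snd z) * snd h)) (at z)"
    using diff_chain_at[OF has_derivative_snd[OF has_derivative_ident] \<eta>(1)[unfolded has_field_derivative_def, of "snd z"]]
    by (simp add: o_def)
  moreover have "((\<lambda>z. \<zeta> (fst z)) has_derivative (\<lambda>h. X (fst z) \<bullet> fst h)) (at z)"
    using diff_chain_at[OF has_derivative_fst[OF has_derivative_ident] \<zeta>(1)[of "fst z"]]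
    by (simp add: o_def)
  ultimately have "((\<lambda>z. \<eta> (snd z) * \<zeta> (fst z)) has_derivative
     (\<lambda>h. \<eta> (snd z) * (X (fst z) \<bullet> fst h) + \<eta>' (snd z) * snd h * \<zeta> (fst z))) (at z)"
    by (rule has_derivative_mult)
  from has_dderiv_has_derivative[OF this, of "(0, 1)"] has_dderiv_has_derivative[OF this, of "(e, 0)"]
  show "has_dderiv (\<lambda>z. \<eta> (snd z) * \<zeta> (fst z)) (0, 1) (\<eta>' (snd z) * \<zeta> (fst z)) z"
    "has_dderiv (\<lambda>z. \<eta> (snd z) * \<zeta> (fst z)) (e, 0) (\<eta> (snd z) * (X (fst z) \<bullet> e)) z" by simp_all
qed

text \<open>
Integration by parts of \<open>\<eta> \<zeta> (|W|\<^sup>2 + \<delta>)\<^sup>q\<close> along \<open>(u, 1)\<close>. The divergence of \<open>u\<close> vanishes, and the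
derivatives of \<open>W\<close> only appear in the combination known from the mollified vorticity equation.
\<close>

lemma smooth_identity:
  fixes W Wt :: "(real^3) \<times> real \<Rightarrow> real^3"
  assumes c: "continuous_on UNIV W" "\<And>i. continuous_on UNIV (D i)" "continuous_on UNIV Wt"
    and d: "\<And>z. has_dderiv W (0, 1) (Wt z) z" "\<And>i z. has_dderiv W (axis i 1, 0) (D i z) z"
    and \<delta>: "\<delta> > 0"
  shows "(LBINT z. \<eta>' (snd z) * \<zeta> (fst z) * (W z \<bullet> W z + \<delta>) powr q + \<eta> (snd z) * (u z \<bullet> X (fst z)) * (W z \<bullet> W z + \<delta>) powr q
     + \<eta> (snd z) * \<zeta> (fst z) * (2 * q * (W z \<bullet> W z + \<delta>) powr (q - 1) * (W z \<bullet> (Wt z + (\<Sum>i\<in>UNIV. (u z $ i) *\<^sub>R D i z))))) = 0"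
proof (rule integral_sum_dderiv_zero[OF compact_cylinder, of "UNIV :: 3 option set"])
  \<comment> \<open>the index \<open>None\<close> stands for the time direction, \<open>Some j\<close> for the \<open>j\<close>-th space direction\<close>
  define \<phi> where "\<phi> z = \<eta> (snd z) * \<zeta> (fst z)" for z :: "(real^3) \<times> real"
  define B where "B z = (W z \<bullet> W z + \<delta>) powr q" for z
  define P where "P z = 2 * q * (W z \<bullet> W z + \<delta>) powr (q - 1)" for z
  define F where "F i z = (case i of None \<Rightarrow> \<phi> z * B z | Some j \<Rightarrow> (\<phi> z * B z) * u z $ j)" for i and z :: "(real^3) \<times> real"
  define F' where "F' i z = (case i of None \<Rightarrow> \<phi> z * (P z * (W z \<bullet> Wt z)) + \<eta>' (snd z) * \<zeta> (fst z) * B z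
     | Some j \<Rightarrow> (\<phi> z * B z) * (J z *v axis j 1) $ j + (\<phi> z * (P z * (W z \<bullet> D j z)) + (\<eta> (snd z) * (X (fst z) \<bullet> axis j 1)) * B z) * u z $ j)" for i and z :: "(real^3) \<times> real"
  note defs = F_def F'_def \<phi>_def B_def P_def
  have pos: "W z \<bullet> W z + \<delta> \<noteq> 0" for z using \<delta> inner_ge_zero[of "W z"] by linarith
  note c_mat = bounded_bilinear.continuous_on[OF mat_vec_mult_bilinear]
  show "F i z = 0" if "z \<notin> cylinder" for i z using cylinder_zero(1)[OF that] by (simp add: F_def \<phi>_def split: option.split)
  have cB: "continuous_on UNIV B" "continuous_on UNIV P" "continuous_on UNIV \<phi>"
    unfolding defs by (intro continuous_intros cont_comp c; simp add: pos)+
  show "continuous_on UNIV (F i)" "continuous_on UNIV (F' i)" for i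
    unfolding F_def F'_def
    by (cases i; simp; intro continuous_intros cont_comp cB c cont_u cont_J c_mat)+
  show "has_dderiv (F i) (case i of None \<Rightarrow> (0, 1) | Some j \<Rightarrow> (axis j 1, 0)) (F' i z) z" for i z
  proof (cases i)
    case None
    then show ?thesis
      using has_dderiv_mult[OF cutoff_dderiv(1)[of z] powr_dderiv[OF d(1)[of z] \<delta>, of q]]
      by (simp add: F_def[abs_def] F'_def \<phi>_def[abs_def] B_def[abs_def] P_def)
  next
    case (Some j)
    then show ?thesis
      using has_dderiv_mult[OF has_dderiv_mult[OF cutoff_dderiv(2) powr_dderiv[OF d(2)[of j z] \<delta>, of q]]
        has_dderiv_linear[OF bounded_linear_vec_nth u_dderiv]]
      by (simp add: F_def[abs_def] F'_def \<phi>_def[abs_def] B_def[abs_def] P_def)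
  qed
  show "\<eta>' (snd z) * \<zeta> (fst z) * (W z \<bullet> W z + \<delta>) powr q + \<eta> (snd z) * (u z \<bullet> X (fst z)) * (W z \<bullet> W z + \<delta>) powr q
     + \<eta> (snd z) * \<zeta> (fst z) * (2 * q * (W z \<bullet> W z + \<delta>) powr (q - 1) * (W z \<bullet> (Wt z + (\<Sum>i\<in>UNIV. (u z $ i) *\<^sub>R D i z))))
     = (\<Sum>i\<in>UNIV. F' i z)" for z
  proof -
    have tr: "(J z *v axis 1 1) $ 1 + (J z *v axis 2 1) $ 2 + (J z *v axis 3 1) $ 3 = 0"
      using div_free[of z] by (simp add: vec3_simps)
    have "(\<Sum>j\<in>UNIV. F' (Some j) z) = (\<phi> z * B z) * ((J z *v axis 1 1) $ 1 + (J z *v axis 2 1) $ 2 + (J z *v axis 3 1) $ 3)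
      + \<phi> z * P z * (W z \<bullet> (\<Sum>i\<in>UNIV. (u z $ i) *\<^sub>R D i z)) + \<eta> (snd z) * (u z \<bullet> X (fst z)) * B z"
      by (simp add: F'_def sum_3 inner_axis inner_add_right inner_vec_def[of "u z"] algebra_simps)
    moreover have "F' None z = \<phi> z * (P z * (W z \<bullet> Wt z)) + \<eta>' (snd z) * \<zeta> (fst z) * B z" by (simp add: F'_def)
    ultimately have "(\<Sum>i\<in>UNIV. F' i z) = \<eta>' (snd z) * \<zeta> (fst z) * B z + \<eta> (snd z) * (u z \<bullet> X (fst z)) * B z
      + \<phi> z * (P z * (W z \<bullet> (Wt z + (\<Sum>i\<in>UNIV. (u z $ i) *\<^sub>R D i z))))"
      unfolding UNIV_option_sum tr by (simp add: inner_add_right algebra_simps)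
    then show ?thesis by (simp only: \<phi>_def B_def P_def)
  qed
qed

text \<open>
With \<open>\<delta> > 0\<close> the power with exponent \<open>q - 1 \<le> 0\<close> stays bounded near zeros of the vorticity, so that the mollifier can
be removed by dominated convergence.
\<close>

lemma renormalised_identity:
  assumes \<delta>: "\<delta> > 0" and q: "0 < q" "q \<le> 1"
  shows "(LBINT z. \<eta>' (snd z) * \<zeta> (fst z) * (vorticity z \<bullet> vorticity z + \<delta>) powr q + \<eta> (snd z) * (u z \<bullet> X (fst z)) * (vorticity z \<bullet> vorticity z + \<delta>) powr q
     + \<eta> (snd z) * \<zeta> (fst z) * (2 * q * (vorticity z \<bullet> vorticity z + \<delta>) powr (q - 1) * (vorticity z \<bullet> (J z *v vorticity z)))) = 0" (is "integral\<^sup>L lborel ?f = 0")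
proof -
  obtain W D Wt and M :: real where c: 
    "\<And>n::nat. continuous_on UNIV (W n)" "\<And>n i. continuous_on UNIV (D n i)" "\<And>n. continuous_on UNIV (Wt n)"
    "\<And>n z. has_dderiv (W n) (0, 1) (Wt n z) z" "\<And>n i z. has_dderiv (W n) (axis i 1, 0) (D n i z) z"
    and W: "\<And>n z. z \<in> cylinder \<Longrightarrow> norm (W n z) \<le> M"
    "\<And>n z. z \<in> cylinder \<Longrightarrow> norm (Wt n z + (\<Sum>i\<in>UNIV. (u z $ i) *\<^sub>R D n i z)) \<le> M"
    "\<And>z. z \<in> cylinder \<Longrightarrow> (\<lambda>n. W n z) \<longlonglongrightarrow> vorticity z"
    "\<And>z. z \<in> cylinder \<Longrightarrow> (\<lambda>n. Wt n z + (\<Sum>i\<in>UNIV. (u z $ i) *\<^sub>R D n i z)) \<longlonglongrightarrow> J z *v vorticity z"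
    by (rule mollified_sequences[OF time, of R]) (rule that; assumption)
  define H where "H n z = Wt n z + (\<Sum>i\<in>UNIV. (u z $ i) *\<^sub>R D n i z)" for n z
  define s where "s n z = \<eta>' (snd z) * \<zeta> (fst z) * (W n z \<bullet> W n z + \<delta>) powr q + \<eta> (snd z) * (u z \<bullet> X (fst z)) * (W n z \<bullet> W n z + \<delta>) powr q
     + \<eta> (snd z) * \<zeta> (fst z) * (2 * q * (W n z \<bullet> W n z + \<delta>) powr (q - 1) * (W n z \<bullet> H n z))" for n z
  define m where "m z = (\<bar>\<eta>' (snd z) * \<zeta> (fst z)\<bar> + \<bar>\<eta> (snd z) * (u z \<bullet> X (fst z))\<bar>) * (M * M + \<delta>) powr q
     + \<bar>\<eta> (snd z) * \<zeta> (fst z)\<bar> * (2 * q * \<delta> powr (q - 1) * (M * M))" for z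
  note c_mat = bounded_bilinear.continuous_on[OF mat_vec_mult_bilinear]
  have pos: "v \<bullet> v + \<delta> \<noteq> 0" for v :: "real^3" using \<delta> inner_ge_zero[of v] by linarith
  have z: "?f z = 0" "s n z = 0" "m z = 0" if "z \<notin> cylinder" for n z
    using cylinder_zero(1,2)[OF that] cylinder_zero(3)[OF that, of "u z"] by (auto simp: s_def m_def)
  have cs: "continuous_on UNIV (s n)" for n
    unfolding s_def H_def by (intro continuous_intros cont_comp c cont_u; simp add: pos)
  have cf: "continuous_on UNIV ?f" by (intro continuous_intros cont_comp cont_w cont_u cont_J c_mat; simp add: pos)
  have cm: "continuous_on UNIV m" unfolding m_def by (intro continuous_intros cont_comp cont_u)
  have zero: "integral\<^sup>L lborel (s n) = 0" for n
    unfolding s_def H_def by (rule smooth_identity[OF c \<delta>])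
  have "(\<lambda>n. integral\<^sup>L lborel (s n)) \<longlonglongrightarrow> integral\<^sup>L lborel ?f"
  proof (rule integral_dominated_convergence)
    show "?f \<in> borel_measurable lborel" "s n \<in> borel_measurable lborel" for n
      using cs cf by (auto intro: borel_measurable_continuous_onI)
    show "integrable lborel m" by (rule integrable_compact_support[OF cm compact_cylinder z(3)])
    show "AE z in lborel. (\<lambda>n. s n z) \<longlonglongrightarrow> ?f z"
    proof (rule AE_I2)
      fix x
      show "(\<lambda>n. s n x) \<longlonglongrightarrow> ?f x"
      proof (cases "x \<in> cylinder")
        case True
        show ?thesis unfolding s_def H_def by (intro tendsto_intros W(3,4)[OF True] disjI1 pos)
      next
        case False then show ?thesis using z[OF False] by simp
      qed
    qed
    show "AE x in lborel. norm (s n x) \<le> m x" for n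
    proof (rule AE_I2)
      fix x
      show "norm (s n x) \<le> m x"
      proof (cases "x \<in> cylinder")
        case True
        have WM: "W n x \<bullet> W n x \<le> M * M"
          using mult_mono'[OF W(1)[OF True] W(1)[OF True] norm_ge_zero norm_ge_zero, of n n] by (simp add: dot_square_norm power2_eq_square)
        have 1: "\<bar>(W n x \<bullet> W n x + \<delta>) powr q\<bar> \<le> (M * M + \<delta>) powr q"
          using WM \<delta> q by (auto intro!: powr_mono2)
        have "(W n x \<bullet> W n x + \<delta>) powr (q - 1) \<le> \<delta> powr (q - 1)"
          using \<delta> q by (intro powr_mono2') auto
        moreover have "\<bar>W n x \<bullet> H n x\<bar> \<le> M * M"
          using Cauchy_Schwarz_ineq2[of "W n x" "H n x"] mult_mono[OF W(1)[OF True, of n] W(2)[OF True, of n]] norm_ge_zero[of "W n x"] W(1)[OF True, of n]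
          unfolding H_def by (smt (verit) norm_ge_zero)
        ultimately have 2: "\<bar>2 * q * (W n x \<bullet> W n x + \<delta>) powr (q - 1) * (W n x \<bullet> H n x)\<bar> \<le> 2 * q * \<delta> powr (q - 1) * (M * M)"
          using q by (auto simp: abs_mult intro!: mult_mono)
        have "norm (s n x) \<le> \<bar>\<eta>' (snd x) * \<zeta> (fst x)\<bar> * \<bar>(W n x \<bullet> W n x + \<delta>) powr q\<bar> + \<bar>\<eta> (snd x) * (u x \<bullet> X (fst x))\<bar> * \<bar>(W n x \<bullet> W n x + \<delta>) powr q\<bar>
          + \<bar>\<eta> (snd x) * \<zeta> (fst x)\<bar> * \<bar>2 * q * (W n x \<bullet> W n x + \<delta>) powr (q - 1) * (W n x \<bullet> H n x)\<bar>"
          unfolding s_def real_norm_def abs_mult[symmetric] by linarith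
        also have "\<dots> \<le> m x"
          unfolding m_def distrib_right by (intro add_mono mult_left_mono 1 2) auto
        finally show ?thesis .
      next
        case False then show ?thesis using z[OF False] by simp
      qed
    qed
  qed
  then show ?thesis unfolding zero by (simp add: LIMSEQ_const_iff)
qed

text \<open>
The factor \<open>q\<close> on the right is the point. It comes from the derivative of the power and survives the limit \<open>\<delta> \<rightarrow> 0\<close>,
because \<open>|x|\<^sup>2 (|x|\<^sup>2 + \<delta>) powr (q - 1) \<le> (|x|\<^sup>2) powr q\<close> for \<open>q \<le> 1\<close>, uniformly in \<open>\<delta>\<close>.
\<close>

lemma local_power_bound:
  assumes q: "0 < q" "q \<le> 1"
  shows "\<bar>LBINT z. (\<eta>' (snd z) * \<zeta> (fst z) + \<eta> (snd z) * (u z \<bullet> X (fst z))) * (vorticity z \<bullet> vorticity z) powr q\<bar>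
    \<le> 2 * q * L * (LBINT z. \<bar>\<eta> (snd z) * \<zeta> (fst z)\<bar> * (vorticity z \<bullet> vorticity z) powr q)"
proof -
  note c_mat = bounded_bilinear.continuous_on[OF mat_vec_mult_bilinear]
  define A where "A z = \<eta>' (snd z) * \<zeta> (fst z) + \<eta> (snd z) * (u z \<bullet> X (fst z))" for z
  have A0: "A z = 0" if "z \<notin> cylinder" for z using cylinder_zero(2)[OF that] cylinder_zero(3)[OF that, of "u z"] by (auto simp: A_def)
  have cA: "continuous_on UNIV A" unfolding A_def by (intro continuous_intros cont_comp cont_u)
  have pos: "v \<bullet> v + \<delta> \<noteq> 0" if "\<delta> > 0" for v :: "real^3" and \<delta> using that inner_ge_zero[of v] by linarith
  have cq: "continuous_on UNIV (\<lambda>z. (vorticity z \<bullet> vorticity z) powr q)"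
    by (rule continuous_on_powr') (use q in \<open>auto intro!: continuous_intros cont_comp cont_w\<close>)
  have cqd: "continuous_on UNIV (\<lambda>z. (vorticity z \<bullet> vorticity z + \<delta>) powr q)" if "\<delta> > 0" for \<delta>
    by (intro continuous_intros cont_comp cont_w) (simp add: pos that)
  have iR: "integrable lborel (\<lambda>z. \<bar>\<eta> (snd z) * \<zeta> (fst z)\<bar> * (vorticity z \<bullet> vorticity z) powr q)"
    by (rule integrable_compact_support[OF _ compact_cylinder]) (auto intro!: continuous_intros cont_comp cq simp: cylinder_zero)
  define R where "R = 2 * q * L * (LBINT z. \<bar>\<eta> (snd z) * \<zeta> (fst z)\<bar> * (vorticity z \<bullet> vorticity z) powr q)"
  have step: "\<bar>LBINT z. A z * (vorticity z \<bullet> vorticity z + \<delta>) powr q\<bar> \<le> R" if \<delta>: "\<delta> > 0" for \<delta>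
  proof -
    let ?g = "\<lambda>z. \<eta> (snd z) * \<zeta> (fst z) * (2 * q * (vorticity z \<bullet> vorticity z + \<delta>) powr (q - 1) * (vorticity z \<bullet> (J z *v vorticity z)))"
    have i1: "integrable lborel (\<lambda>z. A z * (vorticity z \<bullet> vorticity z + \<delta>) powr q)"
      by (rule integrable_compact_support[OF _ compact_cylinder]) (auto intro!: continuous_intros cont_comp cA cqd \<delta> simp: A0)
    have i2: "integrable lborel ?g"
      by (rule integrable_compact_support[OF _ compact_cylinder]; (intro continuous_intros cont_comp cont_w cont_J c_mat; simp add: pos \<delta>)?) (simp add: cylinder_zero)
    have "(LBINT z. A z * (vorticity z \<bullet> vorticity z + \<delta>) powr q + ?g z) = 0"
      using renormalised_identity[OF \<delta> q] by (simp add: A_def distrib_right)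
    then have "(LBINT z. A z * (vorticity z \<bullet> vorticity z + \<delta>) powr q) = - integral\<^sup>L lborel ?g" using i1 i2 by simp
    then have "\<bar>LBINT z. A z * (vorticity z \<bullet> vorticity z + \<delta>) powr q\<bar> = norm (integral\<^sup>L lborel ?g)" by simp
    also have "\<dots> \<le> (LBINT z. (2 * q * L) * (\<bar>\<eta> (snd z) * \<zeta> (fst z)\<bar> * (vorticity z \<bullet> vorticity z) powr q))"
    proof (rule Bochner_Integration.integral_norm_bound_integral[OF i2 integrable_mult_right[OF iR]])
      fix z
      \<comment> \<open>at zeros of the vorticity the left-hand side vanishes, so that only \<open>powr\<close> of positive numbers matters\<close>
      have "(vorticity z \<bullet> vorticity z + \<delta>) powr (q - 1) * \<bar>vorticity z \<bullet> (J z *v vorticity z)\<bar> \<le> L * (vorticity z \<bullet> vorticity z) powr q"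
      proof (cases "vorticity z = 0")
        case False
        then have p: "vorticity z \<bullet> vorticity z > 0" by simp
        have "\<bar>vorticity z \<bullet> (J z *v vorticity z)\<bar> \<le> norm (vorticity z) * (L * norm (vorticity z))"
          using Cauchy_Schwarz_ineq2 mult_left_mono[OF grad_bound norm_ge_zero] order_trans by metis
        also have "\<dots> = L * (vorticity z \<bullet> vorticity z)" by (simp add: dot_square_norm power2_eq_square)
        finally have "(vorticity z \<bullet> vorticity z + \<delta>) powr (q - 1) * \<bar>vorticity z \<bullet> (J z *v vorticity z)\<bar> \<le> (vorticity z \<bullet> vorticity z) powr (q - 1) * (L * (vorticity z \<bullet> vorticity z))"
          using p \<delta> q by (intro mult_mono powr_mono2') auto
        also have "\<dots> = L * ((vorticity z \<bullet> vorticity z) powr (q - 1) * (vorticity z \<bullet> vorticity z) powr 1)" using p by simp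
        also have "\<dots> = L * (vorticity z \<bullet> vorticity z) powr q" unfolding powr_add[symmetric] by simp
        finally show ?thesis .
      qed (simp add: L_nonneg)
      then have "\<bar>\<eta> (snd z) * \<zeta> (fst z)\<bar> * (2 * q * ((vorticity z \<bullet> vorticity z + \<delta>) powr (q - 1) * \<bar>vorticity z \<bullet> (J z *v vorticity z)\<bar>)) \<le> \<bar>\<eta> (snd z) * \<zeta> (fst z)\<bar> * (2 * q * (L * (vorticity z \<bullet> vorticity z) powr q))"
        using q by (intro mult_left_mono) auto
      then show "norm (?g z) \<le> (2 * q * L) * (\<bar>\<eta> (snd z) * \<zeta> (fst z)\<bar> * (vorticity z \<bullet> vorticity z) powr q)"
        using q by (simp add: abs_mult mult_ac)
    qed
    finally show ?thesis by (simp add: R_def)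
  qed
  define \<delta> where "\<delta> n = inverse (real (Suc n))" for n
  have d: "\<delta> n > 0" "\<delta> n \<le> 1" "\<delta> \<longlonglongrightarrow> 0" for n
    unfolding \<delta>_def using LIMSEQ_inverse_real_of_nat by (auto simp: inverse_le_1_iff)
  have "(\<lambda>n. LBINT z. A z * (vorticity z \<bullet> vorticity z + \<delta> n) powr q) \<longlonglongrightarrow> (LBINT z. A z * (vorticity z \<bullet> vorticity z) powr q)"
  proof (rule integral_dominated_convergence)
    show "(\<lambda>z. A z * (vorticity z \<bullet> vorticity z) powr q) \<in> borel_measurable lborel" "(\<lambda>z. A z * (vorticity z \<bullet> vorticity z + \<delta> n) powr q) \<in> borel_measurable lborel" for n
      using continuous_on_mult[OF cA cq] continuous_on_mult[OF cA cqd[OF d(1)]] by (auto intro: borel_measurable_continuous_onI)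
    show "integrable lborel (\<lambda>z. \<bar>A z\<bar> * (vorticity z \<bullet> vorticity z + 1) powr q)"
      by (rule integrable_compact_support[OF _ compact_cylinder]) (auto intro!: continuous_intros cont_comp cA cqd simp: A0)
    show "AE z in lborel. (\<lambda>n. A z * (vorticity z \<bullet> vorticity z + \<delta> n) powr q) \<longlonglongrightarrow> A z * (vorticity z \<bullet> vorticity z) powr q"
    proof (rule AE_I2)
      fix z
      have "(\<lambda>n. (vorticity z \<bullet> vorticity z + \<delta> n) powr q) \<longlonglongrightarrow> (vorticity z \<bullet> vorticity z + 0) powr q"
        by (rule tendsto_powr'[OF tendsto_add[OF tendsto_const d(3)] tendsto_const])
          (use d q in \<open>auto intro!: always_eventually simp: add_nonneg_nonneg less_imp_le\<close>)
      then show "(\<lambda>n. A z * (vorticity z \<bullet> vorticity z + \<delta> n) powr q) \<longlonglongrightarrow> A z * (vorticity z \<bullet> vorticity z) powr q"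
        by (intro tendsto_mult tendsto_const) simp
    qed
    show "AE z in lborel. norm (A z * (vorticity z \<bullet> vorticity z + \<delta> n) powr q) \<le> \<bar>A z\<bar> * (vorticity z \<bullet> vorticity z + 1) powr q" for n
      using d(1)[of n] d(2)[of n] q by (intro AE_I2) (auto simp: abs_mult intro!: mult_left_mono powr_mono2)
  qed
  from tendsto_rabs[OF this] have "\<bar>LBINT z. A z * (vorticity z \<bullet> vorticity z) powr q\<bar> \<le> R"
    by (rule tendsto_upperbound) (auto intro!: always_eventually step d)
  then show ?thesis by (simp add: A_def R_def)
qed

end

end

section \<open>The global power balance\<close>

lemma radial_cutoff_deriv:
  fixes x :: "'a::real_inner"
  shows "((\<lambda>x. (max 0 (1 - c * (x \<bullet> x)))\<^sup>2) has_derivative (\<lambda>h. ((- 4 * c * max 0 (1 - c * (x \<bullet> x))) *\<^sub>R x) \<bullet> h)) (at x)"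
proof -
  have 1: "((\<lambda>x. 1 - c * (x \<bullet> x)) has_derivative (\<lambda>h. - 2 * c * (x \<bullet> h))) (at x)"
    by (auto intro!: derivative_eq_intros simp: inner_commute)
  have 2: "((\<lambda>y::real. (max 0 y)\<^sup>2) has_derivative (\<lambda>h. 2 * max 0 (1 - c * (x \<bullet> x)) * h)) (at (1 - c * (x \<bullet> x)))"
    using max_power_DERIV[of 0] unfolding has_field_derivative_def by (simp add: numeral_2_eq_2)
  from diff_chain_at[OF 1 2] show ?thesis by (simp add: o_def mult_ac)
qed

context velocity_field begin

lemma linear_growth:
  obtains C where "C \<ge> 0" "\<And>z. snd z \<in> {s..t} \<Longrightarrow> norm (u z) \<le> C * (1 + norm (fst z))"
proof -
  have "compact ((\<lambda>r. u (0, r)) ` {s..t})"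
    by (intro compact_continuous_image continuous_on_compose2[OF cont_u] continuous_intros) auto
  then obtain B where B: "\<And>r. r \<in> {s..t} \<Longrightarrow> norm (u (0, r)) \<le> B" "B > 0"
    using compact_imp_bounded bounded_pos by (metis imageI)
  show ?thesis
  proof (rule that[of "B + L"])
    show "B + L \<ge> 0" using B L_nonneg by simp
    fix z :: "(real^3) \<times> real" assume "snd z \<in> {s..t}"
    then have "norm (u (0, snd z)) \<le> B" using B by blast
    moreover have "norm (u z - u (0, snd z)) \<le> L * norm (fst z)" using u_lipschitz[of "fst z" "snd z" 0] by simp
    ultimately have "norm (u z) \<le> B + L * norm (fst z)" using norm_triangle_ineq2[of "u z" "u (0, snd z)"] by linarith
    also have "\<dots> \<le> (B + L) * (1 + norm (fst z))" using B L_nonneg by (simp add: algebra_simps)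
    finally show "norm (u z) \<le> (B + L) * (1 + norm (fst z))" .
  qed
qed

text \<open>
The gradient of the cut-off at radius \<open>\<rho>\<close> is of order \<open>1/\<rho>\<close> while the velocity is of order \<open>\<rho>\<close>. The transport term is thus bounded,
not small, but it tends to 0 at every point, which suffices for dominated convergence.
\<close>

lemma global_power_bound:
  assumes time: "a < a'" "a' \<le> b'" "b' < b"
    and \<eta>: "\<And>t. (\<eta> has_real_derivative \<eta>' t) (at t)" "continuous_on UNIV \<eta>'" "\<And>t. t \<notin> {a'..b'} \<Longrightarrow> \<eta> t = 0"
    and q: "0 < q" "q \<le> 1"
    and int: "integrable lborel (\<lambda>z. indicator {a'..b'} (snd z) * (vorticity z \<bullet> vorticity z) powr q)"
  shows "\<bar>LBINT z. \<eta>' (snd z) * (vorticity z \<bullet> vorticity z) powr q\<bar> \<le> 2 * q * L * (LBINT z. \<bar>\<eta> (snd z)\<bar> * (vorticity z \<bullet> vorticity z) powr q)"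
proof -
  define \<rho> where "\<rho> n = real (Suc n)" for n
  define c where "c n = inverse (\<rho> n) ^ 2" for n
  define m where "m n x = max 0 (1 - c n * (x \<bullet> x))" for n and x :: "real^3"
  define \<zeta> where "\<zeta> n x = (m n x)\<^sup>2" for n x
  define X where "X n x = (- 4 * c n * m n x) *\<^sub>R x" for n x
  have \<rho>: "\<rho> n \<ge> 1" for n by (simp add: \<rho>_def)
  have c0: "c n > 0" for n using \<rho>[of n] by (simp add: c_def)
  have m0: "m n x = 0" if "norm x > \<rho> n" for n x
  proof -
    have "(\<rho> n)\<^sup>2 \<le> x \<bullet> x" using that \<rho>[of n] by (simp add: dot_square_norm power_mono)
    then have "c n * (x \<bullet> x) \<ge> 1" using \<rho>[of n] by (simp add: c_def field_simps)
    then show ?thesis by (simp add: m_def)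
  qed
  have m1: "0 \<le> m n x" "m n x \<le> 1" for n x using c0[of n] by (auto simp: m_def)
  have \<zeta>d: "(\<zeta> n has_derivative (\<lambda>h. X n x \<bullet> h)) (at x)" for n x
    using radial_cutoff_deriv[of "c n" x] by (simp add: \<zeta>_def[abs_def] X_def m_def)
  have Xc: "continuous_on UNIV (X n)" for n unfolding X_def m_def by (intro continuous_intros)
  have \<zeta>c: "continuous_on UNIV (\<zeta> n)" for n unfolding \<zeta>_def m_def by (intro continuous_intros)
  have \<zeta>0: "\<zeta> n x = 0" if "x \<notin> cball 0 (\<rho> n)" for n x using m0[of n x] that by (simp add: \<zeta>_def)
  note loc = local_power_bound[OF time \<eta> \<zeta>d Xc \<zeta>0 q]
  have \<eta>'0: "\<eta>' t = 0" if "t \<notin> {a'..b'}" for t by (rule cutoff_zero(1)[OF time \<eta> \<zeta>d Xc \<zeta>0 that])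
  have c\<eta>: "continuous_on UNIV \<eta>" using DERIV_isCont[OF \<eta>(1)] by (simp add: continuous_on_eq_continuous_at)
  have "compact (\<eta> ` {a'..b'})" "compact (\<eta>' ` {a'..b'})"
    by (intro compact_continuous_image continuous_on_subset[OF c\<eta>] continuous_on_subset[OF \<eta>(2)] compact_Icc subset_UNIV)+
  then obtain E1 E2 where "\<And>t. t \<in> {a'..b'} \<Longrightarrow> \<bar>\<eta> t\<bar> \<le> E1" "\<And>t. t \<in> {a'..b'} \<Longrightarrow> \<bar>\<eta>' t\<bar> \<le> E2"
    using compact_imp_bounded bounded_real by (metis imageI)
  then have E: "\<bar>\<eta> t\<bar> \<le> max E1 E2 * indicator {a'..b'} t" "\<bar>\<eta>' t\<bar> \<le> max E1 E2 * indicator {a'..b'} t" for t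
    using \<eta>(3)[of t] \<eta>'0[of t] by (cases "t \<in> {a'..b'}"; force)+
  define E where "E = max E1 E2"
  obtain C where C: "C \<ge> 0" "\<And>z. snd z \<in> {a'..b'} \<Longrightarrow> norm (u z) \<le> C * (1 + norm (fst z))" using linear_growth by blast
  have Xb: "\<bar>u z \<bullet> X n (fst z)\<bar> \<le> 8 * C" if t: "snd z \<in> {a'..b'}" for n z
  proof (cases "norm (fst z) \<le> \<rho> n")
    case True
    have "\<bar>u z \<bullet> X n (fst z)\<bar> \<le> norm (u z) * norm (X n (fst z))" by (rule Cauchy_Schwarz_ineq2)
    also have "\<dots> \<le> (C * (1 + norm (fst z))) * (4 * c n * 1 * norm (fst z))"
      using c0[of n] m1[of n "fst z"] C t unfolding X_def norm_scaleR
      by (intro mult_mono) (auto simp: abs_mult intro!: mult_left_le)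
    also have "\<dots> \<le> (C * (\<rho> n + \<rho> n)) * (4 * c n * 1 * \<rho> n)"
      using True \<rho>[of n] c0[of n] C by (intro mult_mono) auto
    also have "\<dots> = 8 * C" using \<rho>[of n] by (simp add: c_def power2_eq_square field_simps)
    finally show ?thesis .
  next
    case False
    then show ?thesis using m0[of n "fst z"] C by (simp add: X_def)
  qed
  have clim: "c \<longlonglongrightarrow> 0"
    unfolding c_def \<rho>_def using tendsto_power[OF LIMSEQ_inverse_real_of_nat, of 2] by simp
  have mlim: "(\<lambda>n. m n x) \<longlonglongrightarrow> 1" for x
  proof -
    have "(\<lambda>n. m n x) \<longlonglongrightarrow> max 0 (1 - 0 * (x \<bullet> x))" unfolding m_def by (intro tendsto_intros clim)
    then show ?thesis by simp
  qed
  have \<zeta>lim: "(\<lambda>n. \<zeta> n x) \<longlonglongrightarrow> 1" for x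
    using tendsto_power[OF mlim, of x 2] by (simp add: \<zeta>_def)
  have Xlim: "(\<lambda>n. v \<bullet> X n x) \<longlonglongrightarrow> 0" for x v
  proof -
    have "(\<lambda>n. v \<bullet> X n x) \<longlonglongrightarrow> v \<bullet> ((- 4 * 0 * 1) *\<^sub>R x)" unfolding X_def by (intro tendsto_intros clim mlim)
    then show ?thesis by simp
  qed
  define f where "f z = (vorticity z \<bullet> vorticity z) powr q" for z
  have cf: "continuous_on UNIV f" unfolding f_def
    by (rule continuous_on_powr') (use q in \<open>auto intro!: continuous_intros cont_w\<close>)
  have f0: "f z \<ge> 0" for z by (simp add: f_def)
  define g where "g z = indicator {a'..b'} (snd z) * f z" for z
  have ig: "integrable lborel g" using int by (simp add: g_def[abs_def] f_def)
  have cc: "continuous_on UNIV (\<lambda>z. \<eta> (snd z))" "continuous_on UNIV (\<lambda>z. \<eta>' (snd z))" for z :: "(real^3) \<times> real"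
    by (auto intro!: continuous_on_compose2[OF c\<eta>] continuous_on_compose2[OF \<eta>(2)] continuous_intros)
  have cz: "continuous_on UNIV (\<lambda>z::(real^3) \<times> real. \<zeta> n (fst z))" "continuous_on UNIV (\<lambda>z::(real^3) \<times> real. X n (fst z))" for n
    by (auto intro!: continuous_on_compose2[OF \<zeta>c] continuous_on_compose2[OF Xc] continuous_intros)
  have A: "(\<lambda>n. LBINT z. (\<eta>' (snd z) * \<zeta> n (fst z) + \<eta> (snd z) * (u z \<bullet> X n (fst z))) * f z) \<longlonglongrightarrow> (LBINT z. \<eta>' (snd z) * f z)"
  proof (rule integral_dominated_convergence)
    show "(\<lambda>z. \<eta>' (snd z) * f z) \<in> borel_measurable lborel" "(\<lambda>z. (\<eta>' (snd z) * \<zeta> n (fst z) + \<eta> (snd z) * (u z \<bullet> X n (fst z))) * f z) \<in> borel_measurable lborel" for n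
      by (auto intro!: borel_measurable_continuous_onI continuous_intros cc cz cf cont_u)
    show "integrable lborel (\<lambda>z. (E + E * (8 * C)) * g z)" using ig by simp
    show "AE z in lborel. (\<lambda>n. (\<eta>' (snd z) * \<zeta> n (fst z) + \<eta> (snd z) * (u z \<bullet> X n (fst z))) * f z) \<longlonglongrightarrow> \<eta>' (snd z) * f z"
    proof (rule AE_I2)
      fix z :: "(real^3) \<times> real"
      have "(\<lambda>n. (\<eta>' (snd z) * \<zeta> n (fst z) + \<eta> (snd z) * (u z \<bullet> X n (fst z))) * f z) \<longlonglongrightarrow> (\<eta>' (snd z) * 1 + \<eta> (snd z) * 0) * f z"
        by (intro tendsto_intros \<zeta>lim Xlim)
      then show "(\<lambda>n. (\<eta>' (snd z) * \<zeta> n (fst z) + \<eta> (snd z) * (u z \<bullet> X n (fst z))) * f z) \<longlonglongrightarrow> \<eta>' (snd z) * f z" by simp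
    qed
    show "AE z in lborel. norm ((\<eta>' (snd z) * \<zeta> n (fst z) + \<eta> (snd z) * (u z \<bullet> X n (fst z))) * f z) \<le> (E + E * (8 * C)) * g z" for n
    proof (rule AE_I2)
      fix z :: "(real^3) \<times> real"
      show "norm ((\<eta>' (snd z) * \<zeta> n (fst z) + \<eta> (snd z) * (u z \<bullet> X n (fst z))) * f z) \<le> (E + E * (8 * C)) * g z"
      proof (cases "snd z \<in> {a'..b'}")
        case True
        have "\<zeta> n (fst z) \<le> 1" "\<zeta> n (fst z) \<ge> 0" using m1[of n "fst z"] by (auto simp: \<zeta>_def power_le_one)
        then have "\<bar>\<eta>' (snd z) * \<zeta> n (fst z)\<bar> \<le> E * 1"
          unfolding abs_mult using E(2)[of "snd z"] True by (intro mult_mono) (auto simp: E_def)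
        moreover have "\<bar>\<eta> (snd z) * (u z \<bullet> X n (fst z))\<bar> \<le> E * (8 * C)"
          unfolding abs_mult using E(1)[of "snd z"] True Xb[OF True, of n] by (intro mult_mono) (auto simp: E_def)
        ultimately have "\<bar>\<eta>' (snd z) * \<zeta> n (fst z) + \<eta> (snd z) * (u z \<bullet> X n (fst z))\<bar> \<le> E + E * (8 * C)" by linarith
        then show ?thesis using True f0[of z] by (simp add: g_def abs_mult mult_right_mono)
      next
        case False
        then show ?thesis using \<eta>(3) \<eta>'0 by (simp add: g_def)
      qed
    qed
  qed
  have B: "(\<lambda>n. LBINT z. \<bar>\<eta> (snd z) * \<zeta> n (fst z)\<bar> * f z) \<longlonglongrightarrow> (LBINT z. \<bar>\<eta> (snd z)\<bar> * f z)"
  proof (rule integral_dominated_convergence)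
    show "(\<lambda>z. \<bar>\<eta> (snd z)\<bar> * f z) \<in> borel_measurable lborel" "(\<lambda>z. \<bar>\<eta> (snd z) * \<zeta> n (fst z)\<bar> * f z) \<in> borel_measurable lborel" for n
      by (auto intro!: borel_measurable_continuous_onI continuous_intros cc cz cf cont_u)
    show "integrable lborel (\<lambda>z. E * g z)" using ig by simp
    show "AE z in lborel. (\<lambda>n. \<bar>\<eta> (snd z) * \<zeta> n (fst z)\<bar> * f z) \<longlonglongrightarrow> \<bar>\<eta> (snd z)\<bar> * f z"
    proof (rule AE_I2)
      fix z :: "(real^3) \<times> real"
      have "(\<lambda>n. \<bar>\<eta> (snd z) * \<zeta> n (fst z)\<bar> * f z) \<longlonglongrightarrow> \<bar>\<eta> (snd z) * 1\<bar> * f z"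
        by (intro tendsto_intros \<zeta>lim)
      then show "(\<lambda>n. \<bar>\<eta> (snd z) * \<zeta> n (fst z)\<bar> * f z) \<longlonglongrightarrow> \<bar>\<eta> (snd z)\<bar> * f z" by simp
    qed
    show "AE z in lborel. norm (\<bar>\<eta> (snd z) * \<zeta> n (fst z)\<bar> * f z) \<le> E * g z" for n
    proof (rule AE_I2)
      fix z :: "(real^3) \<times> real"
      have "\<zeta> n (fst z) \<le> 1" "\<zeta> n (fst z) \<ge> 0" using m1[of n "fst z"] by (auto simp: \<zeta>_def power_le_one)
      then have "\<bar>\<eta> (snd z) * \<zeta> n (fst z)\<bar> \<le> (E * indicator {a'..b'} (snd z)) * 1"
        unfolding abs_mult using E(1)[of "snd z"] by (intro mult_mono) (auto simp: E_def intro: order_trans[OF abs_ge_zero])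
      then have "\<bar>\<eta> (snd z) * \<zeta> n (fst z)\<bar> * f z \<le> (E * indicator {a'..b'} (snd z)) * f z"
        using f0[of z] by (intro mult_right_mono) auto
      then show "norm (\<bar>\<eta> (snd z) * \<zeta> n (fst z)\<bar> * f z) \<le> E * g z" using f0[of z] by (simp add: g_def mult_ac)
    qed
  qed
  show ?thesis
    by (rule LIMSEQ_le[OF tendsto_rabs[OF A[unfolded f_def]] tendsto_mult_left[OF B[unfolded f_def]]]) (use loc in blast)
qed

end

section \<open>Linear substitution, Fubini and the limit of small powers\<close>

lemma absolutely_integrable_UNIV_lborel:
  fixes f :: "'a::euclidean_space \<Rightarrow> real"
  assumes "f \<in> borel_measurable borel"
  shows "f absolutely_integrable_on UNIV \<longleftrightarrow> integrable lborel f"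
  using assms by (simp add: set_integrable_def integrable_completion)

lemma integral_linear_substitution:
  fixes f :: "real^'n::{finite,wellorder} \<Rightarrow> real" and A :: "(real^'n::_)^('n::_)"
  assumes c: "continuous_on UNIV f" and i: "integrable lborel f" and A: "det A \<noteq> 0"
  shows "integrable lborel (\<lambda>x. f (A *v x))" "(LBINT x. f (A *v x)) = integral\<^sup>L lborel f / \<bar>det A\<bar>"
proof -
  have surj: "range ((*v) A) = UNIV"
    using A invertible_det_nz invertible_eq_bij bij_is_surj by blast
  have m[measurable]: "f \<in> borel_measurable borel" using c by (rule borel_measurable_continuous_onI)
  have c': "continuous_on UNIV (\<lambda>x. f (A *v x))"
    by (rule continuous_on_compose2[OF c matrix_vector_mult_linear_continuous_on]) auto
  then have m'[measurable]: "(\<lambda>x. f (A *v x)) \<in> borel_measurable borel" by (rule borel_measurable_continuous_onI)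
  let ?v = "\<lambda>x. vec (f x) :: real^1"
  have "f absolutely_integrable_on UNIV" using i m by (simp add: absolutely_integrable_UNIV_lborel)
  then have "?v absolutely_integrable_on range ((*v) A) \<and> integral (range ((*v) A)) ?v = vec (integral\<^sup>L lborel f)"
    unfolding surj absolutely_integrable_on_1_iff integral_on_1_eq using integral_lborel[OF i] by simp
  then have "(\<lambda>x. \<bar>det (matrix ((*v) A))\<bar> *\<^sub>R ?v (A *v x)) absolutely_integrable_on UNIV \<and>
     integral UNIV (\<lambda>x. \<bar>det (matrix ((*v) A))\<bar> *\<^sub>R ?v (A *v x)) = vec (integral\<^sup>L lborel f)"
    using has_absolute_integral_change_of_variables_linear[OF matrix_vector_mul_linear[of A], where f = ?v and S = UNIV] by blast
  then have 1: "(\<lambda>x. \<bar>det A\<bar> * f (A *v x)) absolutely_integrable_on UNIV"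
    and 2: "integral UNIV (\<lambda>x. \<bar>det A\<bar> * f (A *v x)) = integral\<^sup>L lborel f"
    unfolding absolutely_integrable_on_1_iff integral_on_1_eq by (auto simp: vec_eq_iff)
  have 3: "integrable lborel (\<lambda>x. \<bar>det A\<bar> * f (A *v x))"
    using 1 by (subst (asm) absolutely_integrable_UNIV_lborel) auto
  then show 4: "integrable lborel (\<lambda>x. f (A *v x))" using A by simp
  have "(LBINT x. \<bar>det A\<bar> * f (A *v x)) = integral\<^sup>L lborel f"
    using 2 integral_lborel[OF 3] by simp
  then show "(LBINT x. f (A *v x)) = integral\<^sup>L lborel f / \<bar>det A\<bar>" using A by (simp add: field_simps)
qed

text \<open>
The integrability over the time slab has to be derived from that of the slices; non-negativity and
the continuity of the slice integrals \<open>G\<close> provide it.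
\<close>

lemma time_fubini:
  fixes F :: "('a::euclidean_space) \<times> real \<Rightarrow> real"
  assumes F: "continuous_on UNIV F" "\<And>z. F z \<ge> 0"
    and slice: "\<And>t. t \<in> {a..b} \<Longrightarrow> integrable lborel (\<lambda>x. F (x, t))" "\<And>t. t \<in> {a..b} \<Longrightarrow> (LBINT x. F (x, t)) = G t"
    and G: "continuous_on {a..b} G"
  shows "integrable lborel (\<lambda>z. indicator {a..b} (snd z) * F z)"
    and "\<And>k. continuous_on UNIV k \<Longrightarrow> (\<And>t. t \<notin> {a..b} \<Longrightarrow> k t = 0) \<Longrightarrow> (LBINT z. k (snd z) * F z) = (LBINT t. k t * G t)"
proof -
  let ?g = "\<lambda>z::'a \<times> real. indicator {a..b} (snd z) * F z"
  have [measurable]: "F \<in> borel_measurable borel" using F(1) by (rule borel_measurable_continuous_onI)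
  have s: "integrable lborel (\<lambda>x. ?g (x, t))" "(LBINT x. ?g (x, t)) = indicator {a..b} t * G t" for t
    using slice[of t] by (cases "t \<in> {a..b}"; simp)+
  have iG: "integrable lborel (\<lambda>t. indicator {a..b} t *\<^sub>R G t)"
    using borel_integrable_compact[OF compact_Icc G] by simp
  have "integrable (lborel \<Otimes>\<^sub>M lborel) (\<lambda>(t, x). ?g (x, t))"
  proof (rule lborel_pair.Fubini_integrable)
    show "(\<lambda>(t, x). ?g (x, t)) \<in> borel_measurable (lborel \<Otimes>\<^sub>M lborel)"
    proof -
      have "(\<lambda>(t, x). ?g (x, t)) = (\<lambda>z::real \<times> 'a. indicator ({a..b} \<times> UNIV) z * F (snd z, fst z))"
        by (auto simp: indicator_def)
      moreover have "(\<lambda>z::real \<times> 'a. indicator ({a..b} \<times> UNIV) z * F (snd z, fst z)) \<in> borel_measurable borel"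
        by (intro borel_measurable_times borel_measurable_indicator borel_closed closed_Times borel_measurable_continuous_onI
            continuous_on_compose2[OF F(1)] continuous_intros) auto
      ultimately show ?thesis unfolding lborel_prod by simp
    qed
    have "(\<lambda>t. LBINT x. norm (case (t, x) of (t, x) \<Rightarrow> ?g (x, t))) = (\<lambda>t. indicator {a..b} t *\<^sub>R G t)"
      using s(2) F(2) by (auto simp: abs_mult)
    then show "integrable lborel (\<lambda>t. LBINT x. norm (case (t, x) of (t, x) \<Rightarrow> ?g (x, t)))" using iG by simp
    show "AE t in lborel. integrable lborel (\<lambda>x. case (t, x) of (t, x) \<Rightarrow> ?g (x, t))" using s(1) by simp
  qed
  then have "integrable (lborel \<Otimes>\<^sub>M lborel) ?g"
    using lborel_pair.integrable_product_swap_iff[of ?g] by (simp add: case_prod_unfold)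
  then show ig: "integrable lborel ?g" by (simp add: lborel_prod)
  fix k :: "real \<Rightarrow> real" assume k: "continuous_on UNIV k" "\<And>t. t \<notin> {a..b} \<Longrightarrow> k t = 0"
  have [measurable]: "k \<in> borel_measurable borel" using k(1) by (rule borel_measurable_continuous_onI)
  have "compact (k ` {a..b})" by (intro compact_continuous_image continuous_on_subset[OF k(1)]) auto
  then obtain E where "\<And>t. t \<in> {a..b} \<Longrightarrow> \<bar>k t\<bar> \<le> E" using compact_imp_bounded bounded_real by (metis imageI)
  then have E: "\<bar>k t\<bar> \<le> \<bar>E\<bar> * indicator {a..b} t" for t
    using k(2)[of t] by (cases "t \<in> {a..b}") (auto intro: order_trans[OF _ abs_ge_self])
  have "integrable lborel (\<lambda>z::'a \<times> real. k (snd z) * F z)"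
  proof (rule Bochner_Integration.integrable_bound[OF integrable_mult_right[OF ig, of "\<bar>E\<bar>"]])
    have "continuous_on UNIV (\<lambda>z::'a \<times> real. k (snd z) * F z)"
      by (intro continuous_intros F(1) continuous_on_compose2[OF k(1)]) auto
    then show "(\<lambda>z. k (snd z) * F z) \<in> borel_measurable lborel" by (auto intro: borel_measurable_continuous_onI)
    show "AE z in lborel. norm (k (snd z) * F z) \<le> norm (\<bar>E\<bar> * ?g z)"
    proof (rule AE_I2)
      fix z :: "'a \<times> real"
      have "\<bar>k (snd z)\<bar> * F z \<le> (\<bar>E\<bar> * indicator {a..b} (snd z)) * F z" using E F(2) by (rule mult_right_mono)
      then show "norm (k (snd z) * F z) \<le> norm (\<bar>E\<bar> * ?g z)" using F(2)[of z] by (simp add: abs_mult mult_ac)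
    qed
  qed
  then have "integrable (lborel \<Otimes>\<^sub>M lborel) (case_prod (\<lambda>x t. k t * F (x, t)))"
    by (simp add: lborel_prod case_prod_unfold)
  from lborel_pair.integral_snd[OF this]
  have "(LBINT z. k (snd z) * F z) = (LBINT t. LBINT x. k t * F (x, t))"
    by (simp add: lborel_prod case_prod_unfold)
  also have "\<dots> = (LBINT t. k t * G t)"
  proof (rule Bochner_Integration.integral_cong[OF refl])
    show "(LBINT x. k t * F (x, t)) = k t * G t" for t
      using slice(2)[of t] k(2)[of t] by (cases "t \<in> {a..b}") auto
  qed
  finally show "(LBINT z. k (snd z) * F z) = (LBINT t. k t * G t)" .
qed

text \<open>
The test function is taken with derivative \<open>\<kappa> (f - c)\<close>, where \<open>c\<close> is the mean of \<open>f\<close> for the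
weight \<open>\<kappa>\<close>. Then the hypothesis reads \<open>\<integral>\<kappa> (f - c)\<^sup>2 = 0\<close>.
\<close>

lemma du_Bois_Reymond:
  fixes f :: "real \<Rightarrow> real"
  assumes f: "continuous_on UNIV f" and ab: "a < b"
    and weak: "\<And>\<eta> \<eta>'. (\<And>t. (\<eta> has_real_derivative \<eta>' t) (at t)) \<Longrightarrow> continuous_on UNIV \<eta>' \<Longrightarrow>
       (\<And>t. t \<notin> {a..b} \<Longrightarrow> \<eta> t = 0) \<Longrightarrow> (LBINT t. \<eta>' t * f t) = 0"
  shows "\<exists>c. \<forall>t\<in>{a<..<b}. f t = c"
proof -
  \<comment> \<open>a weight that is positive exactly on the open interval\<close>
  define \<kappa> where "\<kappa> t = max 0 ((t - a) * (b - t))" for t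
  have \<kappa>c: "continuous_on UNIV \<kappa>" unfolding \<kappa>_def by (intro continuous_intros)
  have \<kappa>0: "\<kappa> t = 0" if "t \<notin> {a..b}" for t
  proof -
    have "(t - a) * (b - t) \<le> 0" using that ab by (auto simp: mult_le_0_iff)
    then show ?thesis by (simp add: \<kappa>_def)
  qed
  have \<kappa>n: "\<kappa> t \<ge> 0" for t by (simp add: \<kappa>_def)
  have \<kappa>p: "\<kappa> t > 0" if "t \<in> {a<..<b}" for t using that by (simp add: \<kappa>_def less_max_iff_disj)
  have int: "integrable lborel (\<lambda>t. \<kappa> t * h t)" if "continuous_on UNIV h" for h
    by (rule integrable_compact_support[OF _ compact_Icc[of a b]]) (auto intro!: continuous_intros \<kappa>c that simp: \<kappa>0)
  have i\<kappa>: "integrable lborel \<kappa>" using int[of "\<lambda>_. 1"] by simp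
  have I: "integral\<^sup>L lborel \<kappa> > 0"
    by (rule integral_pos_at[OF \<kappa>c \<kappa>n _ i\<kappa>, of "(a + b) / 2"]) (use ab in \<open>auto intro!: \<kappa>p\<close>)
  define c where "c = (LBINT t. \<kappa> t * f t) / integral\<^sup>L lborel \<kappa>"
  define g where "g t = \<kappa> t * (f t - c)" for t
  have gc: "continuous_on UNIV g" unfolding g_def by (intro continuous_intros \<kappa>c f)
  have g0: "g t = 0" if "t \<notin> {a..b}" for t using \<kappa>0[OF that] by (simp add: g_def)
  have ig: "integrable lborel g" unfolding g_def[abs_def] by (intro int continuous_intros f)
  have Ig: "integral\<^sup>L lborel g = 0"
  proof -
    have "integral\<^sup>L lborel g = (LBINT t. \<kappa> t * f t - c * \<kappa> t)" by (simp add: g_def[abs_def] algebra_simps)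
    also have "\<dots> = (LBINT t. \<kappa> t * f t) - c * integral\<^sup>L lborel \<kappa>" using int[OF f] i\<kappa> by simp
    finally show ?thesis using I by (simp add: c_def)
  qed
  obtain P where P: "\<And>t. (P has_vector_derivative g t) (at t)"
    proof -
    have "\<exists>P. \<forall>t::real. - \<infinity> < ereal t \<longrightarrow> ereal t < \<infinity> \<longrightarrow> (P has_vector_derivative g t) (at t)"
      by (rule einterval_antiderivative) (use gc in \<open>simp_all add: continuous_on_eq_continuous_at\<close>)
    then show ?thesis using that by auto
  qed
  have Pd: "(P has_real_derivative g t) (at t)" for t using P[of t] by (simp add: has_real_derivative_iff_has_vector_derivative)
  have left: "P t = P a" if "t < a" for t
  proof -
    have "\<exists>z>t. z < a \<and> P a - P t = (a - t) * g z" by (rule MVT2[OF that Pd])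
    then obtain z where "z > t" "z < a" "P a - P t = (a - t) * g z" by blast
    then show ?thesis using g0[of z] by simp
  qed
  have right: "P t = P b" if "b < t" for t
  proof -
    have "\<exists>z>b. z < t \<and> P t - P b = (t - b) * g z" by (rule MVT2[OF that Pd])
    then obtain z where "z > b" "z < t" "P t - P b = (t - b) * g z" by blast
    then show ?thesis using g0[of z] by simp
  qed
  have "(g has_integral (P b - P a)) {a..b}"
    by (rule fundamental_theorem_of_calculus) (use ab P in \<open>auto intro: has_vector_derivative_at_within\<close>)
  then have "integral {a..b} g = P b - P a" by (rule integral_unique)
  moreover have "integral\<^sup>L lborel g = integral (cbox a b) g"
    by (rule integral_lborel_cbox[OF gc compact_Icc[of a b] g0]) auto
  ultimately have Pab: "P b = P a" using Ig by simp
  have "(LBINT t. g t * f t) = 0"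
  proof (rule weak[of "\<lambda>t. P t - P a"])
    show "((\<lambda>t. P t - P a) has_real_derivative g t) (at t)" for t
      using DERIV_diff[OF Pd[of t] DERIV_const[of "P a"]] by simp
    show "P t - P a = 0" if "t \<notin> {a..b}" for t
      using that left[of t] right[of t] Pab by fastforce
  qed (fact gc)
  moreover have "integrable lborel (\<lambda>t. g t * f t)"
    by (rule integrable_compact_support[OF _ compact_Icc[of a b]]) (auto intro!: continuous_intros gc f simp: g0)
  ultimately have "(LBINT t. g t * f t - c * g t) = 0" using ig Ig by simp
  then have z: "(LBINT t. \<kappa> t * (f t - c)\<^sup>2) = 0" by (simp add: g_def power2_eq_square algebra_simps)
  have "f t = c" if t: "t \<in> {a<..<b}" for t
  proof (rule ccontr)
    assume "f t \<noteq> c"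
    then have "\<kappa> t * (f t - c)\<^sup>2 > 0" using \<kappa>p[OF t] by simp
    moreover have "integrable lborel (\<lambda>t. \<kappa> t * (f t - c)\<^sup>2)" by (intro int continuous_intros f)
    moreover have "continuous_on UNIV (\<lambda>t. \<kappa> t * (f t - c)\<^sup>2)" by (intro continuous_intros \<kappa>c f)
    ultimately have "(LBINT t. \<kappa> t * (f t - c)\<^sup>2) > 0"
      using integral_pos_at[of "\<lambda>t. \<kappa> t * (f t - c)\<^sup>2" t] \<kappa>n by simp
    then show False using z by simp
  qed
  then show ?thesis by blast
qed

text \<open>
The integral of \<open>|\<omega>(\<cdot>,t)|\<close> to the power \<open>2q\<close> is the number \<open>I\<close>, the same power integral of \<open>\<Omega>\<close>, times a function \<open>\<gamma> q t\<close> which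
tends to \<open>1/|det (\<Phi> t)|\<close> as \<open>q \<rightarrow> 0\<close>. As \<open>I\<close> is positive it cancels in the global balance, and it does not matter how \<open>I\<close>
behaves for small \<open>q\<close>.
\<close>

lemma (in velocity_field) determinant_locally_constant:
  fixes \<Psi> :: "real \<Rightarrow> real" and \<Phi> :: "real \<Rightarrow> real^3^3" and \<Omega> :: "real^3 \<Rightarrow> real^3"
  assumes time: "a < a'" "a' < b'" "b' < b"
    and rep: "\<And>x t. t \<in> {a'..b'} \<Longrightarrow> vorticity (x, t) = \<Psi> t *\<^sub>R \<Omega> (\<Phi> t *v x)"
    and \<Psi>: "continuous_on UNIV \<Psi>" "\<And>t. \<Psi> t > 0" and \<Phi>: "continuous_on UNIV \<Phi>" "\<And>t. det (\<Phi> t) \<noteq> 0"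
    and \<Omega>: "continuous_on UNIV \<Omega>" "\<Omega> y0 \<noteq> 0"
    and q1: "q1 > 0" and int: "\<And>q. 0 < q \<Longrightarrow> q < q1 \<Longrightarrow> integrable lborel (\<lambda>y. (\<Omega> y \<bullet> \<Omega> y) powr q)"
  shows "\<exists>c. \<forall>t\<in>{a'<..<b'}. 1 / \<bar>det (\<Phi> t)\<bar> = c"
proof -
  have cd: "continuous_on UNIV (\<lambda>t. det (\<Phi> t))"
    unfolding det_3 by (intro continuous_on_add continuous_on_diff continuous_on_mult continuous_on_component \<Phi>(1))
  have cdet: "continuous_on UNIV (\<lambda>t. 1 / \<bar>det (\<Phi> t)\<bar>)"
    by (intro continuous_intros cd) (simp add: \<Phi>(2))
  have weak: "(LBINT t. \<eta>' t * (1 / \<bar>det (\<Phi> t)\<bar>)) = 0"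
    if \<eta>: "\<And>t. (\<eta> has_real_derivative \<eta>' t) (at t)" "continuous_on UNIV \<eta>'" "\<And>t. t \<notin> {a'..b'} \<Longrightarrow> \<eta> t = 0"
    for \<eta> \<eta>' :: "real \<Rightarrow> real"
  proof -
  have c\<eta>: "continuous_on UNIV \<eta>" using DERIV_isCont[OF \<eta>(1)] by (simp add: continuous_on_eq_continuous_at)
  have \<eta>'0: "\<eta>' t = 0" if "t \<notin> {a'..b'}" for t
  proof -
    have "has_dderiv \<eta> 1 (\<eta>' t) t"
      using has_dderiv_has_derivative[OF \<eta>(1)[unfolded has_field_derivative_def], of 1] by simp
    from has_dderiv_zero_outside[OF compact_Icc \<eta>(3) this that] show ?thesis .
  qed
  define \<gamma> where "\<gamma> q t = (\<Psi> t * \<Psi> t) powr q / \<bar>det (\<Phi> t)\<bar>" for q t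
  have \<Psi>0: "\<Psi> t \<noteq> 0" for t using \<Psi>(2)[of t] by simp
  have c\<gamma>: "continuous_on UNIV (\<gamma> q)" for q
    unfolding \<gamma>_def by (intro continuous_intros cd \<Psi>(1)) (auto simp: \<Phi>(2) \<Psi>0)
  have main: "\<bar>LBINT t. \<eta>' t * \<gamma> q t\<bar> \<le> 2 * q * L * (LBINT t. \<bar>\<eta> t\<bar> * \<gamma> q t)" if q: "0 < q" "q < q1" "q \<le> 1" for q
  proof -
    define I where "I = (LBINT y. (\<Omega> y \<bullet> \<Omega> y) powr q)"
    have cq: "continuous_on UNIV (\<lambda>y. (\<Omega> y \<bullet> \<Omega> y) powr q)"
      by (rule continuous_on_powr') (use q in \<open>auto intro!: continuous_intros \<Omega>\<close>)
    have I: "I > 0" unfolding I_def by (rule integral_pos_at[OF cq _ _ int[OF q(1,2)], of y0]) (use \<Omega>(2) in auto)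
    have cw: "continuous_on UNIV (\<lambda>z. (vorticity z \<bullet> vorticity z) powr q)"
      by (rule continuous_on_powr') (use q in \<open>auto intro!: continuous_intros cont_w\<close>)
    have eq: "(vorticity (x, t) \<bullet> vorticity (x, t)) powr q = (\<Psi> t * \<Psi> t) powr q * (\<Omega> (\<Phi> t *v x) \<bullet> \<Omega> (\<Phi> t *v x)) powr q"
      if "t \<in> {a'..b'}" for x t
    proof -
      have "vorticity (x, t) \<bullet> vorticity (x, t) = (\<Psi> t * \<Psi> t) * (\<Omega> (\<Phi> t *v x) \<bullet> \<Omega> (\<Phi> t *v x))"
        unfolding rep[OF that] by simp
      then show ?thesis by (simp add: powr_mult)
    qed
    have slice: "integrable lborel (\<lambda>x. (vorticity (x, t) \<bullet> vorticity (x, t)) powr q)"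
      "(LBINT x. (vorticity (x, t) \<bullet> vorticity (x, t)) powr q) = I * \<gamma> q t" if "t \<in> {a'..b'}" for t
      using integral_linear_substitution[OF cq int[OF q(1,2)] \<Phi>(2)[of t]] unfolding eq[OF that]
      by (simp_all add: I_def \<gamma>_def)
    have cG: "continuous_on {a'..b'} (\<lambda>t. I * \<gamma> q t)"
      by (intro continuous_intros continuous_on_subset[OF c\<gamma>]) auto
    have fub1: "integrable lborel (\<lambda>z. indicator {a'..b'} (snd z) * (vorticity z \<bullet> vorticity z) powr q)"
      by (rule time_fubini(1)[OF cw powr_ge_zero slice cG])
    have fub2: "(LBINT z. k (snd z) * (vorticity z \<bullet> vorticity z) powr q) = (LBINT t. k t * (I * \<gamma> q t))"
      if "continuous_on UNIV k" "\<And>t. t \<notin> {a'..b'} \<Longrightarrow> k t = 0" for k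
      by (rule time_fubini(2)[OF cw powr_ge_zero slice cG that])
    have f1: "(LBINT z. \<eta>' (snd z) * (vorticity z \<bullet> vorticity z) powr q) = I * (LBINT t. \<eta>' t * \<gamma> q t)"
      using fub2[OF \<eta>(2) \<eta>'0] by (simp add: mult.left_commute)
    have "continuous_on UNIV (\<lambda>t. \<bar>\<eta> t\<bar>)" by (intro continuous_intros c\<eta>)
    from fub2[OF this] have f2: "(LBINT z. \<bar>\<eta> (snd z)\<bar> * (vorticity z \<bullet> vorticity z) powr q) = I * (LBINT t. \<bar>\<eta> t\<bar> * \<gamma> q t)"
      using \<eta>(3) by (simp add: mult.left_commute)
    have "\<bar>LBINT z. \<eta>' (snd z) * (vorticity z \<bullet> vorticity z) powr q\<bar> \<le> 2 * q * L * (LBINT z. \<bar>\<eta> (snd z)\<bar> * (vorticity z \<bullet> vorticity z) powr q)"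
      by (rule global_power_bound[OF time(1) less_imp_le[OF time(2)] time(3) \<eta> q(1,3) fub1])
    then have "I * \<bar>LBINT t. \<eta>' t * \<gamma> q t\<bar> \<le> I * (2 * q * L * (LBINT t. \<bar>\<eta> t\<bar> * \<gamma> q t))"
      unfolding f1 f2 using I by (simp add: abs_mult mult_ac)
    then show ?thesis using I by simp
  qed
  \<comment> \<open>exponents tending to 0 that are admissible in \<open>main\<close>\<close>
  define q where "q n = inverse (real (Suc n)) * min (q1 / 2) 1" for n
  have m: "min (q1 / 2) 1 > 0" using q1 by simp
  have q: "0 < q n" "q n < q1" "q n \<le> 1" for n
  proof -
    show "0 < q n" unfolding q_def using m by simp
    have "q n \<le> 1 * min (q1 / 2) 1" unfolding q_def using m by (intro mult_right_mono) (auto simp: inverse_le_1_iff)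
    then show "q n < q1" "q n \<le> 1" using q1 by auto
  qed
  have qlim: "q \<longlonglongrightarrow> 0" unfolding q_def by (rule tendsto_mult_left_zero[OF LIMSEQ_inverse_real_of_nat])
  have lim: "(\<lambda>n. LBINT t. k t * \<gamma> (q n) t) \<longlonglongrightarrow> (LBINT t. k t * (1 / \<bar>det (\<Phi> t)\<bar>))"
    if k: "continuous_on UNIV k" "\<And>t. t \<notin> {a'..b'} \<Longrightarrow> k t = 0" for k :: "real \<Rightarrow> real"
  proof (rule integral_dominated_convergence)
    show "(\<lambda>t. k t * (1 / \<bar>det (\<Phi> t)\<bar>)) \<in> borel_measurable lborel" "(\<lambda>t. k t * \<gamma> (q n) t) \<in> borel_measurable lborel" for n
      using continuous_on_mult[OF k(1) cdet] continuous_on_mult[OF k(1) c\<gamma>] by (auto intro: borel_measurable_continuous_onI)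
    show "integrable lborel (\<lambda>t. \<bar>k t\<bar> * ((1 + \<Psi> t * \<Psi> t) * (1 / \<bar>det (\<Phi> t)\<bar>)))"
      by (rule integrable_compact_support[OF _ compact_Icc[of a' b']]) (auto intro!: continuous_intros k \<Psi> cd simp: k(2) \<Phi>(2))
    show "AE t in lborel. (\<lambda>n. k t * \<gamma> (q n) t) \<longlonglongrightarrow> k t * (1 / \<bar>det (\<Phi> t)\<bar>)"
    proof (rule AE_I2)
      fix t
      have "(\<lambda>n. (\<Psi> t * \<Psi> t) powr (q n)) \<longlonglongrightarrow> (\<Psi> t * \<Psi> t) powr 0"
        using \<Psi>0[of t] by (intro tendsto_powr tendsto_const qlim) auto
      then have "(\<lambda>n. (\<Psi> t * \<Psi> t) powr (q n)) \<longlonglongrightarrow> 1" using \<Psi>0[of t] by simp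
      then show "(\<lambda>n. k t * \<gamma> (q n) t) \<longlonglongrightarrow> k t * (1 / \<bar>det (\<Phi> t)\<bar>)"
        unfolding \<gamma>_def using \<Phi>(2)[of t] by (intro tendsto_mult tendsto_divide tendsto_const) auto
    qed
    show "AE t in lborel. norm (k t * \<gamma> (q n) t) \<le> \<bar>k t\<bar> * ((1 + \<Psi> t * \<Psi> t) * (1 / \<bar>det (\<Phi> t)\<bar>))" for n
    proof (rule AE_I2)
      fix t
      have "(\<Psi> t * \<Psi> t) powr (q n) \<le> (1 + \<Psi> t * \<Psi> t) powr (q n)" using q[of n] by (intro powr_mono2) auto
      also have "\<dots> \<le> (1 + \<Psi> t * \<Psi> t) powr 1" using q[of n] by (intro powr_mono) auto
      finally have "(\<Psi> t * \<Psi> t) powr (q n) \<le> 1 + \<Psi> t * \<Psi> t" by (simp add: add_nonneg_nonneg)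
      then have "\<gamma> (q n) t \<le> (1 + \<Psi> t * \<Psi> t) * (1 / \<bar>det (\<Phi> t)\<bar>)"
        unfolding \<gamma>_def by (simp add: divide_right_mono)
      moreover have "\<gamma> (q n) t \<ge> 0" by (simp add: \<gamma>_def)
      ultimately show "norm (k t * \<gamma> (q n) t) \<le> \<bar>k t\<bar> * ((1 + \<Psi> t * \<Psi> t) * (1 / \<bar>det (\<Phi> t)\<bar>))"
        by (simp only: real_norm_def abs_mult) (intro mult_left_mono; simp)
    qed
  qed
  have "(\<lambda>n. \<bar>LBINT t. \<eta>' t * \<gamma> (q n) t\<bar>) \<longlonglongrightarrow> \<bar>LBINT t. \<eta>' t * (1 / \<bar>det (\<Phi> t)\<bar>)\<bar>"
    by (intro tendsto_rabs lim \<eta>(2) \<eta>'0)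
  moreover have "(\<lambda>n. 2 * q n * L * (LBINT t. \<bar>\<eta> t\<bar> * \<gamma> (q n) t)) \<longlonglongrightarrow> 2 * 0 * L * (LBINT t. \<bar>\<eta> t\<bar> * (1 / \<bar>det (\<Phi> t)\<bar>))"
    by (intro tendsto_mult tendsto_const qlim lim continuous_intros c\<eta>) (simp add: \<eta>(3))
  ultimately have "\<bar>LBINT t. \<eta>' t * (1 / \<bar>det (\<Phi> t)\<bar>)\<bar> \<le> 2 * 0 * L * (LBINT t. \<bar>\<eta> t\<bar> * (1 / \<bar>det (\<Phi> t)\<bar>))"
    by (rule LIMSEQ_le) (use main q in blast)
  then show "(LBINT t. \<eta>' t * (1 / \<bar>det (\<Phi> t)\<bar>)) = 0" by simp
  qed
  show ?thesis by (rule du_Bois_Reymond[OF cdet time(2) weak])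
qed

section \<open>Velocity fields of Euler solutions\<close>

text \<open>
Evaluation is jointly continuous in the function and the argument since convergence of functions is uniform. This
makes the Jacobian of a solution continuous in space-time.
\<close>

lemma continuous_on_apply_bcontfun_pair:
  fixes F :: "'z::topological_space \<Rightarrow> ('a::metric_space, 'b::metric_space) bcontfun"
  assumes F: "continuous_on S F" and g: "continuous_on S g"
  shows "continuous_on S (\<lambda>z. apply_bcontfun (F z) (g z))"
  unfolding continuous_on_def
proof
  fix z assume z: "z \<in> S"
  have "(F \<longlongrightarrow> F z) (at z within S)" using F z unfolding continuous_on_def by blast
  then have 1: "((\<lambda>x. dist (F x) (F z)) \<longlongrightarrow> 0) (at z within S)" by (rule tendsto_dist_iff[THEN iffD1])
  have "continuous_on S (\<lambda>x. apply_bcontfun (F z) (g x))"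
    by (rule continuous_on_compose2[OF continuous_on_apply_bcontfun[of UNIV "F z"] g]) simp
  then have "((\<lambda>x. apply_bcontfun (F z) (g x)) \<longlongrightarrow> apply_bcontfun (F z) (g z)) (at z within S)"
    using z unfolding continuous_on_def by blast
  then have 2: "((\<lambda>x. dist (apply_bcontfun (F z) (g x)) (apply_bcontfun (F z) (g z))) \<longlongrightarrow> 0) (at z within S)"
    by (rule tendsto_dist_iff[THEN iffD1])
  have "((\<lambda>x. dist (apply_bcontfun (F x) (g x)) (apply_bcontfun (F z) (g z))) \<longlongrightarrow> 0) (at z within S)"
  proof (rule tendsto_sandwich[OF _ _ tendsto_const])
    show "((\<lambda>x. dist (F x) (F z) + dist (apply_bcontfun (F z) (g x)) (apply_bcontfun (F z) (g z))) \<longlongrightarrow> 0) (at z within S)"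
      using tendsto_add[OF 1 2] by simp
    show "\<forall>\<^sub>F x in at z within S. dist (apply_bcontfun (F x) (g x)) (apply_bcontfun (F z) (g z)) \<le>
       dist (F x) (F z) + dist (apply_bcontfun (F z) (g x)) (apply_bcontfun (F z) (g z))"
      by (intro always_eventually allI order_trans[OF dist_triangle add_right_mono[OF dist_bounded]])
  qed simp
  then show "((\<lambda>z. apply_bcontfun (F z) (g z)) \<longlongrightarrow> apply_bcontfun (F z) (g z)) (at z within S)"
    by (rule tendsto_dist_iff[THEN iffD2])
qed

text \<open>
The time is frozen outside \<open>[a,b]\<close> by \<open>cl\<close>. On the supports of the admissible test fields \<open>cl\<close> is the identity, so the
momentum equation is unchanged there.
\<close>

lemma euler_velocity_field:
  fixes v :: "real^3 \<Rightarrow> real \<Rightarrow> real^3"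
  assumes C1: "cont_C1 T v" and sol: "euler_solution T v0 v" and ab: "0 < a" "a < b" "b < T"
  defines "cl \<equiv> \<lambda>t. max a (min b t)"
  obtains L where "velocity_field (\<lambda>z. v (fst z) (cl (snd z))) (\<lambda>z. jacobian (\<lambda>y. v y (cl (snd z))) (at (fst z))) L a b"
proof -
  define J where "J x t = jacobian (\<lambda>y. v y t) (at x)" for x t
  define B where "B t = Bcontfun (\<lambda>x. J x t)" for t
  have cl: "cl t \<in> {a..b}" "cl t \<in> {0..<T}" for t using ab by (auto simp: cl_def)
  have cl_id: "cl t = t" if "t \<in> {a..b}" for t using that by (auto simp: cl_def)
  have ccl: "continuous_on S f \<Longrightarrow> continuous_on S (\<lambda>z. cl (f z))" for S and f :: "(real^3) \<times> real \<Rightarrow> real"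
    unfolding cl_def by (intro continuous_intros)
  have BJ: "apply_bcontfun (B t) x = J x t" if "t \<in> {0..<T}" for x t
    using C1 that unfolding cont_C1_def B_def J_def by (subst Bcontfun_inverse) auto
  have cB: "continuous_on {0..<T} B"
    using C1 unfolding cont_C1_def B_def[abs_def] J_def by blast
  have "compact (B ` {a..b})"
    by (intro compact_continuous_image continuous_on_subset[OF cB] compact_Icc) (use ab in auto)
  then have "bounded (B ` {a..b})" by (rule compact_imp_bounded)
  then obtain N where "\<forall>f\<in>B ` {a..b}. norm f \<le> N" by (auto simp only: bounded_iff)
  then have N: "norm (B t) \<le> N" if "t \<in> {a..b}" for t using that by (rule bspec[OF _ imageI])
  obtain k where k: "k \<ge> 0" "\<And>(A::real^3^3) h. norm (A *v h) \<le> norm A * norm h * k"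
    using bounded_bilinear.nonneg_bounded[OF mat_vec_mult_bilinear] by blast
  have diffv: "((\<lambda>y. v y t) has_derivative (\<lambda>h. J x t *v h)) (at x)" if "t \<in> {0..<T}" for x t
  proof -
    have "(\<lambda>y. v y t) differentiable (at x)" using C1 that unfolding cont_C1_def by blast
    then show ?thesis unfolding J_def by (rule jacobian_works[THEN iffD1])
  qed
  have "velocity_field (\<lambda>z. v (fst z) (cl (snd z))) (\<lambda>z. J (fst z) (cl (snd z))) (N * k) a b"
  proof
    have "continuous_on (UNIV \<times> {0..<T}) (\<lambda>(x, t). v x t)" using C1 unfolding cont_C1_def by blast
    from continuous_on_compose2[OF this, of UNIV "\<lambda>z. (fst z, cl (snd z))"]
    show "continuous_on UNIV (\<lambda>z. v (fst z) (cl (snd z)))"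
      using cl(2) by (force intro!: continuous_intros ccl)
    have "continuous_on UNIV (\<lambda>z::(real^3) \<times> real. B (cl (snd z)))"
      by (rule continuous_on_compose2[OF cB]) (use cl(2) in \<open>auto intro!: ccl continuous_intros\<close>)
    from continuous_on_apply_bcontfun_pair[OF this continuous_on_fst[OF continuous_on_id]]
    show "continuous_on UNIV (\<lambda>z. J (fst z) (cl (snd z)))"
      using BJ[OF cl(2)] by simp
    show "((\<lambda>y. v (fst (y, t)) (cl (snd (y, t)))) has_derivative (\<lambda>h. J (fst (x, t)) (cl (snd (x, t))) *v h)) (at x)" for x t
      using diffv[OF cl(2)] by simp
    show "trace (J (fst z) (cl (snd z))) = 0" for z
      using sol cl(2)[of "snd z"] unfolding euler_solution_def divergence_def J_def by blast
    show "norm (J (fst z) (cl (snd z)) *v h) \<le> N * k * norm h" for z h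
    proof -
      have "norm (J (fst z) (cl (snd z))) \<le> N"
        using N[OF cl(1)] norm_bounded[of "B (cl (snd z))" "fst z"] BJ[OF cl(2)] order_trans by metis
      then have "norm (J (fst z) (cl (snd z))) * (norm h * k) \<le> N * (norm h * k)"
        using k(1) by (intro mult_right_mono) auto
      then show ?thesis using k(2)[of "J (fst z) (cl (snd z))" h] by (simp add: mult_ac)
    qed
    fix \<phi> :: "(real^3) \<times> real \<Rightarrow> real^3" and \<phi>' K
    assume \<phi>: "\<And>z. (\<phi> has_derivative \<phi>' z) (at z)" and c: "\<And>d. continuous_on UNIV (\<lambda>z. \<phi>' z d)"
      and K: "compact K" "K \<subseteq> UNIV \<times> {a<..<b}" "\<And>z. z \<notin> K \<Longrightarrow> \<phi> z = 0"
      and div0: "\<And>z. (\<Sum>i\<in>UNIV. \<phi>' z (axis i 1, 0) $ i) = 0"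
    have fd: "frechet_derivative \<phi> (at z) = \<phi>' z" for z using frechet_derivative_at[OF \<phi>] by simp
    have tf: "test_field T \<phi>"
      unfolding test_field_def fd
    proof (intro conjI allI exI[of _ K])
      show "\<phi> differentiable at z" for z
        using \<phi>[of z] unfolding differentiable_def by blast
      show "K \<subseteq> UNIV \<times> {0<..<T}" using K(2) ab by auto
    qed (use K c in auto)
    have dt: "vector_derivative (\<lambda>s. \<phi> (x, s)) (at t) = \<phi>' (x, t) (0, 1)" for x t
    proof -
      have "((\<lambda>s. (x, s)) has_vector_derivative (0, 1)) (at t)"
        by (auto intro!: derivative_eq_intros has_vector_derivative_Pair)
      then have "((\<lambda>s. \<phi> (x, s)) has_vector_derivative \<phi>' (x, t) (0, 1)) (at t)"
        using vector_derivative_diff_chain_within[of "\<lambda>s. (x, s)" "(0, 1)" t UNIV \<phi> "\<phi>' (x, t)"] \<phi>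
        by (auto simp: o_def intro: has_derivative_at_withinI)
      then show ?thesis by (rule vector_derivative_at)
    qed
    have div: "divergence (\<lambda>y. \<phi> (y, t)) x = 0" for x t
    proof -
      have "((\<lambda>y. (y, t)) has_derivative (\<lambda>h. (h, 0))) (at x)"
        by (auto intro!: derivative_eq_intros)
      from diff_chain_at[OF this \<phi>]
      have "((\<lambda>y. \<phi> (y, t)) has_derivative (\<lambda>h. \<phi>' (x, t) (h, 0))) (at x)" by (simp add: o_def)
      then have "frechet_derivative (\<lambda>y. \<phi> (y, t)) (at x) = (\<lambda>h. \<phi>' (x, t) (h, 0))"
        by (rule frechet_derivative_at[symmetric])
      then show ?thesis using div0[of "(x, t)"] by (simp add: divergence_def jacobian_def trace_def matrix_def)
    qed
    let ?U = "UNIV \<times> {0<..<T} :: ((real^3) \<times> real) set"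
    let ?f = "\<lambda>z. v (fst z) (cl (snd z)) \<bullet> \<phi>' z (0, 1) - (J (fst z) (cl (snd z)) *v v (fst z) (cl (snd z))) \<bullet> \<phi> z"
    obtain p where "momentum_eq T v p" using sol unfolding euler_solution_def by blast
    then have "(LINT (x, t) : ?U | lebesgue.
           v x t \<bullet> vector_derivative (\<lambda>s. \<phi> (x, s)) (at t)
           - convection (\<lambda>y. v y t) x \<bullet> \<phi> (x, t)
           + p x t * divergence (\<lambda>y. \<phi> (y, t)) x) = 0"
      using tf unfolding momentum_eq_def by blast
    moreover have "(indicator ?U z *\<^sub>R (case z of (x, t) \<Rightarrow>
           v x t \<bullet> vector_derivative (\<lambda>s. \<phi> (x, s)) (at t)
           - convection (\<lambda>y. v y t) x \<bullet> \<phi> (x, t)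
           + p x t * divergence (\<lambda>y. \<phi> (y, t)) x)) = ?f z" for z
    proof (cases "z \<in> K")
      case True
      then have "snd z \<in> {a<..<b}" using K(2) by auto
      then have "z \<in> ?U" "cl (snd z) = snd z" using ab cl_id by (auto simp: mem_Times_iff)
      then show ?thesis unfolding div dt convection_def J_def by (simp add: case_prod_unfold)
    next
      case False
      have "\<phi>' z (0, 1) = 0"
        by (rule has_dderiv_zero_outside[OF K(1) K(3) has_dderiv_has_derivative[OF \<phi>] False])
      then show ?thesis unfolding div dt using K(3)[OF False] by (simp add: case_prod_unfold)
    qed
    ultimately have leb: "integral\<^sup>L lebesgue ?f = 0"
      unfolding set_lebesgue_integral_def by simp
    have "continuous_on UNIV \<phi>" by (intro continuous_at_imp_continuous_on ballI has_derivative_continuous[OF \<phi>])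
    then have "continuous_on UNIV ?f"
      using \<open>continuous_on UNIV (\<lambda>z. v (fst z) (cl (snd z)))\<close> \<open>continuous_on UNIV (\<lambda>z. J (fst z) (cl (snd z)))\<close> c[of "(0, 1)"]
      by (intro continuous_intros bounded_bilinear.continuous_on[OF mat_vec_mult_bilinear])
    then have "?f \<in> borel_measurable lborel" by (auto intro: borel_measurable_continuous_onI)
    then show "integral\<^sup>L lborel ?f = 0" using leb integral_completion[of ?f lborel] by simp
  qed
  then show ?thesis unfolding J_def by (rule that)
qed

section \<open>The dichotomy\<close>

lemma norm_powr_double: "norm (x::'a::real_inner) powr (2 * q) = (x \<bullet> x) powr q"
proof (cases "x = 0")
  case False
  then have "norm x powr 2 = x \<bullet> x" by (simp add: dot_square_norm)
  then show ?thesis using powr_powr[of "norm x" 2 q] by simp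
qed simp

theorem theorem1p2:
  fixes T :: real
    and v :: "real^3 \<Rightarrow> real \<Rightarrow> real^3"
    and v\<^sub>0 :: "real^3 \<Rightarrow> real^3"
    and \<Psi> :: "real \<Rightarrow> real"
    and \<Phi> :: "real \<Rightarrow> real^3^3"
    and \<Omega> :: "real^3 \<Rightarrow> real^3"
  assumes "T > 0"
    and "cont_C1 T v"
    and "\<forall>x. divergence v\<^sub>0 x = 0"
    and "euler_solution T v\<^sub>0 v"
    and "\<forall>x. \<forall>t\<in>{0..<T}. curl (\<lambda>y. v y t) x = \<Psi> t *\<^sub>R \<Omega> (\<Phi> t *v x)"
    and "continuous_on {0..<T} \<Psi>" and "\<forall>t\<in>{0..<T}. \<Psi> t > 0"
    and "continuous_on {0..<T} \<Phi>" and "\<forall>t\<in>{0..<T}. det (\<Phi> t) \<noteq> 0"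
    and "\<exists>V. (\<forall>x. V differentiable (at x)) \<and> (\<forall>x. \<Omega> x = curl V x)"
    and "\<exists>p\<^sub>1>0. \<forall>p\<in>{0<..<p\<^sub>1}. in_Lp p \<Omega>"
  shows "(\<forall>t\<in>{0..<T}. det (\<Phi> t) = det (\<Phi> 0)) \<or> (\<forall>x. \<Omega> x = 0)"
proof (cases "\<forall>x. \<Omega> x = 0")
  case False
  then obtain y0 where y0: "\<Omega> y0 \<noteq> 0" by blast
  obtain p1 where p1: "p1 > 0" "\<And>p. 0 < p \<Longrightarrow> p < p1 \<Longrightarrow> in_Lp p \<Omega>" using assms(11) by auto
  define d where "d t = det (\<Phi> t)" for t
  have cd: "continuous_on {0..<T} d"
    unfolding d_def det_3 by (intro continuous_intros assms(8))
  have d0: "d t \<noteq> 0" if "t \<in> {0..<T}" for t using assms(9) that by (simp add: d_def)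
  have local: "\<exists>c. \<forall>t\<in>{a'<..<b'}. 1 / \<bar>d t\<bar> = c" if ab': "0 < a'" "a' < b'" "b' < T" for a' b'
  proof -
    \<comment> \<open>a slightly larger window, still inside \<open>(0,T)\<close>\<close>
    define a b where "a = a' / 2" and "b = (b' + T) / 2"
    have ab: "0 < a" "a < b" "b < T" "a < a'" "b' < b" using ab' by (auto simp: a_def b_def)
    define cl where "cl t = max a (min b t)" for t
    have cl: "cl t \<in> {0..<T}" for t using ab by (auto simp: cl_def)
    have ccl: "continuous_on UNIV cl" unfolding cl_def by (intro continuous_intros)
    obtain L where "velocity_field (\<lambda>z. v (fst z) (cl (snd z))) (\<lambda>z. jacobian (\<lambda>y. v y (cl (snd z))) (at (fst z))) L a b"
      by (rule euler_velocity_field[OF assms(2,4) ab(1-3), folded cl_def]) (rule that)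
    then interpret velocity_field "\<lambda>z. v (fst z) (cl (snd z))" "\<lambda>z. jacobian (\<lambda>y. v y (cl (snd z))) (at (fst z))" L a b .
    have rep: "vorticity (x, t) = \<Psi> (cl t) *\<^sub>R \<Omega> (\<Phi> (cl t) *v x)" for x t
    proof -
      have "vorticity (x, t) = curl (\<lambda>y. v y (cl t)) x" by (simp add: vorticity_def curl_of_def curl_def Let_def)
      then show ?thesis using assms(5) cl by simp
    qed
    have "invertible (\<Phi> (cl a))" using assms(9) cl invertible_det_nz by blast
    then obtain A where A: "\<Phi> (cl a) ** A = mat 1" unfolding invertible_def by blast
    have "\<Omega> y = (1 / \<Psi> (cl a)) *\<^sub>R vorticity (A *v y, a)" for y
    proof -
      have "\<Phi> (cl a) *v (A *v y) = y" by (simp add: matrix_vector_mul_assoc A)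
      moreover have "\<Psi> (cl a) \<noteq> 0" using assms(7) cl by (metis less_irrefl)
      ultimately show ?thesis unfolding rep by simp
    qed
    moreover have "continuous_on UNIV (\<lambda>y. (1 / \<Psi> (cl a)) *\<^sub>R vorticity (A *v y, a))"
      by (intro continuous_intros continuous_on_compose2[OF cont_w] matrix_vector_mult_linear_continuous_on) auto
    ultimately have c\<Omega>: "continuous_on UNIV \<Omega>" by (simp add: continuous_on_cong[of UNIV UNIV \<Omega>])
    have "\<exists>c. \<forall>t\<in>{a'<..<b'}. 1 / \<bar>det (\<Phi> (cl t))\<bar> = c"
    proof (rule determinant_locally_constant[OF ab(4) ab'(2) ab(5) rep _ _ _ _ c\<Omega> y0])
      show "continuous_on UNIV (\<lambda>t. \<Psi> (cl t))" by (rule continuous_on_compose2[OF assms(6) ccl]) (use cl in auto)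
      show "continuous_on UNIV (\<lambda>t. \<Phi> (cl t))" by (rule continuous_on_compose2[OF assms(8) ccl]) (use cl in auto)
      show "\<Psi> (cl t) > 0" "det (\<Phi> (cl t)) \<noteq> 0" for t using assms(7,9) cl by auto
      show "p1 / 2 > 0" using p1 by simp
      show "integrable lborel (\<lambda>y. (\<Omega> y \<bullet> \<Omega> y) powr q)" if "0 < q" "q < p1 / 2" for q
      proof -
        have "in_Lp (2 * q) \<Omega>" using p1(2)[of "2 * q"] that by simp
        then have 1: "integrable lebesgue (\<lambda>y. (\<Omega> y \<bullet> \<Omega> y) powr q)" by (simp add: in_Lp_def norm_powr_double)
        have "continuous_on UNIV (\<lambda>y. (\<Omega> y \<bullet> \<Omega> y) powr q)"
          by (rule continuous_on_powr') (use that in \<open>auto intro!: continuous_intros c\<Omega>\<close>)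
        then have "(\<lambda>y. (\<Omega> y \<bullet> \<Omega> y) powr q) \<in> borel_measurable lborel" by (auto intro: borel_measurable_continuous_onI)
        then show ?thesis using 1 integrable_completion by blast
      qed
    qed
    moreover have "cl t = t" if "t \<in> {a'<..<b'}" for t using that ab by (auto simp: cl_def)
    ultimately show ?thesis by (simp add: d_def)
  qed
  have const: "\<bar>d s\<bar> = \<bar>d t\<bar>" if st: "s \<in> {0<..<T}" "t \<in> {0<..<T}" for s t
  proof -
    obtain c where "\<forall>r\<in>{min s t / 2<..<(max s t + T) / 2}. 1 / \<bar>d r\<bar> = c"
      using local[of "min s t / 2" "(max s t + T) / 2"] st by fastforce
    moreover have "s \<in> {min s t / 2<..<(max s t + T) / 2}" "t \<in> {min s t / 2<..<(max s t + T) / 2}"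
      using st by (auto simp: min_def max_def)
    ultimately have "1 / \<bar>d s\<bar> = 1 / \<bar>d t\<bar>" by metis
    then show ?thesis by (simp add: divide_inverse)
  qed
  have abs0: "\<bar>d t\<bar> = \<bar>d 0\<bar>" if t: "t \<in> {0<..<T}" for t
  proof -
    have cl: "closure {0<..<T/2} = {0..T/2}" using assms(1) by (simp add: closure_greaterThanLessThan)
    have "continuous_on (closure {0<..<T/2}) (\<lambda>t. \<bar>d t\<bar>)"
      unfolding cl by (intro continuous_intros continuous_on_subset[OF cd]) (use assms(1) in auto)
    moreover have "\<bar>d s\<bar> = \<bar>d t\<bar>" if "s \<in> {0<..<T/2}" for s
      by (rule const[OF _ t]) (use that assms(1) in auto)
    ultimately have "\<bar>d 0\<bar> = \<bar>d t\<bar>"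
      by (rule continuous_constant_on_closure) (use cl assms(1) in auto)
    then show ?thesis by simp
  qed
  have "d t = d 0" if t: "t \<in> {0..<T}" for t
  proof (rule ccontr)
    assume ne: "d t \<noteq> d 0"
    then have t0: "t \<in> {0<..<T}" using t by (cases "t = 0") auto
    have c: "continuous_on {0..t} d" by (rule continuous_on_subset[OF cd]) (use t in auto)
    have "\<exists>x\<ge>0. x \<le> t \<and> d x = 0"
    proof (cases "d 0 \<le> 0")
      case True
      then show ?thesis using abs0[OF t0] ne t by (intro IVT'[OF _ _ _ c]) auto
    next
      case False
      then show ?thesis using abs0[OF t0] ne t by (intro IVT2'[OF _ _ _ c]) auto
    qed
    then show False using d0 t by force
  qed
  then show ?thesis unfolding d_def by blast
qed simp

end
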